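(* Let $\alpha\in\mathbb{N}$, $1<p<\infty$, $a>0$, $b\ge 0$ and $\theta>1$. Assume that for every real $m\ge 1$ there is a quadrature $I_m(f)=\sum_{i=1}^{\lfloor m\rfloor}\lambda_i f(\boldsymbol{x}_i)$ with nodes $\boldsymbol{x}_1,\ldots,\boldsymbol{x}_{\lfloor m\rfloor}\in(-\tfrac12,\tfrac12)^d$ (nodes and weights may depend on $\lfloor m\rfloor$) such that $$\Big|\int_{\mathbb{I}^d} f(\boldsymbol{x})\,\mathrm{d}\boldsymbol{x}-I_m(f)\Big|\le C\,m^{-a}\,\ell(m)^b\,\|f\|_{W^\alpha_p(\mathbb{I}^d)}\qquad\text{for all } f\in \mathring{W}^\alpha_p(\mathbb{I}^d),$$ with a constant $C$ independent of $m$ and $f$. For real $n\ge1$ let $I_{\theta,n}$ be the assembled quadrature on $\mathbb{R}^d$ built from the $I_m$ as described in the context (it has at most $n$ nodes). Then there is a constant $C'>0$ independent of $n$ and $f$ such that for all real $n\ge1$ $$\Big|\int_{\mathbb{R}^d} f(\boldsymbol{x})\,\gamma(\mathrm{d}\boldsymbol{x})-I_{\theta,n}(f)\Big|\le C'\,n^{-a}\,\ell(n)^b\,\|f\|_{W^\alpha_p(\mathbb{R}^d,\gamma)}\qquad\text{for all } f\in W^\alpha_p(\mathbb{R}^d,\gamma).$$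
   Context: Notation: $\log$ is the natural logarithm and $\ell(t):=\max\{1,\log t\}$ for $t\ge 1$. $\mathbb{I}^d=[-\tfrac12,\tfrac12]^d$. $\gamma(\mathrm{d}\boldsymbol{x})=g(\boldsymbol{x})\,\mathrm{d}\boldsymbol{x}$ is the standard Gaussian measure on $\mathbb{R}^d$, $g(\boldsymbol{x})=(2\pi)^{-d/2}\exp(-|\boldsymbol{x}|^2/2)$, $|\cdot|$ the Euclidean norm. Spaces: for measurable $\Omega\subset\mathbb{R}^d$, $\|f\|_{L_p(\Omega,\gamma)}=(\int_\Omega|f|^p g\,\mathrm{d}\boldsymbol{x})^{1/p}$. For $\alpha\in\mathbb{N}$, $W^\alpha_p(\Omega,\gamma)$ is the space of $f\in L_p(\Omega,\gamma)$ whose weak derivatives $D^{\boldsymbol{r}}f$ lie in $L_p(\Omega,\gamma)$ for all $\boldsymbol{r}\in\mathbb{N}_0^d$ with $|\boldsymbol{r}|_\infty\le\alpha$, with norm $\big(\sum_{|\boldsymbol{r}|_\infty\le\alpha}\|D^{\boldsymbol{r}}f\|_{L_p(\Omega,\gamma)}^p\big)^{1/p}$. $W^\alpha_p(\Omega)$ is defined in the same way with the unweighted $L_p(\Omega)$. $\mathring{W}^\alpha_p(\mathbb{I}^d)$ is the space of functions in $W^\alpha_p(\mathbb{R}^d)$ with support contained in $\mathbb{I}^d$. Point values refer to continuous representatives. Assembled quadrature: let $\mathbb{I}^d_\theta=[-\tfrac\theta2,\tfrac\theta2]^d$ and $\mathbb{I}^d_{\theta,\boldsymbol{k}}=\boldsymbol{k}+\mathbb{I}^d_\theta$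 for $\boldsymbol{k}\in\mathbb{Z}^d$. Fix a partition of unity $\{\varphi_{\boldsymbol{k}}\}_{\boldsymbol{k}\in\mathbb{Z}^d}$ with: (i) $\varphi_{\boldsymbol{k}}\in C_0^\infty(\mathbb{R}^d)$, $0\le\varphi_{\boldsymbol{k}}\le1$; (ii) $\operatorname{supp}\varphi_{\boldsymbol{k}}$ is contained in the interior of $\mathbb{I}^d_{\theta,\boldsymbol{k}}$; (iii) $\sum_{\boldsymbol{k}}\varphi_{\boldsymbol{k}}=1$ on $\mathbb{R}^d$; (iv) $\|\varphi_{\boldsymbol{k}}\|_{W^\alpha_p(\mathbb{I}^d_{\theta,\boldsymbol{k}})}\le C_{\alpha,d,\theta}$ for all $\boldsymbol{k}$. For $x\in\mathbb{R}$ put $\operatorname{sign}x=1$ if $x\ge0$ and $-1$ otherwise, $\operatorname{sign}\boldsymbol{k}=(\operatorname{sign}k_1,\ldots,\operatorname{sign}k_d)$. Fix $\tau$ with $1<\tau<p$ and $\delta>0$ such that, for some constant $C$ and all $\boldsymbol{k}\in\mathbb{Z}^d$, $$\max\Big\{e^{-\frac{|\boldsymbol{k}-(\theta\operatorname{sign}\boldsymbol{k})/2|^2}{2}(1-\frac1p)},\;e^{\frac{|\boldsymbol{k}+(\theta\operatorname{sign}\boldsymbol{k})/2|^2}{2p}-\frac{|\boldsymbol{k}|^2}{2\tau}}\Big\}\le C e^{-\delta|\boldsymbol{k}|^2}.$$ For real $n\ge1$ put $\xi_n=\sqrt{2a\delta^{-1}\log n}$, and $n_{\boldsymbol{k}}=\varrho\,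 n\, e^{-\frac{\delta}{2a}|\boldsymbol{k}|^2}$ if $|\boldsymbol{k}|<\xi_n$, $n_{\boldsymbol{k}}=0$ otherwise, where $\varrho=2^{-d}(1-e^{-\delta/(2a)})^d$ (so that $\sum_{\boldsymbol{k}}n_{\boldsymbol{k}}\le n$). Define $$I_{\theta,n}(f)=\sum_{|\boldsymbol{k}|<\xi_n}\sum_{j=1}^{\lfloor n_{\boldsymbol{k}}\rfloor}\lambda_{\theta,\boldsymbol{k},j}\,f(\boldsymbol{x}_{\theta,\boldsymbol{k},j}),\qquad \boldsymbol{x}_{\theta,\boldsymbol{k},j}=\theta\boldsymbol{x}_j+\boldsymbol{k},\quad \lambda_{\theta,\boldsymbol{k},j}=\theta^d\lambda_j\,g(\boldsymbol{x}_{\theta,\boldsymbol{k},j})\,\varphi_{\boldsymbol{k}}(\boldsymbol{x}_{\theta,\boldsymbol{k},j}),$$ where $\boldsymbol{k}$ ranges over $\mathbb{Z}^d$, in the summand for $\boldsymbol{k}$ the $\boldsymbol{x}_j,\lambda_j$ are the nodes and weights of $I_{\lfloor n_{\boldsymbol{k}}\rfloor}$, and empty sums are $0$. *)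

theory Defs
  imports "HOL-Analysis.Analysis"
begin

text \<open>
  Throughout, \<open>\<real>\<^sup>d\<close> is \<open>real ^ 'n\<close> with \<open>d = CARD('n)\<close>; multi-indices have type \<open>nat ^ 'n\<close> and
  lattice points type \<open>int ^ 'n\<close>.
\<close>

subsection \<open>Smooth functions\<close>

definition partial_deriv :: "'n \<Rightarrow> (real ^ 'n \<Rightarrow> real) \<Rightarrow> real ^ 'n \<Rightarrow> real" where
  "partial_deriv i f x = frechet_derivative f (at x) (axis i 1)"

fun iter_partial :: "'n list \<Rightarrow> (real ^ 'n \<Rightarrow> real) \<Rightarrow> real ^ 'n \<Rightarrow> real" where
  "iter_partial [] f = f"
| "iter_partial (i # is) f = partial_deriv i (iter_partial is f)"

definition smooth :: "(real ^ 'n \<Rightarrow> real) \<Rightarrow> bool" where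
  "smooth f \<longleftrightarrow> (\<forall>is x. iter_partial is f differentiable (at x))"

text \<open>
  The classical derivative \<open>D\<^sup>r\<close>, only used for smooth functions. An arbitrary order of
  differentiation is chosen; for smooth functions the order is irrelevant.
\<close>

definition multi_deriv :: "nat ^ 'n \<Rightarrow> (real ^ 'n \<Rightarrow> real) \<Rightarrow> real ^ 'n \<Rightarrow> real" where
  "multi_deriv r f = iter_partial (SOME is. \<forall>i. count_list is i = r $ i) f"

definition supp :: "(real ^ 'n \<Rightarrow> real) \<Rightarrow> (real ^ 'n) set" where
  "supp f = closure {x. f x \<noteq> 0}"

definition test_functions :: "(real ^ 'n) set \<Rightarrow> (real ^ 'n \<Rightarrow> real) set" where
  "test_functions U = {\<psi>. smooth \<psi> \<and> compact (supp \<psi>) \<and> supp \<psi> \<subseteq> U}"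

subsection \<open>Lebesgue and Sobolev spaces\<close>

text \<open>
  Elements of the spaces are functions, not classes modulo null sets. Functions on \<open>\<Omega>\<close> are total
  functions whose values outside \<open>\<Omega>\<close> are ignored.
\<close>

definition lp_space :: "real \<Rightarrow> 'a measure \<Rightarrow> ('a \<Rightarrow> real) set" where
  "lp_space p M = {f \<in> borel_measurable M. integrable M (\<lambda>x. \<bar>f x\<bar> powr p)}"

definition lp_norm :: "real \<Rightarrow> 'a measure \<Rightarrow> ('a \<Rightarrow> real) \<Rightarrow> real" where
  "lp_norm p M f = (LINT x|M. \<bar>f x\<bar> powr p) powr (1 / p)"

definition gauss_density :: "real ^ 'n \<Rightarrow> real" where
  "gauss_density x = (2 * pi) powr (- (real CARD('n) / 2)) * exp (- (norm x)\<^sup>2 / 2)"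

definition gauss_measure :: "(real ^ 'n) measure" where
  "gauss_measure = density lebesgue (\<lambda>x. ennreal (gauss_density x))"

definition locally_integrable :: "(real ^ 'n) set \<Rightarrow> (real ^ 'n \<Rightarrow> real) \<Rightarrow> bool" where
  "locally_integrable U f \<longleftrightarrow> (\<forall>K. compact K \<and> K \<subseteq> U \<longrightarrow> set_integrable lebesgue K f)"

text \<open>
  Weak derivatives on \<open>\<Omega>\<close> are tested on the interior of \<open>\<Omega>\<close>, so they are determined up to null
  sets only if \<open>\<Omega>\<close> differs from its interior by a null set. Here \<open>\<Omega>\<close> is always the whole space
  or a closed cube.
\<close>

definition has_weak_deriv ::
  "(real ^ 'n) set \<Rightarrow> nat ^ 'n \<Rightarrow> (real ^ 'n \<Rightarrow> real) \<Rightarrow> (real ^ 'n \<Rightarrow> real) \<Rightarrow> bool" where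
  "has_weak_deriv \<Omega> r f u \<longleftrightarrow>
     locally_integrable (interior \<Omega>) f \<and> locally_integrable (interior \<Omega>) u \<and>
     (\<forall>\<psi> \<in> test_functions (interior \<Omega>).
        (LINT x:interior \<Omega>|lebesgue. f x * multi_deriv r \<psi> x) =
        (- 1) ^ (\<Sum>i\<in>UNIV. r $ i) * (LINT x:interior \<Omega>|lebesgue. u x * \<psi> x))"

definition weak_deriv ::
  "(real ^ 'n) set \<Rightarrow> nat ^ 'n \<Rightarrow> (real ^ 'n \<Rightarrow> real) \<Rightarrow> real ^ 'n \<Rightarrow> real" where
  "weak_deriv \<Omega> r f = (SOME u. has_weak_deriv \<Omega> r f u)"

text \<open>
  \<open>W\<^sup>\<alpha>\<^sub>p(\<Omega>, \<mu>)\<close> of mixed smoothness. The measure \<open>\<mu>\<close> (\<open>lebesgue\<close> or \<open>gauss_measure\<close>) only enters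
  the integrability conditions and the norms; weak derivatives are always taken with respect to
  Lebesgue measure.
\<close>

definition sobolev_space ::
  "nat \<Rightarrow> real \<Rightarrow> (real ^ 'n) set \<Rightarrow> (real ^ 'n) measure \<Rightarrow> (real ^ 'n \<Rightarrow> real) set" where
  "sobolev_space \<alpha> p \<Omega> \<mu> =
     {f \<in> lp_space p (restrict_space \<mu> \<Omega>).
        \<forall>r. (\<forall>i. r $ i \<le> \<alpha>) \<longrightarrow>
          (\<exists>u. has_weak_deriv \<Omega> r f u \<and> u \<in> lp_space p (restrict_space \<mu> \<Omega>))}"

definition sobolev_norm ::
  "nat \<Rightarrow> real \<Rightarrow> (real ^ 'n) set \<Rightarrow> (real ^ 'n) measure \<Rightarrow> (real ^ 'n \<Rightarrow> real) \<Rightarrow> real" where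
  "sobolev_norm \<alpha> p \<Omega> \<mu> f =
     (\<Sum>r | \<forall>i. r $ i \<le> \<alpha>. lp_norm p (restrict_space \<mu> \<Omega>) (weak_deriv \<Omega> r f) powr p) powr (1 / p)"

definition cube :: "real \<Rightarrow> (real ^ 'n) set" where
  "cube \<theta> = cbox (\<chi> i. - \<theta> / 2) (\<chi> i. \<theta> / 2)"

text \<open>
  For functions defined up to null sets, having support in the closed set \<open>cube 1\<close> means vanishing
  almost everywhere outside it.
\<close>

definition sobolev_space_cube0 :: "nat \<Rightarrow> real \<Rightarrow> (real ^ 'n \<Rightarrow> real) set" where
  "sobolev_space_cube0 \<alpha> p =
     {f \<in> sobolev_space \<alpha> p UNIV lebesgue. AE x in lebesgue. x \<notin> cube 1 \<longrightarrow> f x = 0}"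

text \<open>
  Point evaluations refer to this representative. It is unique if it exists, and it exists for
  every \<open>f\<close> in the Sobolev spaces with \<open>\<alpha> \<ge> 1\<close> and \<open>p > 1\<close> on the whole space.
\<close>

definition cont_rep :: "(real ^ 'n \<Rightarrow> real) \<Rightarrow> real ^ 'n \<Rightarrow> real" where
  "cont_rep f = (SOME h. continuous_on UNIV h \<and> (AE x in lebesgue. h x = f x))"

subsection \<open>Quadratures\<close>

definition ell :: "real \<Rightarrow> real" where
  "ell t = max 1 (ln t)"

text \<open>
  A family of quadratures: \<open>X N i\<close> and \<open>\<Lambda> N i\<close> (\<open>1 \<le> i \<le> N\<close>) are the nodes and weights of the
  \<open>N\<close>-point rule.
\<close>

definition quadrature ::
  "(nat \<Rightarrow> nat \<Rightarrow> real ^ 'n) \<Rightarrow> (nat \<Rightarrow> nat \<Rightarrow> real) \<Rightarrow> real \<Rightarrow> (real ^ 'n \<Rightarrow> real) \<Rightarrow> real" where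
  "quadrature X \<Lambda> m f = (\<Sum>i = 1..nat \<lfloor>m\<rfloor>. \<Lambda> (nat \<lfloor>m\<rfloor>) i * f (X (nat \<lfloor>m\<rfloor>) i))"

definition lat :: "int ^ 'n \<Rightarrow> real ^ 'n" where
  "lat k = (\<chi> i. real_of_int (k $ i))"

definition shifted_cube :: "real \<Rightarrow> int ^ 'n \<Rightarrow> (real ^ 'n) set" where
  "shifted_cube \<theta> k = (\<lambda>x. lat k + x) ` cube \<theta>"

text \<open>Unlike \<open>sgn\<close>, this has value \<open>1\<close> at \<open>0\<close>.\<close>

definition sign_vec :: "real ^ 'n \<Rightarrow> real ^ 'n" where
  "sign_vec x = (\<chi> i. if x $ i \<ge> 0 then 1 else - 1)"

definition smooth_partition ::
  "nat \<Rightarrow> real \<Rightarrow> real \<Rightarrow> (int ^ 'n \<Rightarrow> real ^ 'n \<Rightarrow> real) \<Rightarrow> bool" where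
  "smooth_partition \<alpha> p \<theta> \<phi> \<longleftrightarrow>
     (\<forall>k. \<phi> k \<in> test_functions UNIV \<and> (\<forall>x. 0 \<le> \<phi> k x \<and> \<phi> k x \<le> 1)) \<and>
     (\<forall>k. supp (\<phi> k) \<subseteq> interior (shifted_cube \<theta> k)) \<and>
     (\<forall>x. ((\<lambda>k. \<phi> k x) has_sum 1) UNIV) \<and>
     (\<exists>C. \<forall>k. sobolev_norm \<alpha> p (shifted_cube \<theta> k) lebesgue (\<phi> k) \<le> C)"

definition decay_condition :: "'n::finite itself \<Rightarrow> real \<Rightarrow> real \<Rightarrow> real \<Rightarrow> real \<Rightarrow> bool" where
  "decay_condition _ p \<theta> \<tau> \<delta> \<longleftrightarrow>
     (\<exists>C. \<forall>k :: int ^ 'n.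
        max (exp (- ((norm (lat k - (\<theta> / 2) *\<^sub>R sign_vec (lat k)))\<^sup>2 / 2) * (1 - 1 / p)))
            (exp ((norm (lat k + (\<theta> / 2) *\<^sub>R sign_vec (lat k)))\<^sup>2 / (2 * p)
                  - (norm (lat k))\<^sup>2 / (2 * \<tau>)))
        \<le> C * exp (- \<delta> * (norm (lat k))\<^sup>2))"

definition xi :: "real \<Rightarrow> real \<Rightarrow> real \<Rightarrow> real" where
  "xi a \<delta> n = sqrt (2 * a * inverse \<delta> * ln n)"

definition n_at :: "real \<Rightarrow> real \<Rightarrow> real \<Rightarrow> int ^ 'n \<Rightarrow> real" where
  "n_at a \<delta> n k =
     (if norm (lat k) < xi a \<delta> n
      then inverse (2 ^ CARD('n)) * (1 - exp (- \<delta> / (2 * a))) ^ CARD('n)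
             * n * exp (- (\<delta> / (2 * a)) * (norm (lat k))\<^sup>2)
      else 0)"

definition assembled_quadrature ::
  "real \<Rightarrow> real \<Rightarrow> real \<Rightarrow> (int ^ 'n \<Rightarrow> real ^ 'n \<Rightarrow> real) \<Rightarrow>
   (nat \<Rightarrow> nat \<Rightarrow> real ^ 'n) \<Rightarrow> (nat \<Rightarrow> nat \<Rightarrow> real) \<Rightarrow> real \<Rightarrow> (real ^ 'n \<Rightarrow> real) \<Rightarrow> real" where
  "assembled_quadrature a \<delta> \<theta> \<phi> X \<Lambda> n f =
     (\<Sum>k | norm (lat k) < xi a \<delta> n.
        let N = nat \<lfloor>n_at a \<delta> n k\<rfloor> in
        \<Sum>j = 1..N.
          let x = \<theta> *\<^sub>R X N j + lat k in
          (\<theta> ^ CARD('n) * \<Lambda> N j * gauss_density x * \<phi> k x) * f x)"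

end

theory Submission
  imports Defs "HOL-Probability.Distributions"
begin

text \<open>
  The integral of \<open>f\<close> against the Gaussian measure splits, by the partition of unity, into the
  integrals of the localized functions \<open>F\<^sub>k = f g \<phi>\<^sub>k\<close>, and the assembled quadrature applies to
  each of them a scaled copy of the rule on the unit cube. The whole proof rests on one estimate
  (\<open>localized_norm\<close>): the function \<open>x \<mapsto> F\<^sub>k (\<theta> x + k)\<close> lies in the Sobolev space of the unit cube
  with support in it, and its norm is at most \<open>C exp (- \<delta> |k|\<^sup>2)\<close> times the Gaussian Sobolev norm
  of \<open>f\<close>. A rule with \<open>n\<^sub>k = \<rho> n exp (- \<delta> |k|\<^sup>2 / (2a))\<close> nodes loses the factor
  \<open>n\<^sub>k\<^sup>-\<^sup>a = \<rho>\<^sup>-\<^sup>a n\<^sup>-\<^sup>a exp (\<delta> |k|\<^sup>2 / 2)\<close>, so the \<open>k\<close>-th error is at most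
  \<open>C n\<^sup>-\<^sup>a (ell n)\<^sup>b exp (- \<delta> |k|\<^sup>2 / 2)\<close> (\<open>node_rate\<close>). The cubes that receive no node obey the
  same bound, since for them \<open>exp (- \<delta> |k|\<^sup>2 / 2)\<close> is itself at most of order \<open>n\<^sup>-\<^sup>a\<close>
  (\<open>tail_rate\<close>). The sum over the lattice converges (\<open>lattice_gauss_sum\<close>), and the same lattice
  sum bounds the number of nodes.

  The norm estimate has two sources of difficulty. First, the exponential decay: every derivative of
  the density \<open>g\<close> is a polynomial times \<open>g\<close>, and \<open>g = g\<^bsup>1-1/p\<^esup> g\<^bsup>1/p\<^esup>\<close>; the factor
  \<open>g\<^bsup>1/p\<^esup>\<close> turns Lebesgue norms into Gaussian norms, and the other factor, with the polynomial,
  is \<open>O(exp (- \<delta> |k|\<^sup>2))\<close> on the cube because the decay condition forces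
  \<open>\<delta> < (1 - 1/p)/2\<close> (\<open>decay_condition_exponent\<close>, \<open>gauss_derivative_decay\<close>). Second, of the functions
  \<open>\<phi>\<^sub>k\<close> only the norms in the Sobolev space itself are bounded uniformly in \<open>k\<close>, so products have to
  be controlled by the fact that the space of dominating mixed smoothness \<open>\<alpha> \<ge> 1\<close> is a
  multiplication algebra on a cube (\<open>sobolev_algebra\<close>). In a product \<open>D\<^sup>s u D\<^sup>t \<phi>\<close> with
  \<open>s + t \<le> \<alpha>\<close>, each coordinate direction admits one more derivative of at least one of the
  two factors, and this derivative controls the supremum of that factor in that direction. After taking
  suprema the two factors depend on complementary sets of variables, so the integral of their product
  is the product of their integrals (\<open>mixed_product_smooth\<close>). The passage to weakly differentiable \<open>u\<close>
  is by mollification (\<open>mixed_product_weak\<close>), and the same one-dimensional inequality yields the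
  continuous representative in which point values are taken (\<open>continuous_representative\<close>).

  Weak derivatives are handled along lists of directions, which makes the Leibniz rule a sum over the
  ways to split a list in two. The mollifier is a normalized member of the partition of unity
  (\<open>partition_mollifier\<close>).
\<close>

section \<open>Iterated partial derivatives of smooth functions\<close>

lemma partial_deriv_eq:
  "(f has_derivative f') (at x) \<Longrightarrow> partial_deriv i f x = f' (axis i 1)"
  unfolding partial_deriv_def by (metis frechet_derivative_at)

lemma partial_deriv_DERIV:
  assumes "f differentiable (at (x + t *\<^sub>R axis i 1))"
  shows "((\<lambda>t. f (x + t *\<^sub>R axis i 1)) has_field_derivative partial_deriv i f (x + t *\<^sub>R axis i 1)) (at t)"
proof -
  have 1: "(f has_derivative frechet_derivative f (at (x + t *\<^sub>R axis i 1))) (at (x + t *\<^sub>R axis i 1))"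
    using assms by (simp add: frechet_derivative_works)
  have 2: "((\<lambda>t. x + t *\<^sub>R axis i 1) has_derivative (\<lambda>h. h *\<^sub>R axis i 1)) (at t)"
    by (auto intro!: derivative_eq_intros)
  have 3: "linear (frechet_derivative f (at (x + t *\<^sub>R axis i 1)))"
    using 1 has_derivative_linear by blast
  show ?thesis
    unfolding has_field_derivative_def partial_deriv_def
    using has_derivative_compose[OF 2 1] linear_scale[OF 3] by (simp add: mult.commute[of _ "frechet_derivative f _ _"])
qed

lemma iter_partial_append: "iter_partial (is @ js) f = iter_partial is (iter_partial js f)"
  by (induction "is") auto

lemma smooth_differentiable: "smooth f \<Longrightarrow> f differentiable (at x)"
  unfolding smooth_def by (metis iter_partial.simps(1))

lemma smooth_iter_partial: "smooth f \<Longrightarrow> smooth (iter_partial is f)"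
  unfolding smooth_def by (metis iter_partial_append)

lemma smooth_partial_deriv: "smooth f \<Longrightarrow> smooth (partial_deriv i f)"
  using smooth_iter_partial[of f "[i]"] by simp

lemma smooth_continuous: "smooth f \<Longrightarrow> continuous_on S f"
  by (meson continuous_at_imp_continuous_on differentiable_imp_continuous_within smooth_differentiable)

lemma smooth_DERIV:
  "smooth f \<Longrightarrow> ((\<lambda>t. f (x + t *\<^sub>R axis i 1)) has_field_derivative partial_deriv i f (x + t *\<^sub>R axis i 1)) (at t)"
  by (rule partial_deriv_DERIV) (rule smooth_differentiable)

text \<open>
  The second difference quotient in two directions is a second partial derivative at a nearby point,
  by the mean value theorem in each variable. Both orders of differentiation share the left-hand side.
\<close>

lemma smooth_double_difference:
  assumes f: "smooth f" and h: "0 < h"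
  obtains \<xi> \<eta> where "0 < \<xi>" "\<xi> < h" "0 < \<eta>" "\<eta> < h"
    "f (x + h *\<^sub>R axis i 1 + h *\<^sub>R axis j 1) - f (x + h *\<^sub>R axis i 1) - f (x + h *\<^sub>R axis j 1) + f x
      = h\<^sup>2 * partial_deriv j (partial_deriv i f) (x + \<xi> *\<^sub>R axis i 1 + \<eta> *\<^sub>R axis j 1)"
proof -
  let ?F = "\<lambda>s. f ((x + h *\<^sub>R axis j 1) + s *\<^sub>R axis i 1) - f (x + s *\<^sub>R axis i 1)"
  let ?F' = "\<lambda>s. partial_deriv i f ((x + h *\<^sub>R axis j 1) + s *\<^sub>R axis i 1) - partial_deriv i f (x + s *\<^sub>R axis i 1)"
  have "(?F has_field_derivative ?F' s) (at s)" for s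
    by (intro DERIV_diff smooth_DERIV f)
  from MVT2[OF h this] obtain \<xi> where \<xi>: "0 < \<xi>" "\<xi> < h" "?F h - ?F 0 = (h - 0) * ?F' \<xi>"
    by blast
  let ?G = "\<lambda>t. partial_deriv i f ((x + \<xi> *\<^sub>R axis i 1) + t *\<^sub>R axis j 1)"
  let ?G' = "\<lambda>t. partial_deriv j (partial_deriv i f) ((x + \<xi> *\<^sub>R axis i 1) + t *\<^sub>R axis j 1)"
  have "(?G has_field_derivative ?G' s) (at s)" for s
    by (intro smooth_DERIV smooth_partial_deriv f)
  from MVT2[OF h this] obtain \<eta> where \<eta>: "0 < \<eta>" "\<eta> < h" "?G h - ?G 0 = (h - 0) * ?G' \<eta>"
    by blast
  have "?F' \<xi> = h * ?G' \<eta>"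
    using \<eta>(3) by (simp add: algebra_simps)
  then have "?F h - ?F 0 = h\<^sup>2 * ?G' \<eta>"
    using \<xi>(3) by (simp add: power2_eq_square)
  then show thesis
    using \<xi>(1,2) \<eta>(1,2) by (intro that[of \<xi> \<eta>]) (simp_all add: algebra_simps)
qed

lemma partial_deriv_commute:
  assumes f: "smooth f"
  shows "partial_deriv i (partial_deriv j f) x = partial_deriv j (partial_deriv i f) x"
proof -
  let ?A = "partial_deriv i (partial_deriv j f)" and ?B = "partial_deriv j (partial_deriv i f)"
  have cont: "isCont ?A x" "isCont ?B x"
    using smooth_continuous[of ?A UNIV] smooth_continuous[of ?B UNIV] f
    by (auto simp: smooth_partial_deriv continuous_on_eq_continuous_at)
  define h where "h n = 1 / real (Suc n)" for n
  have h: "0 < h n" for n by (simp add: h_def)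
  have "\<forall>n. \<exists>a b. dist a x \<le> 2 * h n \<and> dist b x \<le> 2 * h n \<and> ?A a = ?B b"
  proof
    fix n
    obtain \<xi> \<eta> where 1: "0 < \<xi>" "\<xi> < h n" "0 < \<eta>" "\<eta> < h n"
     "f (x + h n *\<^sub>R axis i 1 + h n *\<^sub>R axis j 1) - f (x + h n *\<^sub>R axis i 1) - f (x + h n *\<^sub>R axis j 1) + f x
      = (h n)\<^sup>2 * ?B (x + \<xi> *\<^sub>R axis i 1 + \<eta> *\<^sub>R axis j 1)"
      using smooth_double_difference[OF f h] .
    obtain \<xi>' \<eta>' where 2: "0 < \<xi>'" "\<xi>' < h n" "0 < \<eta>'" "\<eta>' < h n"
     "f (x + h n *\<^sub>R axis j 1 + h n *\<^sub>R axis i 1) - f (x + h n *\<^sub>R axis j 1) - f (x + h n *\<^sub>R axis i 1) + f x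
      = (h n)\<^sup>2 * ?A (x + \<xi>' *\<^sub>R axis j 1 + \<eta>' *\<^sub>R axis i 1)"
      using smooth_double_difference[OF f h] .
    have "f (x + h n *\<^sub>R axis i 1 + h n *\<^sub>R axis j 1) = f (x + h n *\<^sub>R axis j 1 + h n *\<^sub>R axis i 1)"
      by (simp add: algebra_simps)
    then have "(h n)\<^sup>2 * ?A (x + \<xi>' *\<^sub>R axis j 1 + \<eta>' *\<^sub>R axis i 1) = (h n)\<^sup>2 * ?B (x + \<xi> *\<^sub>R axis i 1 + \<eta> *\<^sub>R axis j 1)"
      using 1(5) 2(5) by linarith
    then have eq: "?A (x + \<xi>' *\<^sub>R axis j 1 + \<eta>' *\<^sub>R axis i 1) = ?B (x + \<xi> *\<^sub>R axis i 1 + \<eta> *\<^sub>R axis j 1)"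
      using h[of n] by simp
    have d: "dist (x + s *\<^sub>R axis k 1 + t *\<^sub>R axis l 1) x \<le> 2 * h n"
      if "0 < s" "s < h n" "0 < t" "t < h n" for s t k l
    proof -
      have "norm (s *\<^sub>R axis k 1 + t *\<^sub>R axis l 1 :: real^'a) \<le> \<bar>s\<bar> + \<bar>t\<bar>"
        by (rule norm_triangle_le) (simp add: norm_axis_1)
      then show ?thesis using that by (simp add: dist_norm algebra_simps)
    qed
    show "\<exists>a b. dist a x \<le> 2 * h n \<and> dist b x \<le> 2 * h n \<and> ?A a = ?B b"
      using eq d 1 2 by blast
  qed
  then obtain a b where ab: "\<And>n. dist (a n) x \<le> 2 * h n" "\<And>n. dist (b n) x \<le> 2 * h n" "\<And>n. ?A (a n) = ?B (b n)"
    by metis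
  have h0: "(\<lambda>n. 2 * h n) \<longlonglongrightarrow> 0"
    unfolding h_def using tendsto_mult_right_zero[OF LIMSEQ_inverse_real_of_nat, of 2] by (simp add: inverse_eq_divide)
  have "a \<longlonglongrightarrow> x" "b \<longlonglongrightarrow> x"
    unfolding tendsto_dist_iff[of _ x]
    by (rule tendsto_sandwich[OF _ _ tendsto_const h0]; use ab in simp)+
  then have "(\<lambda>n. ?A (a n)) \<longlonglongrightarrow> ?A x" "(\<lambda>n. ?B (b n)) \<longlonglongrightarrow> ?B x"
    using cont by (auto intro: isCont_tendsto_compose)
  then show ?thesis using ab(3) LIMSEQ_unique by auto
qed

lemma iter_partial_Cons_swap: "smooth f \<Longrightarrow> iter_partial (i # is @ js) f = iter_partial (is @ i # js) f"
proof (induction "is")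
  case (Cons j "is")
  have "iter_partial (i # (j # is) @ js) f = partial_deriv i (partial_deriv j (iter_partial (is @ js) f))"
    by simp
  also have "\<dots> = partial_deriv j (partial_deriv i (iter_partial (is @ js) f))"
    by (intro ext partial_deriv_commute smooth_iter_partial Cons.prems)
  also have "\<dots> = partial_deriv j (iter_partial (is @ i # js) f)"
    using Cons by simp
  finally show ?case by simp
qed simp

text \<open>
  Only the number of occurrences of each direction matters. Hence the arbitrary choice of a list in
  the definition of \<open>multi_deriv\<close> is harmless.
\<close>

lemma iter_partial_mset:
  assumes f: "smooth f" shows "mset is = mset js \<Longrightarrow> iter_partial is f = iter_partial js f"
proof (induction "is" arbitrary: js)
  case (Cons i "is")
  then have "i \<in> set js" by (metis list.set_intros(1) set_mset_mset)
  then obtain as bs where js: "js = as @ i # bs" by (meson split_list)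
  with Cons.prems have "mset is = mset (as @ bs)" by simp
  then have "iter_partial is f = iter_partial (as @ bs) f"
    by (rule Cons.IH)
  then have "iter_partial (i # is) f = partial_deriv i (iter_partial (as @ bs) f)"
    by simp
  also have "\<dots> = iter_partial js f"
    using iter_partial_Cons_swap[OF f, of i as bs] js by simp
  finally show ?case .
qed simp

definition mult_index :: "'n list \<Rightarrow> nat ^ 'n" where
  "mult_index is = (\<chi> i. count_list is i)"

lemma mult_index_surj: fixes r :: "nat ^ 'n" shows "\<exists>is. mult_index is = r"
proof -
  obtain xs :: "'n list" where xs: "set xs = UNIV" "distinct xs" 
    using finite_distinct_list[of "UNIV :: 'n set"] by auto
  have "count_list (concat (map (\<lambda>i. replicate (r $ i) i) xs)) j = (if j \<in> set xs then r $ j else 0)"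
    if "distinct xs" for j and xs :: "'n list"
    using that
  proof (induction xs)
    case (Cons x xs)
    have "count_list (replicate (r $ x) x) j = (if j = x then r $ j else 0)"
      by (induction "r $ x") (auto simp: count_list_eq_length_filter)
    then show ?case using Cons by auto
  qed simp
  from this[OF xs(2)] show ?thesis using xs(1)
    by (intro exI[of _ "concat (map (\<lambda>i. replicate (r $ i) i) xs)"]) (simp add: mult_index_def vec_eq_iff)
qed

lemma mult_index_Cons: "mult_index (i # is) = mult_index is + axis i 1"
  by (auto simp add: mult_index_def vec_eq_iff axis_def)

lemma mult_index_Nil: "mult_index [] = 0"
  by (simp add: mult_index_def vec_eq_iff)

lemma mult_index_length: "(\<Sum>i\<in>UNIV. mult_index is $ i) = length is"
proof (induction "is")
  case (Cons i "is")
  have "(\<Sum>j\<in>UNIV. axis i (1::nat) $ j) = 1" by (simp add: axis_def)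
  then show ?case using Cons unfolding mult_index_Cons vector_add_component sum.distrib by simp
qed (simp add: mult_index_Nil)

lemma multi_deriv_eq:
  assumes "smooth f"
  shows "multi_deriv (mult_index is) f = iter_partial is f"
proof -
  let ?js = "SOME js. \<forall>i. count_list js i = mult_index is $ i"
  have "\<forall>i. count_list ?js i = mult_index is $ i"
    by (rule someI[of _ "is"]) (simp add: mult_index_def)
  then have "mset ?js = mset is"
    by (simp add: mult_index_def multiset_eq_iff count_mset)
  then show ?thesis unfolding multi_deriv_def using iter_partial_mset[OF assms] by blast
qed

text \<open>
  All ways to distribute the positions of a list over two sublists. Summing over positions instead of
  sub-multi-indices absorbs the binomial coefficients of the Leibniz rule.
\<close>

fun splits :: "'n list \<Rightarrow> ('n list \<times> 'n list) list" where
  "splits [] = [([], [])]"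
| "splits (i # is) = map (\<lambda>(A, B). (i # A, B)) (splits is) @ map (\<lambda>(A, B). (A, i # B)) (splits is)"

lemma splits_mult_index: "(A, B) \<in> set (splits is) \<Longrightarrow> mult_index A + mult_index B = mult_index is"
proof (induction "is" arbitrary: A B)
  case (Cons i "is")
  then show ?case by (auto simp: mult_index_Cons add.assoc[symmetric]) (metis add.commute add.left_commute)+
qed (simp add: mult_index_Nil)

lemma splits_length: "(A, B) \<in> set (splits is) \<Longrightarrow> length A + length B = length is"
  by (induction "is" arbitrary: A B) auto

lemma partial_deriv_mult:
  assumes "f differentiable (at x)" "g differentiable (at x)"
  shows "partial_deriv i (\<lambda>x. f x * g x) x = partial_deriv i f x * g x + f x * partial_deriv i g x"
proof -
  have "((\<lambda>x. f x * g x) has_derivative (\<lambda>h. f x * frechet_derivative g (at x) h + frechet_derivative f (at x) h * g x)) (at x)"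
    using assms by (intro has_derivative_mult) (simp_all add: frechet_derivative_works)
  from partial_deriv_eq[OF this] show ?thesis by (simp add: partial_deriv_def)
qed

lemma partial_deriv_add:
  assumes "f differentiable (at x)" "g differentiable (at x)"
  shows "partial_deriv i (\<lambda>x. f x + g x) x = partial_deriv i f x + partial_deriv i g x"
proof -
  have "((\<lambda>x. f x + g x) has_derivative (\<lambda>h. frechet_derivative f (at x) h + frechet_derivative g (at x) h)) (at x)"
    using assms by (intro has_derivative_add) (simp_all add: frechet_derivative_works)
  from partial_deriv_eq[OF this] show ?thesis by (simp add: partial_deriv_def)
qed

lemma partial_deriv_const: "partial_deriv i (\<lambda>x. c) = (\<lambda>x. 0)"
  using partial_deriv_eq[OF has_derivative_const] by blast

lemma iter_partial_const: "iter_partial is (\<lambda>x. c) = (\<lambda>x. if is = [] then c else 0)"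
  by (induction "is") (auto simp: partial_deriv_const split: if_splits)

lemma smooth_const: "smooth (\<lambda>x. c)"
  by (auto simp: smooth_def iter_partial_const)

lemma differentiable_sum_list:
  "(\<And>a. a \<in> set xs \<Longrightarrow> F a differentiable (at x)) \<Longrightarrow> (\<lambda>x. \<Sum>a\<leftarrow>xs. F a x :: real) differentiable (at x)"
  by (induction xs) (auto intro!: differentiable_add)

lemma partial_deriv_sum_list:
  "(\<And>a. a \<in> set xs \<Longrightarrow> F a differentiable (at x)) \<Longrightarrow>
    partial_deriv i (\<lambda>x. \<Sum>a\<leftarrow>xs. F a x) x = (\<Sum>a\<leftarrow>xs. partial_deriv i (F a) x)"
proof (induction xs)
  case (Cons a xs)
  then show ?case using differentiable_sum_list[of xs F x]
    by (simp add: partial_deriv_add)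
qed (simp add: partial_deriv_const)

lemma iter_partial_mult:
  assumes "smooth f" "smooth g"
  shows "iter_partial is (\<lambda>x. f x * g x) = (\<lambda>x. \<Sum>(A, B)\<leftarrow>splits is. iter_partial A f x * iter_partial B g x)"
proof (induction "is")
  case (Cons i "is")
  have d: "iter_partial A f differentiable (at x)" "iter_partial A g differentiable (at x)" for A x
    using assms by (auto simp: smooth_def)
  have "partial_deriv i (\<lambda>x. \<Sum>(A, B)\<leftarrow>splits is. iter_partial A f x * iter_partial B g x) x
    = (\<Sum>a\<leftarrow>splits is. partial_deriv i (\<lambda>x. case a of (A, B) \<Rightarrow> iter_partial A f x * iter_partial B g x) x)" for x
    using d by (subst partial_deriv_sum_list) auto
  also have "\<dots> x = (\<Sum>(A, B)\<leftarrow>splits is. iter_partial (i # A) f x * iter_partial B g x + iter_partial A f x * iter_partial (i # B) g x)" for x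
    using d by (intro arg_cong[where f=sum_list] map_cong) (auto simp: partial_deriv_mult)
  finally show ?case
    unfolding iter_partial.simps Cons by (auto simp: sum_list_addf split_def o_def fun_eq_iff)
qed simp

lemma smooth_mult: assumes "smooth f" "smooth g" shows "smooth (\<lambda>x. f x * g x)"
  unfolding smooth_def iter_partial_mult[OF assms]
  using assms by (auto intro!: differentiable_sum_list simp: smooth_def)

lemma partial_deriv_affine:
  assumes "f differentiable (at (c *\<^sub>R x + t))"
  shows "partial_deriv i (\<lambda>x. f (c *\<^sub>R x + t)) x = c * partial_deriv i f (c *\<^sub>R x + t)"
proof -
  have 1: "(f has_derivative frechet_derivative f (at (c *\<^sub>R x + t))) (at (c *\<^sub>R x + t))"
    using assms by (simp add: frechet_derivative_works)
  have 2: "((\<lambda>x. c *\<^sub>R x + t) has_derivative (\<lambda>h. c *\<^sub>R h)) (at x)"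
    by (auto intro!: derivative_eq_intros)
  have 3: "linear (frechet_derivative f (at (c *\<^sub>R x + t)))"
    using 1 has_derivative_linear by blast
  show ?thesis
    using partial_deriv_eq[OF has_derivative_compose[OF 2 1]] linear_scale[OF 3]
    by (simp add: partial_deriv_def)
qed

lemma differentiable_affine:
  assumes "f differentiable (at (c *\<^sub>R x + t))"
  shows "(\<lambda>x. f (c *\<^sub>R x + t)) differentiable (at x)"
proof -
  have 2: "(\<lambda>x. c *\<^sub>R x + t) differentiable (at x)"
    by (auto intro!: derivative_intros)
  show ?thesis using differentiable_compose[of f "\<lambda>x. c *\<^sub>R x + t", OF assms 2] .
qed

lemma partial_deriv_cmult:
  assumes "f differentiable (at x)"
  shows "partial_deriv i (\<lambda>x. c * f x) x = c * partial_deriv i f x"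
  using partial_deriv_mult[of "\<lambda>_. c" x f i] assms by (simp add: partial_deriv_const)

lemma iter_partial_affine:
  assumes "smooth f"
  shows "iter_partial is (\<lambda>x. f (c *\<^sub>R x + t)) = (\<lambda>x. c ^ length is * iter_partial is f (c *\<^sub>R x + t))"
proof (induction "is")
  case (Cons i "is")
  have d: "iter_partial is f differentiable (at x)" for x using assms by (auto simp: smooth_def)
  show ?case
    by (simp add: Cons.IH fun_eq_iff partial_deriv_cmult d differentiable_affine partial_deriv_affine)
qed simp

lemma smooth_affine: assumes "smooth f" shows "smooth (\<lambda>x. f (c *\<^sub>R x + t))"
  unfolding smooth_def iter_partial_affine[OF assms]
  using assms by (auto simp: smooth_def intro!: differentiable_affine derivative_intros)

lemma smooth_cmult: "smooth f \<Longrightarrow> smooth (\<lambda>x. c * f x)"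
  by (intro smooth_mult smooth_const)

lemma supp_zero: "x \<notin> supp f \<Longrightarrow> f x = 0"
  unfolding supp_def using closure_subset[of "{x. f x \<noteq> 0}"] by auto

lemma partial_deriv_zero_off_supp: "x \<notin> supp f \<Longrightarrow> partial_deriv i f x = 0"
proof -
  assume x: "x \<notin> supp f"
  have "open (- supp f)" unfolding supp_def by (rule open_Compl) simp
  have "(f has_derivative (\<lambda>_. 0)) (at x)"
    by (rule has_derivative_transform_within_open[OF has_derivative_const \<open>open (- supp f)\<close>])
      (use x supp_zero[of _ f] in auto)
  then show ?thesis using partial_deriv_eq[of f "\<lambda>_. 0" x] by simp
qed

lemma supp_partial_deriv: "supp (partial_deriv i f) \<subseteq> supp f"
  unfolding supp_def[of "partial_deriv i f"]
  by (rule closure_minimal) (use partial_deriv_zero_off_supp in \<open>auto simp: supp_def\<close>)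

lemma supp_iter_partial: "supp (iter_partial is f) \<subseteq> supp f"
  by (induction "is") (use supp_partial_deriv in auto)

lemma iter_partial_zero_off_supp: "x \<notin> supp f \<Longrightarrow> iter_partial is f x = 0"
  using supp_iter_partial supp_zero by blast

lemma supp_mult: "supp (\<lambda>x. f x * g x) \<subseteq> supp g"
  unfolding supp_def by (rule closure_mono) auto

lemma compact_supp_subset: "compact (supp g) \<Longrightarrow> supp f \<subseteq> supp g \<Longrightarrow> compact (supp f)"
  by (metis closed_closure compact_Int_closed inf.absorb_iff2 supp_def)

lemma test_functionsD:
  assumes "\<psi> \<in> test_functions U"
  shows "smooth \<psi>" "compact (supp \<psi>)" "supp \<psi> \<subseteq> U" "\<And>x. x \<notin> U \<Longrightarrow> \<psi> x = 0" "\<And>x is. x \<notin> U \<Longrightarrow> iter_partial is \<psi> x = 0"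
  using assms supp_zero[of _ \<psi>] iter_partial_zero_off_supp[of _ \<psi>] unfolding test_functions_def by blast+

lemma test_functions_mono: "U \<subseteq> V \<Longrightarrow> \<psi> \<in> test_functions U \<Longrightarrow> \<psi> \<in> test_functions V"
  unfolding test_functions_def by auto

lemma test_functions_iter_partial: "\<psi> \<in> test_functions U \<Longrightarrow> iter_partial is \<psi> \<in> test_functions U"
  unfolding test_functions_def
  using smooth_iter_partial[of \<psi> "is"] supp_iter_partial[of "is" \<psi>] compact_supp_subset[of \<psi> "iter_partial is \<psi>"]
  by blast

lemma test_functions_mult: "\<psi> \<in> test_functions U \<Longrightarrow> smooth f \<Longrightarrow> (\<lambda>x. f x * \<psi> x) \<in> test_functions U"
  unfolding test_functions_def
  using smooth_mult[of f \<psi>] supp_mult[of f \<psi>] compact_supp_subset[of \<psi> "\<lambda>x. f x * \<psi> x"]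
  by blast

lemma test_functions_affine:
  assumes "\<psi> \<in> test_functions UNIV" "c \<noteq> 0"
  shows "(\<lambda>x. \<psi> (c *\<^sub>R x + t)) \<in> test_functions UNIV"
proof -
  have sub: "supp (\<lambda>x. \<psi> (c *\<^sub>R x + t)) \<subseteq> (\<lambda>y. (1/c) *\<^sub>R y + (-(1/c) *\<^sub>R t)) ` supp \<psi>" (is "_ \<subseteq> ?K")
  proof -
    have K: "compact ?K"
      by (intro compact_continuous_image continuous_intros test_functionsD(2)[OF assms(1)])
    have "x \<in> ?K" if "\<psi> (c *\<^sub>R x + t) \<noteq> 0" for x
    proof
      show "x = (1/c) *\<^sub>R (c *\<^sub>R x + t) + (-(1/c) *\<^sub>R t)" using assms(2) by (simp add: scaleR_add_right)
      show "c *\<^sub>R x + t \<in> supp \<psi>" using that supp_zero by blast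
    qed
    then have "closure {x. \<psi> (c *\<^sub>R x + t) \<noteq> 0} \<subseteq> ?K"
      by (intro closure_minimal compact_imp_closed[OF K]) blast
    then show ?thesis by (simp add: supp_def)
  qed
  have "compact ((\<lambda>y. (1/c) *\<^sub>R y + (-(1/c) *\<^sub>R t)) ` supp \<psi>)"
    by (intro compact_continuous_image continuous_intros test_functionsD(2)[OF assms(1)])
  then have "compact (supp (\<lambda>x. \<psi> (c *\<^sub>R x + t)))"
    using sub by (metis closed_closure compact_Int_closed inf.absorb_iff2 supp_def)
  then show ?thesis
    unfolding test_functions_def using test_functionsD(1)[OF assms(1)] smooth_affine by auto
qed

lemma continuous_compact_supp_bounded:
  fixes f :: "real^'n \<Rightarrow> real"
  assumes "continuous_on UNIV f" "compact (supp f)"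
  obtains B where "B > 0" "\<And>x. \<bar>f x\<bar> \<le> B"
proof -
  have "compact (f ` supp f)" by (intro compact_continuous_image assms(2) continuous_on_subset[OF assms(1)]) auto
  then obtain B where "\<And>y. y \<in> f ` supp f \<Longrightarrow> norm y \<le> B" 
    using compact_imp_bounded bounded_iff by metis
  then have "\<bar>f x\<bar> \<le> max B 1" for x
    by (cases "x \<in> supp f") (force simp: supp_zero)+
  then show thesis using that[of "max B 1"] by auto
qed

lemma test_function_bounded:
  assumes "\<psi> \<in> test_functions U"
  obtains B where "B > 0" "\<And>x. \<bar>\<psi> x\<bar> \<le> B"
  using continuous_compact_supp_bounded[of \<psi>] test_functionsD(1,2)[OF assms] smooth_continuous by metis

lemma test_function_supp_ball:
  assumes "\<psi> \<in> test_functions UNIV"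
  obtains R where "R > 0" "\<And>x. x \<notin> cball 0 R \<Longrightarrow> \<psi> x = 0"
proof -
  have "bounded (supp \<psi>)" using test_functionsD(2)[OF assms] compact_imp_bounded by blast
  then obtain R where "\<And>x. x \<in> supp \<psi> \<Longrightarrow> norm x \<le> R" by (auto simp: bounded_iff)
  then have "\<psi> x = 0" if "x \<notin> cball 0 (max R 1)" for x using that supp_zero[of x \<psi>] by force
  then show thesis using that[of "max R 1"] by auto
qed

section \<open>Mollification of locally integrable functions\<close>

lemma nn_integral_lborel_affine:
  fixes f :: "'a::euclidean_space \<Rightarrow> ennreal"
  assumes [measurable]: "f \<in> borel_measurable borel" and c: "c \<noteq> 0"
  shows "(\<integral>\<^sup>+x. f x \<partial>lborel) = ennreal (\<bar>c\<bar> ^ DIM('a)) * (\<integral>\<^sup>+x. f (c *\<^sub>R x + t) \<partial>lborel)"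
  by (subst lborel_affine[OF c, of t])
    (simp add: nn_integral_density nn_integral_distr nn_integral_cmult add.commute[of _ t])

lemma integrable_lborel_affine:
  fixes f :: "'a::euclidean_space \<Rightarrow> real"
  assumes f: "integrable lborel f" and c: "c \<noteq> 0"
  shows "integrable lborel (\<lambda>x. f (c *\<^sub>R x + t))"
proof -
  have [measurable]: "f \<in> borel_measurable borel" using f by auto
  have "(\<integral>\<^sup>+x. ennreal (norm (f x)) \<partial>lborel) = ennreal (\<bar>c\<bar> ^ DIM('a)) * (\<integral>\<^sup>+x. ennreal (norm (f (c *\<^sub>R x + t))) \<partial>lborel)"
    by (rule nn_integral_lborel_affine) (use c in auto)
  then show ?thesis
    using f c unfolding integrable_iff_bounded by (auto simp: ennreal_mult_less_top)
qed

lemma integral_lborel_affine: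
  fixes f :: "'a::euclidean_space \<Rightarrow> real"
  assumes c: "c \<noteq> 0" and [measurable]: "f \<in> borel_measurable borel"
  shows "(\<integral>x. f x \<partial>lborel) = \<bar>c\<bar> ^ DIM('a) * (\<integral>x. f (c *\<^sub>R x + t) \<partial>lborel)"
  by (subst lborel_affine[OF c, of t])
    (simp add: integral_density integral_distr add.commute[of _ t])

text \<open>
  Compactness of the inner set is what gives it a positive distance from the complement of the outer
  open set; the inner closed set from regularity is cut off by a large ball.
\<close>

lemma emeasure_lborel_compact_regular:
  fixes A :: "'a::euclidean_space set"
  assumes A: "A \<in> sets lborel" "emeasure lborel A < \<infinity>" and e: "e > 0"
  obtains K U where "compact K" "K \<subseteq> A" "A \<subseteq> U" "open U"
    "emeasure lborel (U - A) < ennreal e" "emeasure lborel (A - K) < ennreal e"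
proof -
  obtain U where U: "open U" "A \<subseteq> U" "emeasure lborel (U - A) < ennreal e"
    using outer_regular_lborel[of A e] A e by (metis sets_lborel)
  obtain T where T: "closed T" "T \<subseteq> A" "emeasure lebesgue (A - T) < ennreal (e/2)"
    using sets_lebesgue_inner_closed[of A "e/2"] A e by (metis half_gt_zero sets_completionI_sets)
  then have T': "emeasure lborel (A - T) < ennreal (e/2)"
    using A by simp
  let ?B = "\<lambda>n. A - cball 0 (real n)"
  have "(\<lambda>n. emeasure lborel (?B n)) \<longlonglongrightarrow> emeasure lborel (\<Inter>n. ?B n)"
  proof (rule Lim_emeasure_decseq)
    show "decseq ?B" by (auto simp: decseq_def)
    show "emeasure lborel (?B n) \<noteq> \<infinity>" for n
      using emeasure_mono[of "?B n" A lborel] A by auto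
  qed (use A in auto)
  moreover have "(\<Inter>n. ?B n) = {}"
    using real_arch_simple by auto
  ultimately have "(\<lambda>n. emeasure lborel (?B n)) \<longlonglongrightarrow> 0" by (metis emeasure_empty)
  then have "eventually (\<lambda>n. emeasure lborel (?B n) < ennreal (e/2)) sequentially"
    using e by (intro order_tendstoD(2)[where a="ennreal (e/2)"]) auto
  then obtain n where n: "emeasure lborel (?B n) < ennreal (e/2)"
    by (auto simp: eventually_sequentially)
  let ?K = "T \<inter> cball 0 (real n)"
  have "emeasure lborel (A - ?K) \<le> emeasure lborel ((A - T) \<union> ?B n)"
    using A T by (intro emeasure_mono) auto
  also have "\<dots> \<le> emeasure lborel (A - T) + emeasure lborel (?B n)"
    using A T by (intro emeasure_subadditive) auto
  also have "\<dots> < ennreal (e/2) + ennreal (e/2)"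
    using T' n by (rule add_strict_mono)
  also have "\<dots> = ennreal e" using e by (simp flip: ennreal_plus)
  finally show thesis
    using U T by (intro that[of ?K U]) (auto intro: closed_Int_compact)
qed

text \<open>
  If \<open>K \<subseteq> A \<subseteq> U\<close> and \<open>z\<close> is shorter than the distance from \<open>K\<close> to the complement of \<open>U\<close>,
  then \<open>A\<close> and its translate differ only inside translates of \<open>U - A\<close> and \<open>A - K\<close>.
\<close>

lemma translation_continuous_indicator:
  fixes A :: "'a::euclidean_space set"
  assumes A[measurable]: "A \<in> sets lborel" and fin: "emeasure lborel A < \<infinity>" and e: "e > 0"
  shows "\<exists>d>0. \<forall>z. norm z < d \<longrightarrow> (\<integral>\<^sup>+x. ennreal \<bar>indicator A (x - z) - indicator A x\<bar> \<partial>lborel) < ennreal e"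
proof -
  obtain K U where KU: "compact K" "K \<subseteq> A" "A \<subseteq> U" "open U"
    "emeasure lborel (U - A) < ennreal (e/4)" "emeasure lborel (A - K) < ennreal (e/4)"
    using emeasure_lborel_compact_regular[OF A fin, of "e/4"] e by auto
  have "\<exists>d>0. \<forall>x\<in>K. \<forall>y\<in>-U. d \<le> dist x y"
    by (rule separate_compact_closed) (use KU in auto)
  then obtain d where d: "d > 0" "\<And>x y. x \<in> K \<Longrightarrow> y \<notin> U \<Longrightarrow> d \<le> dist x y" by auto
  have [measurable]: "U \<in> sets borel" "K \<in> sets borel" "A \<in> sets borel" using KU A by (auto simp: borel_compact)
  have shift: "(\<integral>\<^sup>+x. indicator B (x - z) \<partial>lborel) = emeasure lborel B" if [measurable]: "B \<in> sets borel" for B :: "'a set" and z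
    using nn_integral_lborel_affine[of "indicator B" 1 "-z"] by simp
  show ?thesis
  proof (intro exI[of _ d] conjI allI impI d(1))
    fix z :: 'a assume z: "norm z < d"
    have *: "ennreal \<bar>indicator A (x - z) - indicator A x\<bar> \<le>
        ((indicator (U - A) x + indicator (A - K) (x - z)) + (indicator (U - A) (x - z) + indicator (A - K) x) :: ennreal)" for x
    proof -
      have "x \<in> U" if "x - z \<in> K" using d(2)[OF that, of x] z by (auto simp: dist_norm)
      moreover have "x - z \<in> U" if "x \<in> K" using d(2)[OF that, of "x - z"] z by (auto simp: dist_norm)
      ultimately show ?thesis using KU(2,3) by (auto simp: indicator_def)
    qed
    have "(\<integral>\<^sup>+x. ennreal \<bar>indicator A (x - z) - indicator A x\<bar> \<partial>lborel) \<le>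
       (\<integral>\<^sup>+x. (indicator (U - A) x + indicator (A - K) (x - z)) + (indicator (U - A) (x - z) + indicator (A - K) x) \<partial>lborel)"
      by (intro nn_integral_mono *)
    also have "\<dots> = (emeasure lborel (U - A) + emeasure lborel (A - K)) + (emeasure lborel (U - A) + emeasure lborel (A - K))"
      by (subst nn_integral_add; (subst nn_integral_add)?; (subst nn_integral_add)?) (simp_all add: shift)
    also have "\<dots> < (ennreal (e/4) + ennreal (e/4)) + (ennreal (e/4) + ennreal (e/4))"
      by (intro add_strict_mono KU)
    also have "\<dots> = ennreal e" using e by (simp flip: ennreal_plus)
    finally show "(\<integral>\<^sup>+x. ennreal \<bar>indicator A (x - z) - indicator A x\<bar> \<partial>lborel) < ennreal e" .
  qed
qed

lemma translation_continuous_L1: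
  fixes v :: "'a::euclidean_space \<Rightarrow> real"
  assumes "integrable lborel v" "e > 0"
  shows "\<exists>d>0. \<forall>z. norm z < d \<longrightarrow> (\<integral>\<^sup>+x. ennreal \<bar>v (x - z) - v x\<bar> \<partial>lborel) < ennreal e"
  using assms
proof (induction arbitrary: e rule: integrable_induct)
  case (base A c)
  have [measurable]: "A \<in> sets borel" using base by simp
  obtain d where d: "d > 0" "\<And>z. norm z < d \<Longrightarrow> (\<integral>\<^sup>+x. ennreal \<bar>indicator A (x - z) - indicator A x\<bar> \<partial>lborel) < ennreal (e / (\<bar>c\<bar> + 1))"
    using translation_continuous_indicator[OF base(1), of "e / (\<bar>c\<bar> + 1)"] base by (auto simp: divide_pos_pos add_nonneg_pos)
  show ?case
  proof (intro exI[of _ d] conjI allI impI d(1))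
    fix z :: 'a assume z: "norm z < d"
    have "(\<integral>\<^sup>+x. ennreal \<bar>indicat_real A (x - z) *\<^sub>R c - indicat_real A x *\<^sub>R c\<bar> \<partial>lborel)
       = (\<integral>\<^sup>+x. ennreal \<bar>c\<bar> * ennreal \<bar>indicator A (x - z) - indicator A x\<bar> \<partial>lborel)"
      by (intro nn_integral_cong) (auto simp: indicator_def)
    also have "\<dots> = ennreal \<bar>c\<bar> * (\<integral>\<^sup>+x. ennreal \<bar>indicator A (x - z) - indicator A x\<bar> \<partial>lborel)"
      by (rule nn_integral_cmult) measurable
    also have "\<dots> \<le> ennreal \<bar>c\<bar> * ennreal (e / (\<bar>c\<bar> + 1))"
      using d(2)[OF z] by (intro mult_left_mono) auto
    also have "\<dots> = ennreal (\<bar>c\<bar> * (e / (\<bar>c\<bar> + 1)))"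
      using base(3) by (intro ennreal_mult[symmetric]) auto
    also have "\<dots> < ennreal e" using base(3) by (intro ennreal_lessI) (auto simp: field_simps)
    finally show "(\<integral>\<^sup>+x. ennreal \<bar>indicat_real A (x - z) *\<^sub>R c - indicat_real A x *\<^sub>R c\<bar> \<partial>lborel) < ennreal e" .
  qed
next
  case (add f g)
  have [measurable]: "f \<in> borel_measurable borel" "g \<in> borel_measurable borel" using add by auto
  obtain d1 where d1: "d1 > 0" "\<And>z. norm z < d1 \<Longrightarrow> (\<integral>\<^sup>+x. ennreal \<bar>f (x - z) - f x\<bar> \<partial>lborel) < ennreal (e / 2)"
    using add.IH(1)[of "e/2"] add.prems by auto
  obtain d2 where d2: "d2 > 0" "\<And>z. norm z < d2 \<Longrightarrow> (\<integral>\<^sup>+x. ennreal \<bar>g (x - z) - g x\<bar> \<partial>lborel) < ennreal (e / 2)"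
    using add.IH(2)[of "e/2"] add.prems by auto
  show ?case
  proof (intro exI[of _ "min d1 d2"] conjI allI impI)
    fix z :: 'a assume z: "norm z < min d1 d2"
    have "(\<integral>\<^sup>+x. ennreal \<bar>(f (x - z) + g (x - z)) - (f x + g x)\<bar> \<partial>lborel)
      \<le> (\<integral>\<^sup>+x. ennreal \<bar>f (x - z) - f x\<bar> + ennreal \<bar>g (x - z) - g x\<bar> \<partial>lborel)"
      by (intro nn_integral_mono) (auto simp flip: ennreal_plus intro!: ennreal_leI)
    also have "\<dots> = (\<integral>\<^sup>+x. ennreal \<bar>f (x - z) - f x\<bar> \<partial>lborel) + (\<integral>\<^sup>+x. ennreal \<bar>g (x - z) - g x\<bar> \<partial>lborel)"
      by (rule nn_integral_add) measurable
    also have "\<dots> < ennreal (e/2) + ennreal (e/2)"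
      using d1(2)[of z] d2(2)[of z] z by (intro add_strict_mono) auto
    also have "\<dots> = ennreal e" using add.prems by (simp flip: ennreal_plus)
    finally show "(\<integral>\<^sup>+x. ennreal \<bar>(f (x - z) + g (x - z)) - (f x + g x)\<bar> \<partial>lborel) < ennreal e" .
  qed (use d1 d2 in auto)
next
  case (lim f s)
  have [measurable]: "f \<in> borel_measurable borel" "s i \<in> borel_measurable borel" for i using lim by auto
  have "(\<lambda>i. \<integral>\<^sup>+ x. ennreal (norm (f x - s i x)) \<partial>lborel) \<longlonglongrightarrow> 0"
  proof (rule nn_integral_dominated_convergence_norm[where w="\<lambda>x. 2 * norm (f x)"])
    show "(\<integral>\<^sup>+ x. ennreal (2 * norm (f x)) \<partial>lborel) < \<infinity>"
      using integrable_mult_right[OF integrable_norm[OF lim.hyps(4)], of 2, unfolded integrable_iff_bounded]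
      by (simp add: abs_mult)
  qed (use lim.hyps in auto)
  then have "eventually (\<lambda>i. (\<integral>\<^sup>+ x. ennreal (norm (f x - s i x)) \<partial>lborel) < ennreal (e/4)) sequentially"
    using lim.prems by (intro order_tendstoD(2)[where a="ennreal (e/4)"]) auto
  then obtain i where i: "(\<integral>\<^sup>+ x. ennreal (norm (f x - s i x)) \<partial>lborel) < ennreal (e/4)"
    by (auto simp: eventually_sequentially)
  have i': "(\<integral>\<^sup>+ x. ennreal (norm (f (x - z) - s i (x - z))) \<partial>lborel) < ennreal (e/4)" for z
    using i nn_integral_lborel_affine[of "\<lambda>x. ennreal (norm (f x - s i x))" 1 "-z"] by simp
  obtain d where d: "d > 0" "\<And>z. norm z < d \<Longrightarrow> (\<integral>\<^sup>+x. ennreal \<bar>s i (x - z) - s i x\<bar> \<partial>lborel) < ennreal (e / 4)"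
    using lim.IH[of "e/4" i] lim.prems by auto
  show ?case
  proof (intro exI[of _ d] conjI allI impI d(1))
    fix z :: 'a assume z: "norm z < d"
    have "(\<integral>\<^sup>+x. ennreal \<bar>f (x - z) - f x\<bar> \<partial>lborel)
      \<le> (\<integral>\<^sup>+x. (ennreal (norm (f (x - z) - s i (x - z))) + ennreal \<bar>s i (x - z) - s i x\<bar>) + ennreal (norm (f x - s i x)) \<partial>lborel)"
      by (intro nn_integral_mono) (auto simp flip: ennreal_plus intro!: ennreal_leI)
    also have "\<dots> = ((\<integral>\<^sup>+x. ennreal (norm (f (x - z) - s i (x - z))) \<partial>lborel)
       + (\<integral>\<^sup>+x. ennreal \<bar>s i (x - z) - s i x\<bar> \<partial>lborel)) + (\<integral>\<^sup>+x. ennreal (norm (f x - s i x)) \<partial>lborel)"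
      by (subst nn_integral_add; (subst nn_integral_add)?) simp_all
    also have "\<dots> < (ennreal (e/4) + ennreal (e/4)) + ennreal (e/4)"
      using d(2)[OF z] i i'[of z] by (intro add_strict_mono) auto
    also have "\<dots> \<le> ennreal e" using lim.prems by (simp flip: ennreal_plus)
    finally show "(\<integral>\<^sup>+x. ennreal \<bar>f (x - z) - f x\<bar> \<partial>lborel) < ennreal e" .
  qed
qed

text \<open>
  Borel functions rather than Lebesgue measurable ones, because convolution needs measurability on
  the product space. Every locally integrable function agrees almost everywhere with one of these.
\<close>

definition loc_int :: "('a::euclidean_space \<Rightarrow> real) \<Rightarrow> bool" where
  "loc_int v \<longleftrightarrow> v \<in> borel_measurable borel \<and> (\<forall>K. compact K \<longrightarrow> set_integrable lborel K v)"

lemma loc_int_measurable: "loc_int v \<Longrightarrow> v \<in> borel_measurable borel"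
  by (simp add: loc_int_def)

lemma continuous_loc_int: "continuous_on UNIV f \<Longrightarrow> loc_int f"
  unfolding loc_int_def set_integrable_def
  using borel_integrable_compact[of _ f] continuous_on_subset[of UNIV f]
  by (auto simp: borel_measurable_continuous_onI indicator_scaleR_eq_if)

lemma loc_int_mult_bounded_compact:
  assumes v: "loc_int v" and [measurable]: "g \<in> borel_measurable borel"
    and B: "\<And>x. \<bar>g x\<bar> \<le> B" and K: "compact K" "\<And>x. x \<notin> K \<Longrightarrow> g x = 0"
  shows "integrable lborel (\<lambda>x. v x * g x)"
proof (rule Bochner_Integration.integrable_bound)
  show "integrable lborel (\<lambda>x. B * (indicator K x *\<^sub>R v x))"
    using v K unfolding loc_int_def set_integrable_def by (intro integrable_mult_right) auto
  show "(\<lambda>x. v x * g x) \<in> borel_measurable lborel" using v[unfolded loc_int_def] by auto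
  have "0 \<le> B" using B[of undefined] by linarith
  then show "AE x in lborel. norm (v x * g x) \<le> norm (B * (indicator K x *\<^sub>R v x))"
    using B K by (intro AE_I2) (auto simp: indicator_def abs_mult mult.commute intro!: mult_right_mono)
qed

lemma loc_int_mult_continuous:
  assumes v: "loc_int v" and g: "continuous_on UNIV g"
  shows "loc_int (\<lambda>x. v x * g x)"
proof -
  have [measurable]: "g \<in> borel_measurable borel" using g by (simp add: borel_measurable_continuous_onI)
  have "set_integrable lborel K (\<lambda>x. v x * g x)" if K: "compact K" for K
  proof -
    have "compact (g ` K)" using K g by (meson compact_continuous_image continuous_on_subset top_greatest)
    then obtain B where B: "\<And>x. x \<in> K \<Longrightarrow> \<bar>g x\<bar> \<le> B" 
      using compact_imp_bounded bounded_iff by (metis imageI real_norm_def)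
    have "integrable lborel (\<lambda>x. v x * (indicator K x * g x))"
    proof (rule loc_int_mult_bounded_compact[OF v _ _ K])
      show "(\<lambda>x. indicator K x * g x) \<in> borel_measurable borel" using borel_compact[OF K] by auto
      show "\<bar>indicator K x * g x\<bar> \<le> max B 0" for x using B by (auto simp: indicator_def le_max_iff_disj)
    qed auto
    then show ?thesis unfolding set_integrable_def by (simp add: ac_simps)
  qed
  then show ?thesis using v by (auto simp: loc_int_def)
qed

lemma loc_int_add: "loc_int u \<Longrightarrow> loc_int v \<Longrightarrow> loc_int (\<lambda>x. u x + v x)"
  by (auto simp: loc_int_def intro: set_integral_add)

lemma loc_int_cmult: "loc_int v \<Longrightarrow> loc_int (\<lambda>x. c * v x)"
  by (auto simp: loc_int_def)

lemma loc_int_sum_list: "(\<And>a. a \<in> set xs \<Longrightarrow> loc_int (F a)) \<Longrightarrow> loc_int (\<lambda>x. \<Sum>a\<leftarrow>xs. F a x)"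
  by (induction xs) (auto intro: loc_int_add continuous_loc_int[OF continuous_on_const])

definition mollifier :: "(real ^ 'n \<Rightarrow> real) \<Rightarrow> bool" where
  "mollifier \<eta> \<longleftrightarrow> \<eta> \<in> test_functions UNIV \<and> (\<forall>x. 0 \<le> \<eta> x) \<and> (\<integral>x. \<eta> x \<partial>lborel) = 1"

text \<open>
  The convolution with \<open>M\<^sup>d \<eta>(M \<cdot>)\<close>, where \<open>M = m + 1\<close>, in the variable \<open>z\<close> of the unscaled bump: this form
  exhibits it as an average of translates of \<open>v\<close>. The form \<open>mollify_kernel\<close> exhibits it as
  a pairing with a test function.
\<close>

definition mollify :: "(real ^ 'n \<Rightarrow> real) \<Rightarrow> nat \<Rightarrow> (real ^ 'n \<Rightarrow> real) \<Rightarrow> real ^ 'n \<Rightarrow> real" where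
  "mollify \<eta> m v x = (\<integral>z. v (x - z /\<^sub>R real (Suc m)) * \<eta> z \<partial>lborel)"


lemma loc_int_affine:
  assumes v: "loc_int v" and c: "c \<noteq> 0"
  shows "loc_int (\<lambda>x. v (c *\<^sub>R x + t))"
proof -
  have [measurable]: "v \<in> borel_measurable borel" using v by (rule loc_int_measurable)
  have "set_integrable lborel K (\<lambda>x. v (c *\<^sub>R x + t))" if K: "compact K" for K
  proof -
    let ?K = "(\<lambda>x. c *\<^sub>R x + t) ` K"
    have "compact ?K" by (intro compact_continuous_image continuous_intros K)
    then have "integrable lborel (\<lambda>x. indicator ?K x *\<^sub>R v x)"
      using v by (auto simp: loc_int_def set_integrable_def)
    from integrable_lborel_affine[OF this c, of t]
    have "integrable lborel (\<lambda>x. indicator ?K (c *\<^sub>R x + t) *\<^sub>R v (c *\<^sub>R x + t))" .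
    moreover have "indicat_real ?K (c *\<^sub>R x + t) = indicator K x" for x
      using c by (auto simp: indicator_def)
    ultimately show ?thesis by (simp add: set_integrable_def)
  qed
  then show ?thesis by (auto simp: loc_int_def)
qed

lemma loc_int_tendsto:
  assumes v: "loc_int v" and g: "\<And>k. g k \<in> borel_measurable borel" and g': "g' \<in> borel_measurable borel"
    and B: "\<And>k x. \<bar>g k x\<bar> \<le> B" and K: "compact K" "\<And>k x. x \<notin> K \<Longrightarrow> g k x = 0"
    and lim: "\<And>x. (\<lambda>k. g k x) \<longlonglongrightarrow> g' x"
  shows "(\<lambda>k. \<integral>x. v x * g k x \<partial>lborel) \<longlonglongrightarrow> (\<integral>x. v x * g' x \<partial>lborel)"
proof (rule integral_dominated_convergence[where w="\<lambda>x. B * (indicator K x *\<^sub>R \<bar>v x\<bar>)"])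
  have m: "v \<in> borel_measurable borel" using v by (rule loc_int_measurable)
  show "(\<lambda>x. v x * g k x) \<in> borel_measurable lborel" "(\<lambda>x. v x * g' x) \<in> borel_measurable lborel" for k
    using m g g' by auto
  have "integrable lborel (\<lambda>x. \<bar>indicator K x *\<^sub>R v x\<bar>)"
    using v K unfolding loc_int_def set_integrable_def by (intro integrable_abs) auto
  then show "integrable lborel (\<lambda>x. B * (indicator K x *\<^sub>R \<bar>v x\<bar>))"
    by (intro integrable_mult_right) (simp add: abs_mult)
  show "AE x in lborel. (\<lambda>k. v x * g k x) \<longlonglongrightarrow> v x * g' x"
    using lim by (intro AE_I2 tendsto_intros)
  show "AE x in lborel. norm (v x * g k x) \<le> B * (indicator K x *\<^sub>R \<bar>v x\<bar>)" for k
    using B[of k] K(2)[of _ k] mult_right_mono[OF B[of k], of "\<bar>v _\<bar>"]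
    by (intro AE_I2) (auto simp: indicator_def abs_mult mult.commute)
qed

lemma powr_above_tangent:
  fixes p t s :: real
  assumes "1 \<le> p" "0 \<le> t" "0 < s"
  shows "s powr p + p * s powr (p - 1) * (t - s) \<le> t powr p"
proof (cases "t = 0")
  case True
  have "s powr p = s powr (p - 1) * s" using assms by (simp add: powr_diff)
  then show ?thesis using True assms by (simp add: mult_right_mono[of 1 p "s powr (p - 1) * s"])
next
  case False
  have "t powr p - s powr p \<ge> (p * s powr (p - 1)) * (t - s)"
  proof (rule convex_on_imp_above_tangent[OF powr_convex[OF assms(1)]])
    show "((\<lambda>x. x powr p) has_real_derivative p * s powr (p - 1)) (at s within {0<..})"
      using assms by (auto intro!: derivative_eq_intros DERIV_subset[OF has_real_derivative_powr])
  qed (use assms False in \<open>auto simp: interior_open\<close>)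
  then show ?thesis by simp
qed

text \<open>
  Jensen's inequality for a probability density \<open>w\<close>, obtained by integrating the tangent to \<open>t\<^sup>p\<close> at the mean.
\<close>

lemma jensen_powr:
  fixes h w :: "'a \<Rightarrow> real" and p :: real
  assumes p: "1 \<le> p" and w: "\<And>x. 0 \<le> w x" "integrable M w" "(\<integral>x. w x \<partial>M) = 1"
    and h: "\<And>x. 0 \<le> h x" "integrable M (\<lambda>x. h x * w x)" "integrable M (\<lambda>x. h x powr p * w x)"
  shows "(\<integral>x. h x * w x \<partial>M) powr p \<le> (\<integral>x. h x powr p * w x \<partial>M)"
proof (cases "(\<integral>x. h x * w x \<partial>M) = 0")
  case True
  have "0 \<le> (\<integral>x. h x powr p * w x \<partial>M)"
    by (rule Bochner_Integration.integral_nonneg) (simp add: w)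
  then show ?thesis using True by simp
next
  case False
  define s where "s = (\<integral>x. h x * w x \<partial>M)"
  have s: "s > 0" using False w h unfolding s_def by (simp add: order.not_eq_order_implies_strict integral_nonneg_AE)
  have "(\<integral>x. s powr p * w x + p * s powr (p - 1) * (h x * w x - s * w x) \<partial>M) \<le> (\<integral>x. h x powr p * w x \<partial>M)"
  proof (rule integral_mono)
    show "integrable M (\<lambda>x. s powr p * w x + p * s powr (p - 1) * (h x * w x - s * w x))"
      using w h by (intro Bochner_Integration.integrable_add integrable_mult_right Bochner_Integration.integrable_diff) auto
    show "s powr p * w x + p * s powr (p - 1) * (h x * w x - s * w x) \<le> h x powr p * w x" for x
      using mult_right_mono[OF powr_above_tangent[OF p h(1)[of x] s] w(1)[of x]] by (simp add: algebra_simps)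
  qed (use h in auto)
  also have "(\<integral>x. s powr p * w x + p * s powr (p - 1) * (h x * w x - s * w x) \<partial>M) = s powr p"
    using w h by (simp add: s_def[symmetric])
  finally show ?thesis by (simp add: s_def)
qed

context
  fixes \<eta> :: "real ^ 'n \<Rightarrow> real"
  assumes eta: "mollifier \<eta>"
begin

lemma mollifier_test: "\<eta> \<in> test_functions UNIV" and mollifier_nonneg: "0 \<le> \<eta> x" and mollifier_integral: "(\<integral>x. \<eta> x \<partial>lborel) = 1"
  using eta by (auto simp: mollifier_def)

lemma mollifier_continuous: "continuous_on UNIV \<eta>"
  using test_functionsD(1)[OF mollifier_test] smooth_continuous by blast

lemma mollifier_borel[measurable]: "\<eta> \<in> borel_measurable borel"
  using mollifier_continuous by (rule borel_measurable_continuous_onI)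

lemma mollifier_supp:
  obtains R where "R > 0" "\<And>x. x \<notin> cball 0 R \<Longrightarrow> \<eta> x = 0"
  using test_function_supp_ball[OF mollifier_test] by blast

lemma loc_int_mult_mollifier:
  assumes "loc_int v" shows "integrable lborel (\<lambda>x. v x * \<eta> x)"
proof -
  obtain B where "\<And>x. \<bar>\<eta> x\<bar> \<le> B" using test_function_bounded[OF mollifier_test] by blast
  moreover obtain R where "\<And>x. x \<notin> cball 0 R \<Longrightarrow> \<eta> x = 0" using mollifier_supp by blast
  ultimately show ?thesis
    by (intro loc_int_mult_bounded_compact[OF assms, where K="cball 0 R"]) auto
qed

lemma mollifier_integrable: "integrable lborel \<eta>"
  using loc_int_mult_mollifier[OF continuous_loc_int[OF continuous_on_const, of 1]] by simp

lemma mollify_integrable: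
  assumes "loc_int v" shows "integrable lborel (\<lambda>z. v (x - z /\<^sub>R real (Suc m)) * \<eta> z)"
  using loc_int_mult_mollifier[OF loc_int_affine[OF assms, of "- inverse (real (Suc m))" x]] by simp

lemma mollify_borel:
  assumes [measurable]: "v \<in> borel_measurable borel"
  shows "mollify \<eta> m v \<in> borel_measurable borel"
proof -
  have "(\<lambda>x. \<integral>z. v (x - z /\<^sub>R real (Suc m)) * \<eta> z \<partial>lborel) \<in> borel_measurable borel"
    by measurable
  then show ?thesis unfolding mollify_def .
qed

lemma mollify_minus_bound:
  assumes v: "loc_int v"
  shows "ennreal \<bar>mollify \<eta> m v x - v x\<bar> \<le> (\<integral>\<^sup>+z. ennreal \<bar>v (x - z /\<^sub>R real (Suc m)) - v x\<bar> * ennreal (\<eta> z) \<partial>lborel)"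
proof -
  have i: "integrable lborel (\<lambda>z. v (x - z /\<^sub>R real (Suc m)) * \<eta> z - v x * \<eta> z)"
    using mollify_integrable[OF v] mollifier_integrable by (intro Bochner_Integration.integrable_diff integrable_mult_right)
  have "mollify \<eta> m v x - v x = (\<integral>z. v (x - z /\<^sub>R real (Suc m)) * \<eta> z - v x * \<eta> z \<partial>lborel)"
    using mollify_integrable[OF v] mollifier_integrable
    by (subst Bochner_Integration.integral_diff) (auto simp: mollify_def mollifier_integral)
  then have "ennreal \<bar>mollify \<eta> m v x - v x\<bar> \<le> (\<integral>\<^sup>+z. ennreal (norm (v (x - z /\<^sub>R real (Suc m)) * \<eta> z - v x * \<eta> z)) \<partial>lborel)"
    using integral_norm_bound_ennreal[OF i] by simp
  also have "\<dots> = (\<integral>\<^sup>+z. ennreal \<bar>v (x - z /\<^sub>R real (Suc m)) - v x\<bar> * ennreal (\<eta> z) \<partial>lborel)"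
    by (intro nn_integral_cong)
      (simp add: mollifier_nonneg ennreal_mult[symmetric] abs_mult left_diff_distrib[symmetric])
  finally show ?thesis .
qed

text \<open>
  By Tonelli, the distance is at most the average over \<open>z\<close> of the distances of \<open>v\<close> to its translates by
  \<open>z / M\<close>, and these are uniformly small on the support of \<open>\<eta>\<close>.
\<close>

lemma mollify_L1:
  assumes v: "integrable lborel v"
  shows "(\<lambda>m. \<integral>\<^sup>+x. ennreal \<bar>mollify \<eta> m v x - v x\<bar> \<partial>lborel) \<longlonglongrightarrow> 0"
proof -
  have [measurable]: "v \<in> borel_measurable borel" using v by auto
  have lv: "loc_int v" using v using integrable_mult_indicator[OF _ v] by (auto simp: loc_int_def set_integrable_def borel_compact)
  obtain R where R: "R > 0" "\<And>x. x \<notin> cball 0 R \<Longrightarrow> \<eta> x = 0" using mollifier_supp by blast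
  have *: "\<exists>N. \<forall>m\<ge>N. (\<integral>\<^sup>+x. ennreal \<bar>mollify \<eta> m v x - v x\<bar> \<partial>lborel) \<le> ennreal e" if e: "e > 0" for e
  proof -
    obtain d where d: "d > 0" "\<And>z. norm z < d \<Longrightarrow> (\<integral>\<^sup>+x. ennreal \<bar>v (x - z) - v x\<bar> \<partial>lborel) < ennreal e"
      using translation_continuous_L1[OF v e] by blast
    obtain N where N: "R / d < real N" using reals_Archimedean2 by blast
    show ?thesis
    proof (intro exI[of _ N] allI impI)
      fix m assume m: "N \<le> m"
      have small: "norm (z /\<^sub>R real (Suc m)) < d" if "\<eta> z \<noteq> 0" for z
      proof -
        have "norm z \<le> R" using R(2) that by force
        also have "R < real (Suc m) * d" using N m d by (simp add: field_simps) (meson le_less_trans less_le_trans mult_left_mono of_nat_mono less_imp_le add_strict_increasing2)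
        finally show ?thesis by (simp add: field_simps)
      qed
      have "(\<integral>\<^sup>+x. ennreal \<bar>mollify \<eta> m v x - v x\<bar> \<partial>lborel)
        \<le> (\<integral>\<^sup>+x. (\<integral>\<^sup>+z. ennreal \<bar>v (x - z /\<^sub>R real (Suc m)) - v x\<bar> * ennreal (\<eta> z) \<partial>lborel) \<partial>lborel)"
        by (intro nn_integral_mono mollify_minus_bound lv)
      also have "\<dots> = (\<integral>\<^sup>+z. (\<integral>\<^sup>+x. ennreal \<bar>v (x - z /\<^sub>R real (Suc m)) - v x\<bar> * ennreal (\<eta> z) \<partial>lborel) \<partial>lborel)"
        by (rule lborel_pair.Fubini'[symmetric]) measurable
      also have "\<dots> = (\<integral>\<^sup>+z. (\<integral>\<^sup>+x. ennreal \<bar>v (x - z /\<^sub>R real (Suc m)) - v x\<bar> \<partial>lborel) * ennreal (\<eta> z) \<partial>lborel)"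
        by (intro nn_integral_cong nn_integral_multc) measurable
      also have "\<dots> \<le> (\<integral>\<^sup>+z. ennreal e * ennreal (\<eta> z) \<partial>lborel)"
      proof (intro nn_integral_mono)
        show "(\<integral>\<^sup>+x. ennreal \<bar>v (x - z /\<^sub>R real (Suc m)) - v x\<bar> \<partial>lborel) * ennreal (\<eta> z) \<le> ennreal e * ennreal (\<eta> z)" for z
          using d(2)[OF small[of z]] by (cases "\<eta> z = 0") (auto intro!: mult_right_mono)
      qed
      also have "\<dots> = ennreal e * (\<integral>\<^sup>+z. ennreal (\<eta> z) \<partial>lborel)" by (rule nn_integral_cmult) measurable
      also have "(\<integral>\<^sup>+z. ennreal (\<eta> z) \<partial>lborel) = 1"
        using nn_integral_eq_integral[OF mollifier_integrable] mollifier_nonneg mollifier_integral by simp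
      finally show "(\<integral>\<^sup>+x. ennreal \<bar>mollify \<eta> m v x - v x\<bar> \<partial>lborel) \<le> ennreal e" by simp
    qed
  qed
  have "\<exists>N. \<forall>m\<ge>N. (\<integral>\<^sup>+x. ennreal \<bar>mollify \<eta> m v x - v x\<bar> \<partial>lborel) < a" if a: "a > 0" for a
  proof -
    obtain b where b: "0 < b" "b < a" using dense[OF a] by blast
    then obtain e where e: "b = ennreal e" "e > 0" by (cases b) auto
    then show ?thesis using * b(2) by (meson le_less_trans)
  qed
  then show ?thesis
    by (intro order_tendstoI) (auto simp: eventually_sequentially)
qed

text \<open>
  On a compact set the mollification depends only on \<open>v\<close> in a compact neighbourhood, so \<open>v\<close> may be cut off.
\<close>

lemma mollify_local_L1:
  assumes v: "loc_int v" and K: "compact K"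
  shows "(\<lambda>m. \<integral>\<^sup>+x. indicator K x * ennreal \<bar>mollify \<eta> m v x - v x\<bar> \<partial>lborel) \<longlonglongrightarrow> 0"
proof -
  obtain R where R: "R > 0" "\<And>x. x \<notin> cball 0 R \<Longrightarrow> \<eta> x = 0" using mollifier_supp by blast
  let ?K = "{x + y |x y. x \<in> K \<and> y \<in> cball 0 R}"
  have cK: "compact ?K" by (intro compact_sums K compact_cball)
  define w where "w x = indicator ?K x * v x" for x
  have w: "integrable lborel w" using v cK unfolding loc_int_def set_integrable_def w_def by auto
  have eq: "mollify \<eta> m v x - v x = mollify \<eta> m w x - w x" if x: "x \<in> K" for m x
  proof -
    have "x \<in> ?K" using x R by (force intro: exI[of _ x] exI[of _ 0])
    moreover have "x - z /\<^sub>R real (Suc m) \<in> ?K" if "\<eta> z \<noteq> 0" for z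
    proof -
      have "norm z \<le> R" using R(2) that by force
      then have "norm (z /\<^sub>R real (Suc m)) \<le> R" by (simp add: field_simps) (smt (verit) R(1) mult_nonneg_nonneg of_nat_0_le_iff)
      then have "- (z /\<^sub>R real (Suc m)) \<in> cball 0 R" by simp
      then have "x + (- (z /\<^sub>R real (Suc m))) \<in> ?K" using x by blast
      then show ?thesis by simp
    qed
    then have "v (x - z /\<^sub>R real (Suc m)) * \<eta> z = w (x - z /\<^sub>R real (Suc m)) * \<eta> z" for z
      by (cases "\<eta> z = 0") (auto simp: w_def)
    then have "mollify \<eta> m v x = mollify \<eta> m w x"
      unfolding mollify_def by (intro Bochner_Integration.integral_cong refl)
    ultimately show ?thesis by (simp add: w_def)
  qed
  have "(\<integral>\<^sup>+x. indicator K x * ennreal \<bar>mollify \<eta> m v x - v x\<bar> \<partial>lborel) \<le> (\<integral>\<^sup>+x. ennreal \<bar>mollify \<eta> m w x - w x\<bar> \<partial>lborel)" for m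
    by (intro nn_integral_mono) (auto simp: indicator_def eq)
  then show ?thesis
    by (intro tendsto_sandwich[OF _ _ tendsto_const mollify_L1[OF w]]) auto
qed

lemma mollify_jensen:
  assumes v: "loc_int v" and vp: "loc_int (\<lambda>x. \<bar>v x\<bar> powr p)" and p: "1 \<le> p"
  shows "\<bar>mollify \<eta> m v x\<bar> powr p \<le> mollify \<eta> m (\<lambda>x. \<bar>v x\<bar> powr p) x"
proof -
  have i: "integrable lborel (\<lambda>z. \<bar>v (x - z /\<^sub>R real (Suc m))\<bar> * \<eta> z)"
    using integrable_abs[OF mollify_integrable[OF v, of x m]] by (simp add: abs_mult mollifier_nonneg)
  have "\<bar>mollify \<eta> m v x\<bar> \<le> (\<integral>z. \<bar>v (x - z /\<^sub>R real (Suc m))\<bar> * \<eta> z \<partial>lborel)"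
    unfolding mollify_def using integral_abs_bound[of lborel "\<lambda>z. v (x - z /\<^sub>R real (Suc m)) * \<eta> z"] by (simp add: abs_mult mollifier_nonneg)
  then have "\<bar>mollify \<eta> m v x\<bar> powr p \<le> (\<integral>z. \<bar>v (x - z /\<^sub>R real (Suc m))\<bar> * \<eta> z \<partial>lborel) powr p"
    using p by (intro powr_mono2) auto
  also have "\<dots> \<le> mollify \<eta> m (\<lambda>x. \<bar>v x\<bar> powr p) x"
    unfolding mollify_def
    using i mollify_integrable[OF vp, of x m]
    by (intro jensen_powr[OF p]) (auto simp: mollifier_nonneg mollifier_integral mollifier_integrable)
  finally show ?thesis .
qed

definition mollifier_kernel :: "nat \<Rightarrow> real ^ 'n \<Rightarrow> real ^ 'n \<Rightarrow> real" where
  "mollifier_kernel m x y = real (Suc m) ^ CARD('n) * \<eta> ((- real (Suc m)) *\<^sub>R y + real (Suc m) *\<^sub>R x)"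

lemma mollifier_kernel_test: "mollifier_kernel m x \<in> test_functions UNIV"
proof -
  have "(\<lambda>y. \<eta> ((- real (Suc m)) *\<^sub>R y + real (Suc m) *\<^sub>R x)) \<in> test_functions UNIV"
    by (intro test_functions_affine mollifier_test) simp
  from test_functions_mult[OF this smooth_const] show ?thesis
    by (simp add: mollifier_kernel_def[abs_def])
qed

lemma mollify_kernel:
  assumes [measurable]: "v \<in> borel_measurable borel"
  shows "mollify \<eta> m v x = (\<integral>y. v y * mollifier_kernel m x y \<partial>lborel)"
proof -
  have "mollify \<eta> m v x = \<bar>- real (Suc m)\<bar> ^ DIM(real^'n) * (\<integral>y. v (x - ((- real (Suc m)) *\<^sub>R y + real (Suc m) *\<^sub>R x) /\<^sub>R real (Suc m)) * \<eta> ((- real (Suc m)) *\<^sub>R y + real (Suc m) *\<^sub>R x) \<partial>lborel)"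
    unfolding mollify_def
    by (rule integral_lborel_affine) auto
  also have "\<dots> = (\<integral>y. v y * mollifier_kernel m x y \<partial>lborel)"
  proof -
    have "x - ((- real (Suc m)) *\<^sub>R y + real (Suc m) *\<^sub>R x) /\<^sub>R real (Suc m) = y" for y
      by (simp add: scaleR_diff_right del: of_nat_Suc)
    then show ?thesis
      unfolding mollifier_kernel_def
      by (subst Bochner_Integration.integral_mult_right_zero[symmetric])
        (intro Bochner_Integration.integral_cong refl, simp only: mult.commute mult.left_commute abs_minus_cancel abs_of_nat DIM_cart DIM_real mult_1_right mult_1_left)
  qed
  finally show ?thesis .
qed

end

section \<open>Weak derivatives on the whole space\<close>

lemma test_function_borel: "\<psi> \<in> test_functions U \<Longrightarrow> \<psi> \<in> borel_measurable borel"
  using test_functionsD(1) smooth_continuous borel_measurable_continuous_onI by blast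

lemma loc_int_mult_test:
  assumes "loc_int v" "\<psi> \<in> test_functions U" shows "integrable lborel (\<lambda>x. v x * \<psi> x)"
proof -
  have "\<psi> \<in> test_functions UNIV" using assms(2) test_functions_mono[of U UNIV \<psi>] by auto
  then obtain R where "\<And>x. x \<notin> cball 0 R \<Longrightarrow> \<psi> x = 0" using test_function_supp_ball by blast
  moreover obtain B where "\<And>x. \<bar>\<psi> x\<bar> \<le> B" using test_function_bounded[OF assms(2)] by blast
  ultimately show ?thesis
    by (intro loc_int_mult_bounded_compact[OF assms(1), where K="cball 0 R"] test_function_borel[OF assms(2)]) auto
qed

lemma test_function_difference_quotient:
  assumes "\<psi> \<in> test_functions UNIV"
  obtains B where "B > 0" "\<And>y t. \<bar>\<psi> (y + t *\<^sub>R axis i 1) - \<psi> y\<bar> \<le> B * \<bar>t\<bar>"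
proof -
  have sm: "smooth \<psi>" using test_functionsD(1)[OF assms] .
  have "partial_deriv i \<psi> \<in> test_functions UNIV" using test_functions_iter_partial[OF assms, of "[i]"] by simp
  then obtain B where B: "B > 0" "\<And>x. \<bar>partial_deriv i \<psi> x\<bar> \<le> B" using test_function_bounded by blast
  have "\<bar>\<psi> (y + t *\<^sub>R axis i 1) - \<psi> y\<bar> \<le> B * \<bar>t\<bar>" for y t
  proof -
    have "norm (\<psi> (y + t *\<^sub>R axis i 1) - \<psi> (y + 0 *\<^sub>R axis i 1)) \<le> B * norm (t - 0)"
      by (rule field_differentiable_bound[of UNIV "\<lambda>t. \<psi> (y + t *\<^sub>R axis i 1)" "\<lambda>t. partial_deriv i \<psi> (y + t *\<^sub>R axis i 1)"])
        (auto simp: smooth_DERIV[OF sm] B)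
    then show ?thesis by simp
  qed
  with B show thesis using that by blast
qed

text \<open>
  Differentiation under the integral sign: the difference quotients of a test function are bounded
  and vanish off a common compact set.
\<close>

lemma translated_pairing_DERIV:
  assumes u: "loc_int u" and \<psi>: "\<psi> \<in> test_functions UNIV"
  shows "((\<lambda>t. \<integral>y. u y * \<psi> (y - t *\<^sub>R axis i 1) \<partial>lborel) has_field_derivative
     - (\<integral>y. u y * partial_deriv i \<psi> y \<partial>lborel)) (at 0)"
proof -
  have sm: "smooth \<psi>" using test_functionsD(1)[OF \<psi>] .
  obtain B where B: "B > 0" "\<And>y t. \<bar>\<psi> (y + t *\<^sub>R axis i 1) - \<psi> y\<bar> \<le> B * \<bar>t\<bar>"
    using test_function_difference_quotient[OF \<psi>] by blast
  obtain R where R: "R > 0" "\<And>x. x \<notin> cball 0 R \<Longrightarrow> \<psi> x = 0" using test_function_supp_ball[OF \<psi>] by blast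
  have [measurable]: "\<psi> \<in> borel_measurable borel" "partial_deriv i \<psi> \<in> borel_measurable borel"
    using test_function_borel[OF \<psi>] test_function_borel[OF test_functions_iter_partial[OF \<psi>, of "[i]"]] by auto
  have int: "integrable lborel (\<lambda>y. u y * \<psi> (y - t *\<^sub>R axis i 1))" for t
    using loc_int_mult_test[OF u test_functions_affine[OF \<psi>, of 1 "- t *\<^sub>R axis i 1"]] by simp
  have "(\<lambda>k. ((\<integral>y. u y * \<psi> (y - (0 + h k) *\<^sub>R axis i 1) \<partial>lborel) - (\<integral>y. u y * \<psi> (y - 0 *\<^sub>R axis i 1) \<partial>lborel)) / h k)
      \<longlonglongrightarrow> - (\<integral>y. u y * partial_deriv i \<psi> y \<partial>lborel)"
    if h: "\<And>k. h k \<noteq> 0" "h \<longlonglongrightarrow> 0" for h :: "nat \<Rightarrow> real"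
  proof -
    obtain T where T: "\<And>k. \<bar>h k\<bar> \<le> T" using convergent_imp_Bseq[OF convergentI[OF h(2)]] by (auto simp: Bseq_def)
    have lim: "(\<lambda>k. \<integral>y. u y * ((\<psi> (y - h k *\<^sub>R axis i 1) - \<psi> y) / h k) \<partial>lborel) \<longlonglongrightarrow> (\<integral>y. u y * - partial_deriv i \<psi> y \<partial>lborel)"
    proof (rule loc_int_tendsto[OF u, where K="cball 0 (R + T)" and B=B])
      show "\<bar>(\<psi> (y - h k *\<^sub>R axis i 1) - \<psi> y) / h k\<bar> \<le> B" for k y
        using B(2)[of y "- h k"] h(1)[of k] by (simp add: field_simps)
      show "(\<psi> (y - h k *\<^sub>R axis i 1) - \<psi> y) / h k = 0" if "y \<notin> cball 0 (R + T)" for k y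
      proof -
        have "norm y > R + T" using that by simp
        moreover have "norm (h k *\<^sub>R (axis i 1 :: real^'a)) \<le> T" "T \<ge> 0" using T[of k] by (auto simp: norm_axis_1)
        ultimately have "norm (y - h k *\<^sub>R axis i 1) > R" "norm y > R"
          using norm_triangle_ineq2[of y "h k *\<^sub>R axis i 1"] by auto
        then show ?thesis using R by simp
      qed
      show "(\<lambda>k. (\<psi> (y - h k *\<^sub>R axis i 1) - \<psi> y) / h k) \<longlonglongrightarrow> - partial_deriv i \<psi> y" for y
      proof -
        have D: "((\<lambda>t. \<psi> (y + t *\<^sub>R axis i 1)) has_field_derivative partial_deriv i \<psi> (y + 0 *\<^sub>R axis i 1)) (at 0)"
          by (rule smooth_DERIV[OF sm])
        have "((\<lambda>t. (\<psi> (y + t *\<^sub>R axis i 1) - \<psi> y) / t) \<longlongrightarrow> partial_deriv i \<psi> y) (at 0)"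
          using D unfolding has_field_derivative_iff by simp
        moreover have "filterlim (\<lambda>k. - h k) (at 0) sequentially"
          using h tendsto_minus[OF h(2)] by (auto simp: filterlim_at)
        ultimately have "(\<lambda>k. (\<psi> (y + (- h k) *\<^sub>R axis i 1) - \<psi> y) / (- h k)) \<longlonglongrightarrow> partial_deriv i \<psi> y"
          by (rule filterlim_compose)
        from tendsto_minus[OF this] show ?thesis by simp
      qed
    qed auto
    have eq: "(\<integral>y. u y * ((\<psi> (y - h k *\<^sub>R axis i 1) - \<psi> y) / h k) \<partial>lborel)
      = ((\<integral>y. u y * \<psi> (y - (0 + h k) *\<^sub>R axis i 1) \<partial>lborel) - (\<integral>y. u y * \<psi> (y - 0 *\<^sub>R axis i 1) \<partial>lborel)) / h k" for k
    proof -
      have "(\<integral>y. u y * ((\<psi> (y - h k *\<^sub>R axis i 1) - \<psi> y) / h k) \<partial>lborel)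
        = (\<integral>y. (u y * \<psi> (y - (0 + h k) *\<^sub>R axis i 1) - u y * \<psi> (y - 0 *\<^sub>R axis i 1)) / h k \<partial>lborel)"
        by (simp add: right_diff_distrib)
      also have "\<dots> = ((\<integral>y. u y * \<psi> (y - (0 + h k) *\<^sub>R axis i 1) \<partial>lborel) - (\<integral>y. u y * \<psi> (y - 0 *\<^sub>R axis i 1) \<partial>lborel)) / h k"
        by (subst integral_divide_zero, subst Bochner_Integration.integral_diff[OF int int]) simp
      finally show ?thesis .
    qed
    show ?thesis using lim unfolding eq by (simp only: mult_minus_right Bochner_Integration.integral_minus)
  qed
  then show ?thesis
    unfolding has_field_derivative_iff tendsto_at_iff_sequentially by (auto simp: o_def)
qed

text \<open>
  The integral of \<open>\<psi>\<close> is invariant under translation, and its derivative with respect to the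
  translation is minus the integral of the partial derivative.
\<close>

lemma integral_partial_deriv_test:
  assumes \<psi>: "\<psi> \<in> test_functions UNIV"
  shows "(\<integral>x. partial_deriv i \<psi> x \<partial>lborel) = 0"
proof -
  have c: "(\<integral>y. 1 * \<psi> (y - t *\<^sub>R axis i 1) \<partial>lborel) = (\<integral>y. \<psi> y \<partial>lborel)" for t
    using integral_lborel_affine[of 1 \<psi> "- t *\<^sub>R axis i 1"] test_function_borel[OF \<psi>] by simp
  have "((\<lambda>t. \<integral>y. 1 * \<psi> (y - t *\<^sub>R axis i 1) \<partial>lborel) has_field_derivative - (\<integral>y. 1 * partial_deriv i \<psi> y \<partial>lborel)) (at 0)"
    by (rule translated_pairing_DERIV[OF continuous_loc_int[OF continuous_on_const] \<psi>])
  moreover have "((\<lambda>t. \<integral>y. 1 * \<psi> (y - t *\<^sub>R axis i 1) \<partial>lborel) has_field_derivative 0) (at 0)"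
    unfolding c by simp
  ultimately show ?thesis using DERIV_unique by fastforce
qed

definition wderiv :: "'n list \<Rightarrow> (real ^ 'n \<Rightarrow> real) \<Rightarrow> (real ^ 'n \<Rightarrow> real) \<Rightarrow> bool" where
  "wderiv is f u \<longleftrightarrow> loc_int f \<and> loc_int u \<and>
    (\<forall>\<psi>\<in>test_functions UNIV. (\<integral>x. f x * iter_partial is \<psi> x \<partial>lborel) = (- 1) ^ length is * (\<integral>x. u x * \<psi> x \<partial>lborel))"

lemma sum_list_iter_partial:
  assumes "\<And>a. a \<in> set xs \<Longrightarrow> smooth (F a)"
  shows "partial_deriv i (\<lambda>x. \<Sum>a\<leftarrow>xs. F a x) = (\<lambda>x. \<Sum>a\<leftarrow>xs. partial_deriv i (F a) x)"
  using assms by (intro ext partial_deriv_sum_list smooth_differentiable) auto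

text \<open>
  The Leibniz rule with the derivatives moved to the product. It expresses a test against \<open>f \<phi>\<close>
  through tests of \<open>f\<close> against the functions \<open>D\<^sup>A \<phi> \<psi>\<close>, which are test functions again.
\<close>

lemma dual_leibniz:
  assumes "smooth \<phi>" "smooth \<psi>"
  shows "\<phi> x * iter_partial is \<psi> x =
    (\<Sum>(A, B)\<leftarrow>splits is. (- 1) ^ length A * iter_partial B (\<lambda>x. iter_partial A \<phi> x * \<psi> x) x)"
  using assms
proof (induction "is" arbitrary: \<phi> x)
  case (Cons i "is")
  let ?\<Psi> = "iter_partial is \<psi>"
  have sm: "smooth (iter_partial B (\<lambda>x. iter_partial A \<phi> x * \<psi> x))" for A B
    using Cons.prems by (intro smooth_iter_partial smooth_mult)
  have "partial_deriv i (\<lambda>x. \<phi> x * ?\<Psi> x) x = partial_deriv i \<phi> x * ?\<Psi> x + \<phi> x * partial_deriv i ?\<Psi> x"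
    using Cons.prems by (intro partial_deriv_mult smooth_differentiable smooth_iter_partial)
  then have "\<phi> x * iter_partial (i # is) \<psi> x = partial_deriv i (\<lambda>x. \<phi> x * ?\<Psi> x) x - partial_deriv i \<phi> x * ?\<Psi> x"
    by simp
  also have "(\<lambda>x. \<phi> x * ?\<Psi> x) = (\<lambda>x. \<Sum>a\<leftarrow>splits is. (case a of (A, B) \<Rightarrow> \<lambda>x. (- 1) ^ length A * iter_partial B (\<lambda>x. iter_partial A \<phi> x * \<psi> x) x) x)"
    using Cons.IH[OF Cons.prems] by (simp add: split_def)
  also have "partial_deriv i \<dots> x = (\<Sum>a\<leftarrow>splits is. partial_deriv i (case a of (A, B) \<Rightarrow> \<lambda>x. (- 1) ^ length A * iter_partial B (\<lambda>x. iter_partial A \<phi> x * \<psi> x) x) x)"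
    by (subst sum_list_iter_partial) (auto intro!: smooth_cmult sm)
  also have "\<dots> = (\<Sum>(A, B)\<leftarrow>splits is. (- 1) ^ length A * iter_partial (i # B) (\<lambda>x. iter_partial A \<phi> x * \<psi> x) x)"
    by (intro arg_cong[where f=sum_list] map_cong) (auto simp: partial_deriv_cmult smooth_differentiable[OF sm])
  also have "partial_deriv i \<phi> x * ?\<Psi> x = (\<Sum>(A, B)\<leftarrow>splits is. (- 1) ^ length A * iter_partial B (\<lambda>x. iter_partial A (partial_deriv i \<phi>) x * \<psi> x) x)"
    using Cons by (intro Cons.IH smooth_partial_deriv)
  also have "\<dots> = - (\<Sum>(A, B)\<leftarrow>splits is. (- 1) ^ length (i # A) * iter_partial B (\<lambda>x. iter_partial (i # A) \<phi> x * \<psi> x) x)"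
  proof -
    have "iter_partial A (partial_deriv i \<phi>) = iter_partial (i # A) \<phi>" for A
    proof -
      have "iter_partial (A @ [i]) \<phi> = iter_partial (i # A) \<phi>"
        using Cons.prems by (intro iter_partial_mset) auto
      then show ?thesis by (simp add: iter_partial_append)
    qed
    then show ?thesis by (simp add: uminus_sum_list_map o_def split_def)
  qed
  finally show ?case by (simp add: split_def o_def)
qed simp

lemma integral_sum_list:
  "(\<And>a. a \<in> set xs \<Longrightarrow> integrable M (F a)) \<Longrightarrow> (\<integral>x. (\<Sum>a\<leftarrow>xs. F a x :: real) \<partial>M) = (\<Sum>a\<leftarrow>xs. \<integral>x. F a x \<partial>M)
    \<and> integrable M (\<lambda>x. \<Sum>a\<leftarrow>xs. F a x)"
  by (induction xs) auto

lemma wderiv_leibniz: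
  assumes f: "\<And>A B. (A, B) \<in> set (splits is) \<Longrightarrow> wderiv B f (u B)" and \<phi>: "smooth \<phi>"
  shows "wderiv is (\<lambda>x. f x * \<phi> x) (\<lambda>x. \<Sum>(A, B)\<leftarrow>splits is. u B x * iter_partial A \<phi> x)"
proof -
  have "set (splits is) \<noteq> {}" by (induction "is") auto
  then obtain A B where "(A, B) \<in> set (splits is)" by (metis ex_in_conv surj_pair)
  then have lf: "loc_int f" using f by (auto simp: wderiv_def)
  have lu: "loc_int (u B)" if "(A, B) \<in> set (splits is)" for A B using f[OF that] by (simp add: wderiv_def)
  have sm: "smooth (iter_partial A \<phi>)" for A by (intro smooth_iter_partial \<phi>)
  show ?thesis
    unfolding wderiv_def
  proof (intro conjI ballI)
    show "loc_int (\<lambda>x. f x * \<phi> x)" using lf \<phi> by (intro loc_int_mult_continuous smooth_continuous)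
    show "loc_int (\<lambda>x. \<Sum>(A, B)\<leftarrow>splits is. u B x * iter_partial A \<phi> x)"
      unfolding split_def
      by (intro loc_int_sum_list loc_int_mult_continuous smooth_continuous sm) (use lu in auto)
    fix \<psi> :: "real ^ 'a \<Rightarrow> real" assume \<psi>: "\<psi> \<in> test_functions UNIV"
    have t: "(\<lambda>x. iter_partial A \<phi> x * \<psi> x) \<in> test_functions UNIV" for A
      by (intro test_functions_mult \<psi> sm)
    have "(\<integral>x. f x * \<phi> x * iter_partial is \<psi> x \<partial>lborel)
       = (\<integral>x. (\<Sum>a\<leftarrow>splits is. (- 1) ^ length (fst a) * (f x * iter_partial (snd a) (\<lambda>x. iter_partial (fst a) \<phi> x * \<psi> x) x)) \<partial>lborel)"
    proof (intro Bochner_Integration.integral_cong refl)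
      fix x
      show "f x * \<phi> x * iter_partial is \<psi> x = (\<Sum>a\<leftarrow>splits is. (- 1) ^ length (fst a) * (f x * iter_partial (snd a) (\<lambda>x. iter_partial (fst a) \<phi> x * \<psi> x) x))"
        using dual_leibniz[OF \<phi> test_functionsD(1)[OF \<psi>], of x "is"]
        by (simp add: mult.assoc sum_list_const_mult[symmetric] split_def mult.left_commute[of "f x"])
    qed
    also have "\<dots> = (\<Sum>a\<leftarrow>splits is. \<integral>x. (- 1) ^ length (fst a) * (f x * iter_partial (snd a) (\<lambda>x. iter_partial (fst a) \<phi> x * \<psi> x) x) \<partial>lborel)"
      by (intro integral_sum_list[THEN conjunct1] integrable_mult_right loc_int_mult_test[OF lf test_functions_iter_partial[OF t]])
    also have "\<dots> = (\<Sum>a\<leftarrow>splits is. (- 1) ^ length is * (\<integral>x. (u (snd a) x * iter_partial (fst a) \<phi> x) * \<psi> x \<partial>lborel))"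
    proof (intro arg_cong[where f=sum_list] map_cong refl)
      fix a assume a: "a \<in> set (splits is)"
      then have "wderiv (snd a) f (u (snd a))" "length (fst a) + length (snd a) = length is"
        using f[of "fst a" "snd a"] splits_length[of "fst a" "snd a"] by auto
      then show "(\<integral>x. (- 1) ^ length (fst a) * (f x * iter_partial (snd a) (\<lambda>x. iter_partial (fst a) \<phi> x * \<psi> x) x) \<partial>lborel)
        = (- 1) ^ length is * (\<integral>x. (u (snd a) x * iter_partial (fst a) \<phi> x) * \<psi> x \<partial>lborel)"
        using t[of "fst a"] unfolding wderiv_def by (simp add: power_add[symmetric] mult.assoc)
    qed
    also have "\<dots> = (- 1) ^ length is * (\<Sum>a\<leftarrow>splits is. (\<integral>x. (u (snd a) x * iter_partial (fst a) \<phi> x) * \<psi> x \<partial>lborel))"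
      by (simp add: sum_list_const_mult)
    also have "(\<Sum>a\<leftarrow>splits is. (\<integral>x. (u (snd a) x * iter_partial (fst a) \<phi> x) * \<psi> x \<partial>lborel))
      = (\<integral>x. (\<Sum>a\<leftarrow>splits is. (u (snd a) x * iter_partial (fst a) \<phi> x) * \<psi> x) \<partial>lborel)"
      using lu by (intro integral_sum_list[THEN conjunct1, symmetric] loc_int_mult_test[OF _ \<psi>] loc_int_mult_continuous smooth_continuous sm) auto
    finally show "(\<integral>x. f x * \<phi> x * iter_partial is \<psi> x \<partial>lborel) = (- 1) ^ length is *
        (\<integral>x. (\<Sum>(A, B)\<leftarrow>splits is. u B x * iter_partial A \<phi> x) * \<psi> x \<partial>lborel)"
      by (simp add: split_def sum_list_mult_const)
  qed
qed

text \<open>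
  Together with the Leibniz rule this yields integration by parts for all smooth functions
  (\<open>wderiv_smooth\<close>), since \<open>\<phi> = 1 \<cdot> \<phi>\<close>.
\<close>

lemma wderiv_one: "wderiv is (\<lambda>_. 1) (\<lambda>_. if is = [] then 1 else 0)"
  unfolding wderiv_def
proof (intro conjI ballI)
  fix \<psi> :: "real^'a \<Rightarrow> real" assume \<psi>: "\<psi> \<in> test_functions UNIV"
  show "(\<integral>x. 1 * iter_partial is \<psi> x \<partial>lborel) = (- 1) ^ length is * (\<integral>x. (if is = [] then 1 else 0) * \<psi> x \<partial>lborel)"
    by (cases "is") (simp_all add: integral_partial_deriv_test[OF test_functions_iter_partial[OF \<psi>]])
qed (auto intro: continuous_loc_int)

lemma splits_right_Nil: "(\<Sum>(A, B)\<leftarrow>splits is. (if B = [] then 1 else 0) * F A) = (F is :: real)"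
proof (induction "is" arbitrary: F)
  case (Cons i "is")
  have "(\<Sum>(A, B)\<leftarrow>splits (i # is). (if B = [] then 1 else 0) * F A) = (\<Sum>(A, B)\<leftarrow>splits is. (if B = [] then 1 else 0) * F (i # A))"
    by (simp add: split_def o_def)
  also have "\<dots> = F (i # is)" by (rule Cons.IH[of "\<lambda>A. F (i # A)"])
  finally show ?case .
qed simp

lemma wderiv_smooth: assumes "smooth \<phi>" shows "wderiv is \<phi> (iter_partial is \<phi>)"
proof -
  have "(\<lambda>x. \<Sum>(A, B)\<leftarrow>splits is. (if B = [] then 1 else 0) * iter_partial A \<phi> x) = iter_partial is \<phi>"
    by (rule ext) (rule splits_right_Nil)
  then show ?thesis
    using wderiv_leibniz[of "is" "\<lambda>_. 1" "\<lambda>B _. if B = [] then 1 else 0" \<phi>, OF wderiv_one assms] by simp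
qed

lemma wderiv_affine:
  fixes f u :: "real^'n \<Rightarrow> real"
  assumes fu: "wderiv is f u" and c: "c \<noteq> 0"
  shows "wderiv is (\<lambda>x. f (c *\<^sub>R x + t)) (\<lambda>x. c ^ length is * u (c *\<^sub>R x + t))"
  unfolding wderiv_def
proof (intro conjI ballI)
  have f: "loc_int f" and u: "loc_int u" using fu by (auto simp: wderiv_def)
  note [measurable] = loc_int_measurable[OF f] loc_int_measurable[OF u]
  show "loc_int (\<lambda>x. f (c *\<^sub>R x + t))" "loc_int (\<lambda>x. c ^ length is * u (c *\<^sub>R x + t))"
    by (intro loc_int_cmult loc_int_affine f u c)+
  fix \<psi> :: "real^'n \<Rightarrow> real" assume \<psi>: "\<psi> \<in> test_functions UNIV"
  define \<psi>' where "\<psi>' x = \<psi> ((1 / c) *\<^sub>R x + (- (1 / c) *\<^sub>R t))" for x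
  have \<psi>': "\<psi>' \<in> test_functions UNIV"
    unfolding \<psi>'_def using c by (intro test_functions_affine[OF \<psi>]) auto
  note [measurable] = test_function_borel[OF \<psi>'] test_function_borel[OF test_functions_iter_partial[OF \<psi>', of "is"]]
  have eq: "\<psi> = (\<lambda>x. \<psi>' (c *\<^sub>R x + t))"
    using c by (auto simp: \<psi>'_def scaleR_add_right)
  have "iter_partial is \<psi> = (\<lambda>x. c ^ length is * iter_partial is \<psi>' (c *\<^sub>R x + t))"
    unfolding eq by (rule iter_partial_affine[OF test_functionsD(1)[OF \<psi>']])
  then have "(\<integral>x. f (c *\<^sub>R x + t) * iter_partial is \<psi> x \<partial>lborel)
     = c ^ length is * (\<integral>x. f (c *\<^sub>R x + t) * iter_partial is \<psi>' (c *\<^sub>R x + t) \<partial>lborel)"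
    by (simp add: mult.left_commute)
  moreover have "(\<integral>x. f x * iter_partial is \<psi>' x \<partial>lborel) = \<bar>c\<bar> ^ DIM(real^'n) * (\<integral>x. f (c *\<^sub>R x + t) * iter_partial is \<psi>' (c *\<^sub>R x + t) \<partial>lborel)"
    by (rule integral_lborel_affine[OF c]) measurable
  moreover have "(\<integral>x. u x * \<psi>' x \<partial>lborel) = \<bar>c\<bar> ^ DIM(real^'n) * (\<integral>x. u (c *\<^sub>R x + t) * \<psi>' (c *\<^sub>R x + t) \<partial>lborel)"
    by (rule integral_lborel_affine[OF c]) measurable
  moreover have "(\<integral>x. f x * iter_partial is \<psi>' x \<partial>lborel) = (- 1) ^ length is * (\<integral>x. u x * \<psi>' x \<partial>lborel)"
    using fu \<psi>' by (auto simp: wderiv_def)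
  ultimately have "(\<integral>x. f (c *\<^sub>R x + t) * iter_partial is \<psi> x \<partial>lborel)
     = c ^ length is * ((- 1) ^ length is * (\<integral>x. u (c *\<^sub>R x + t) * \<psi>' (c *\<^sub>R x + t) \<partial>lborel))"
    using c by (simp add: mult.left_commute[of _ "(- 1) ^ _"])
  then show "(\<integral>x. f (c *\<^sub>R x + t) * iter_partial is \<psi> x \<partial>lborel)
     = (- 1) ^ length is * (\<integral>x. c ^ length is * u (c *\<^sub>R x + t) * \<psi> x \<partial>lborel)"
    by (simp add: eq mult.assoc mult.left_commute)
qed

lemma wderiv_mset: "wderiv is f u \<Longrightarrow> mset is = mset js \<Longrightarrow> wderiv js f u"
  unfolding wderiv_def
  using iter_partial_mset[OF test_functionsD(1), of _ UNIV "is" js] mset_eq_length[of "is" js] by simp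

text \<open>
  Higher weak derivatives of \<open>f\<close> are weak derivatives of each other, because derivatives of test
  functions are test functions.
\<close>

lemma wderiv_step:
  assumes "wderiv is f u" "wderiv (i # is) f u'"
  shows "wderiv [i] u u'"
  unfolding wderiv_def
proof (intro conjI ballI)
  fix \<psi> :: "real^'a \<Rightarrow> real" assume \<psi>: "\<psi> \<in> test_functions UNIV"
  have "iter_partial is (partial_deriv i \<psi>) = iter_partial (is @ [i]) \<psi>"
    by (simp add: iter_partial_append)
  also have "\<dots> = iter_partial (i # is) \<psi>"
    by (rule iter_partial_mset[OF test_functionsD(1)[OF \<psi>]]) simp
  finally have eq: "iter_partial is (partial_deriv i \<psi>) = iter_partial (i # is) \<psi>" .
  have "partial_deriv i \<psi> \<in> test_functions UNIV" using test_functions_iter_partial[OF \<psi>, of "[i]"] by simp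
  then have "(\<integral>x. f x * iter_partial (i # is) \<psi> x \<partial>lborel) = (- 1) ^ length is * (\<integral>x. u x * partial_deriv i \<psi> x \<partial>lborel)"
    using assms(1) eq unfolding wderiv_def by metis
  moreover have "(\<integral>x. f x * iter_partial (i # is) \<psi> x \<partial>lborel) = (- 1) ^ length (i # is) * (\<integral>x. u' x * \<psi> x \<partial>lborel)"
    using assms(2) \<psi> unfolding wderiv_def by blast
  ultimately have "(- 1) ^ length is * (\<integral>x. u x * partial_deriv i \<psi> x \<partial>lborel) = (- 1) ^ length is * - (\<integral>x. u' x * \<psi> x \<partial>lborel)"
    by simp
  then have "(\<integral>x. u x * partial_deriv i \<psi> x \<partial>lborel) = - (\<integral>x. u' x * \<psi> x \<partial>lborel)"
    by (subst (asm) mult_cancel_left) simp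
  then show "(\<integral>x. u x * iter_partial [i] \<psi> x \<partial>lborel) = (- 1) ^ length [i] * (\<integral>x. u' x * \<psi> x \<partial>lborel)"
    by simp
qed (use assms in \<open>auto simp: wderiv_def\<close>)

lemma mollifier_kernel_translate:
  assumes "mollifier \<eta>"
  shows "mollifier_kernel \<eta> m (x + s) y = mollifier_kernel \<eta> m x (y - s)"
  unfolding mollifier_kernel_def[OF assms] by (simp add: scaleR_add_right scaleR_diff_right add.commute add.left_commute diff_conv_add_uminus del: of_nat_Suc add_uminus_conv_diff)

text \<open>
  Mollification turns a weak first derivative into a classical one: translating the argument of the
  mollification translates the kernel in the opposite direction.
\<close>

lemma mollify_DERIV:
  assumes eta: "mollifier \<eta>" and u: "wderiv [i] u u'"
  shows "((\<lambda>t. mollify \<eta> m u (x + t *\<^sub>R axis i 1)) has_field_derivative mollify \<eta> m u' (x + t *\<^sub>R axis i 1)) (at t)"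
proof -
  have lu: "loc_int u" and lu': "loc_int u'" using u by (auto simp: wderiv_def)
  let ?x = "x + t *\<^sub>R axis i 1"
  have "((\<lambda>h. \<integral>y. u y * mollifier_kernel \<eta> m ?x (y - h *\<^sub>R axis i 1) \<partial>lborel) has_field_derivative
     - (\<integral>y. u y * partial_deriv i (mollifier_kernel \<eta> m ?x) y \<partial>lborel)) (at 0)"
    by (rule translated_pairing_DERIV[OF lu mollifier_kernel_test[OF eta]])
  moreover have "- (\<integral>y. u y * partial_deriv i (mollifier_kernel \<eta> m ?x) y \<partial>lborel) = mollify \<eta> m u' ?x"
    using u mollifier_kernel_test[OF eta, of m ?x] mollify_kernel[OF eta loc_int_measurable[OF lu'], of m ?x]
    by (auto simp: wderiv_def)
  moreover have "(\<integral>y. u y * mollifier_kernel \<eta> m ?x (y - h *\<^sub>R axis i 1) \<partial>lborel) = mollify \<eta> m u (x + (t + h) *\<^sub>R axis i 1)" for h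
    by (simp add: mollify_kernel[OF eta loc_int_measurable[OF lu]] mollifier_kernel_translate[OF eta, symmetric] algebra_simps)
  ultimately have "((\<lambda>h. mollify \<eta> m u (x + (t + h) *\<^sub>R axis i 1)) has_field_derivative mollify \<eta> m u' ?x) (at 0)"
    by simp
  then show ?thesis
    using DERIV_shift[of "\<lambda>t. mollify \<eta> m u (x + t *\<^sub>R axis i 1)" _ 0 t] by (simp add: add.commute)
qed

lemma mollifier_kernel_small_supp:
  assumes eta: "mollifier \<eta>" and R: "\<And>x. x \<notin> cball 0 R \<Longrightarrow> \<eta> x = 0" and ne: "mollifier_kernel \<eta> m x y \<noteq> 0"
  shows "dist x y \<le> R / real (Suc m)"
proof -
  have "norm ((- real (Suc m)) *\<^sub>R y + real (Suc m) *\<^sub>R x) \<le> R"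
    using ne R unfolding mollifier_kernel_def[OF eta] by force
  moreover have "(- real (Suc m)) *\<^sub>R y + real (Suc m) *\<^sub>R x = real (Suc m) *\<^sub>R (x - y)"
    by (simp add: scaleR_diff_right del: of_nat_Suc)
  ultimately have "real (Suc m) * norm (x - y) \<le> R" by (metis abs_of_nat norm_scaleR)
  then show ?thesis by (simp add: field_simps dist_norm)
qed

lemma mollify_continuous:
  assumes eta: "mollifier \<eta>" and u: "loc_int u"
  shows "continuous_on UNIV (mollify \<eta> m u)"
proof (rule continuous_at_imp_continuous_on, rule ballI)
  fix x :: "real^'a"
  have t: "mollifier_kernel \<eta> m x \<in> test_functions UNIV" for x by (rule mollifier_kernel_test[OF eta])
  obtain R where R: "R > 0" "\<And>x. x \<notin> cball 0 R \<Longrightarrow> \<eta> x = 0" using mollifier_supp[OF eta] by blast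
  obtain B where B: "B > 0" "\<And>x. \<bar>\<eta> x\<bar> \<le> B" using test_function_bounded[OF mollifier_test[OF eta]] by blast
  have "(\<lambda>k. mollify \<eta> m u (h k)) \<longlonglongrightarrow> mollify \<eta> m u x" if h: "h \<longlonglongrightarrow> x" for h
  proof -
    obtain T where T: "\<And>k. norm (h k) \<le> T" using convergent_imp_Bseq[OF convergentI[OF h]] by (auto simp: Bseq_def)
    have "(\<lambda>k. \<integral>y. u y * mollifier_kernel \<eta> m (h k) y \<partial>lborel) \<longlonglongrightarrow> (\<integral>y. u y * mollifier_kernel \<eta> m x y \<partial>lborel)"
    proof (rule loc_int_tendsto[OF u, where K="cball 0 (T + R)" and B="real (Suc m) ^ CARD('a) * B"])
      show "\<bar>mollifier_kernel \<eta> m (h k) y\<bar> \<le> real (Suc m) ^ CARD('a) * B" for k y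
        using B by (auto simp: mollifier_kernel_def[OF eta] abs_mult intro!: mult_left_mono)
      show "mollifier_kernel \<eta> m (h k) y = 0" if "y \<notin> cball 0 (T + R)" for k y
      proof (rule ccontr)
        assume "mollifier_kernel \<eta> m (h k) y \<noteq> 0"
        then have "dist (h k) y \<le> R / real (Suc m)" using mollifier_kernel_small_supp[OF eta, of R m "h k" y] R(2) by blast
        also have "\<dots> \<le> R" using R by (simp add: field_simps)
        finally have "norm y \<le> T + R" using T[of k] norm_triangle_sub[of y "h k"] by (simp add: dist_norm norm_minus_commute)
        then show False using that by simp
      qed
      have c: "continuous_on UNIV \<eta>" by (rule mollifier_continuous[OF eta])
      show "(\<lambda>k. mollifier_kernel \<eta> m (h k) y) \<longlonglongrightarrow> mollifier_kernel \<eta> m x y" for y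
        unfolding mollifier_kernel_def[OF eta] using c h
        by (intro tendsto_mult tendsto_const continuous_on_tendsto_compose[OF c] tendsto_add tendsto_scaleR) auto
    qed (auto intro: test_function_borel[OF t])
    then show ?thesis by (simp add: mollify_kernel[OF eta loc_int_measurable[OF u]])
  qed
  then show "isCont (mollify \<eta> m u) x"
    by (simp add: continuous_at_sequentially o_def)
qed

section \<open>Averages over a cube\<close>

text \<open>
  Takes the coordinates in \<open>S\<close> from \<open>y\<close> and the others from \<open>x\<close>. Averaging over \<open>y\<close> in a cube then
  integrates out the coordinates in \<open>S\<close>, which replaces splitting the space into a product.
\<close>

definition mix :: "'n set \<Rightarrow> real ^ 'n \<Rightarrow> real ^ 'n \<Rightarrow> real ^ 'n" where
  "mix S x y = (\<chi> i. if i \<in> S then y $ i else x $ i)"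

lemma mix_nth[simp]: "mix S x y $ i = (if i \<in> S then y $ i else x $ i)"
  by (simp add: mix_def)

lemma continuous_on_mix[continuous_intros]:
  "continuous_on X f \<Longrightarrow> continuous_on X g \<Longrightarrow> continuous_on X (\<lambda>x. mix S (f x) (g x))"
  unfolding mix_def
proof (rule continuous_on_vec_lambda)
  fix i assume "continuous_on X f" "continuous_on X g"
  then show "continuous_on X (\<lambda>x. if i \<in> S then g x $ i else f x $ i)"
    by (cases "i \<in> S") (auto intro: continuous_intros)
qed

lemma mix_empty[simp]: "mix {} x y = x" and mix_UNIV[simp]: "mix UNIV x y = y"
  by (auto simp: vec_eq_iff)

definition swap_coords :: "'n set \<Rightarrow> (real ^ 'n) \<times> (real ^ 'n) \<Rightarrow> (real ^ 'n) \<times> (real ^ 'n)" where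
  "swap_coords S p = (mix S (fst p) (snd p), mix S (snd p) (fst p))"

lemma swap_coords_borel[measurable]: "swap_coords S \<in> borel_measurable borel"
  unfolding swap_coords_def by (intro borel_measurable_continuous_onI continuous_intros)

lemma prod_Basis_vec: "(\<Prod>b\<in>(Basis :: (real^'n) set). f b) = (\<Prod>i\<in>UNIV. f (axis i 1))"
proof -
  have B: "(Basis :: (real^'n) set) = (\<lambda>i. axis i 1) ` UNIV" by (auto simp: Basis_vec_def)
  have I: "inj (\<lambda>i :: 'n. axis i (1::real))" by (auto simp: inj_def axis_eq_axis)
  show ?thesis unfolding B by (subst prod.reindex[OF I]) (simp add: o_def)
qed

lemma prod_Basis_pair: "(\<Prod>b\<in>(Basis :: ((real^'n) \<times> (real^'n)) set). f b) = (\<Prod>i\<in>UNIV. f (axis i 1, 0)) * (\<Prod>i\<in>UNIV. f (0, axis i 1))"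
proof -
  have "(\<Prod>b\<in>(Basis :: ((real^'n) \<times> (real^'n)) set). f b) = (\<Prod>b\<in>Basis. f (b, 0)) * (\<Prod>b\<in>Basis. f (0, b))"
    unfolding Basis_prod_def
    by (subst prod.union_disjoint) (auto simp: prod.reindex inj_on_def)
  then show ?thesis by (simp add: prod_Basis_vec)
qed

text \<open>
  Exchanging some coordinates of two points maps boxes to boxes of the same volume. This invariance
  plays the role of Fubini's theorem for groups of coordinates.
\<close>

lemma lborel_swap_coords: fixes S :: "'n::finite set" shows "distr lborel borel (swap_coords S) = lborel"
proof (rule lborel_eqI[symmetric])
  fix l u :: "(real^'n) \<times> (real^'n)"
  assume le: "\<And>b. b \<in> Basis \<Longrightarrow> l \<bullet> b \<le> u \<bullet> b"
  have le1: "fst l $ i \<le> fst u $ i" for i using le[of "(axis i 1, 0)"] by (simp add: Basis_prod_def inner_axis' inner_prod_def axis_in_Basis_iff inner_axis)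
  have le2: "snd l $ i \<le> snd u $ i" for i using le[of "(0, axis i 1)"] by (simp add: Basis_prod_def inner_axis' inner_prod_def axis_in_Basis_iff inner_axis)
  have boxp: "box l u = box (fst l) (fst u) \<times> box (snd l) (snd u)" for l u :: "(real^'n) \<times> (real^'n)"
    by (cases l; cases u) (auto simp: box_def Basis_prod_def ball_Un)
  have vim: "swap_coords S -` box l u = box (swap_coords S l) (swap_coords S u)"
    by (auto simp: boxp swap_coords_def mem_box_cart split: if_splits)
  have "emeasure (distr lborel borel (swap_coords S)) (box l u) = emeasure lborel (box (swap_coords S l) (swap_coords S u))"
    by (subst emeasure_distr) (auto simp: vim)
  also have "\<dots> = ennreal (\<Prod>b\<in>Basis. (swap_coords S u - swap_coords S l) \<bullet> b)"
  proof (subst emeasure_lborel_box)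
    have "\<forall>b\<in>Basis. swap_coords S l \<bullet> b \<le> swap_coords S u \<bullet> b"
      using le1 le2 by (auto simp: Basis_prod_def swap_coords_def inner_prod_def Basis_vec_def inner_axis)
    then show "\<And>b. b \<in> Basis \<Longrightarrow> swap_coords S l \<bullet> b \<le> swap_coords S u \<bullet> b" by blast
  qed simp
  also have "(\<Prod>b\<in>Basis. (swap_coords S u - swap_coords S l) \<bullet> b) = (\<Prod>b\<in>Basis. (u - l) \<bullet> b)"
    unfolding prod_Basis_pair
    by (auto simp: inner_prod_def inner_axis swap_coords_def prod.distrib[symmetric] intro!: prod.cong)
  finally show "emeasure (distr lborel borel (swap_coords S)) (box l u) = (\<Prod>b\<in>Basis. (u - l) \<bullet> b)" .
qed simp

lemma integrable_compact_continuous: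
  fixes F :: "'a::euclidean_space \<Rightarrow> real"
  assumes "continuous_on UNIV F" "compact S"
  shows "integrable lborel (\<lambda>x. if x \<in> S then F x else 0)"
  using borel_integrable_compact[OF assms(2) continuous_on_subset[OF assms(1) subset_UNIV]]
  by (simp only: indicator_scaleR_eq_if)

lemma powr_add_le: "0 \<le> x \<Longrightarrow> 0 \<le> y \<Longrightarrow> 0 \<le> p \<Longrightarrow> (x + y) powr p \<le> 2 powr p * (x powr p + y powr p)" for x y p :: real
proof -
  assume *: "0 \<le> x" "0 \<le> y" "0 \<le> p"
  have "(x + y) powr p \<le> (2 * max x y) powr p" using * by (intro powr_mono2) auto
  also have "\<dots> = 2 powr p * max x y powr p" using * by (simp add: powr_mult)
  also have "max x y powr p \<le> x powr p + y powr p" by (auto simp: max_def)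
  finally show ?thesis by simp
qed

text \<open>
  Cubes of arbitrary position; the constants below depend on the cube only through its side length \<open>L\<close>.
\<close>

locale side_cube =
  fixes a b :: "real ^ 'n" and L :: real
  assumes L: "L > 0" and side: "\<And>i. b $ i = a $ i + L"
begin

definition weight :: "real ^ 'n \<Rightarrow> real" where
  "weight y = indicator (cbox a b) y / L ^ CARD('n)"

definition avg :: "(real ^ 'n \<Rightarrow> real) \<Rightarrow> real" where
  "avg F = (\<integral>y. F y * weight y \<partial>lborel)"

lemma weight_nonneg: "0 \<le> weight y" using L by (simp add: weight_def)

lemma weight_borel[measurable]: "weight \<in> borel_measurable borel" unfolding weight_def by measurable

lemma vol: "measure lborel (cbox a b) = L ^ CARD('n)"
proof -
  have "\<forall>i. a $ i \<le> b $ i" using side L by auto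
  then have "measure lborel (cbox a b) = (\<Prod>i\<in>UNIV. b $ i - a $ i)"
    by (subst content_cbox_cart) (auto simp: interval_ne_empty_cart(1)[symmetric] set_eq_iff mem_box_cart intro!: exI[of _ a])
  then show ?thesis by (simp add: side)
qed

lemma avg_integrable: "continuous_on UNIV F \<Longrightarrow> integrable lborel (\<lambda>y. F y * weight y)"
proof -
  assume "continuous_on UNIV F"
  then have "integrable lborel (\<lambda>x. if x \<in> cbox a b then F x else 0)"
    by (intro integrable_compact_continuous) auto
  then have "integrable lborel (\<lambda>x. (if x \<in> cbox a b then F x else 0) / L ^ CARD('n))" by (rule integrable_divide)
  moreover have "(if x \<in> cbox a b then F x else 0) / L ^ CARD('n) = F x * weight x" for x
    by (simp add: weight_def)
  ultimately show ?thesis by simp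
qed

lemma avg_eq_integral: "continuous_on UNIV F \<Longrightarrow> avg F = integral (cbox a b) F / L ^ CARD('n)"
proof -
  assume F: "continuous_on UNIV F"
  have "integrable lborel (\<lambda>x. if x \<in> cbox a b then F x else 0)"
    using F by (intro integrable_compact_continuous) auto
  then have s: "set_integrable lborel (cbox a b) F"
    by (simp only: set_integrable_def indicator_scaleR_eq_if)
  have "avg F = (\<integral>y. (indicator (cbox a b) y *\<^sub>R F y) / L ^ CARD('n) \<partial>lborel)"
    by (simp add: avg_def weight_def mult.commute)
  also have "\<dots> = (LINT y:cbox a b|lborel. F y) / L ^ CARD('n)"
    by (simp add: set_lebesgue_integral_def)
  also have "(LINT y:cbox a b|lborel. F y) = integral (cbox a b) F"
    by (rule set_borel_integral_eq_integral(2)[OF s])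
  finally show ?thesis .
qed

lemma avg_const: "avg (\<lambda>_. c) = c"
  using L vol by (simp add: avg_eq_integral)

lemma weight_integral: "(\<integral>y. weight y \<partial>lborel) = 1"
  using avg_const[of 1] by (simp add: avg_def)

lemma avg_mono:
  assumes "continuous_on UNIV F" "continuous_on UNIV G" "\<And>x. x \<in> cbox a b \<Longrightarrow> F x \<le> G x"
  shows "avg F \<le> avg G"
  unfolding avg_def
proof (rule integral_mono)
  show "F x * weight x \<le> G x * weight x" for x
    using assms(3)[of x] L by (auto simp: weight_def indicator_def divide_right_mono)
qed (use assms avg_integrable in auto)

lemma avg_add: "continuous_on UNIV F \<Longrightarrow> continuous_on UNIV G \<Longrightarrow> avg (\<lambda>x. F x + G x) = avg F + avg G"
  unfolding avg_def by (simp add: avg_integrable ring_distribs)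

lemma avg_cmult: "avg (\<lambda>x. c * F x) = c * avg F"
  unfolding avg_def by (simp add: mult.assoc)

lemma avg_multc: "avg (\<lambda>x. F x * c) = avg F * c"
  using avg_cmult[of c F] by (simp add: mult.commute)

lemma avg_sum: "(\<And>i. i \<in> I \<Longrightarrow> continuous_on UNIV (F i)) \<Longrightarrow> avg (\<lambda>x. \<Sum>i\<in>I. F i x) = (\<Sum>i\<in>I. avg (F i))"
  unfolding avg_def by (simp add: sum_distrib_right avg_integrable)

lemma avg_nonneg: "(\<And>x. 0 \<le> F x) \<Longrightarrow> 0 \<le> avg F"
  unfolding avg_def by (auto intro!: Bochner_Integration.integral_nonneg simp: weight_nonneg)

lemma avg_jensen:
  assumes "1 \<le> p" "continuous_on UNIV F" "\<And>x. 0 \<le> F x"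
  shows "avg F powr p \<le> avg (\<lambda>x. F x powr p)"
  unfolding avg_def
proof (rule jensen_powr)
  show "integrable lborel (\<lambda>x. F x powr p * weight x)"
    using assms by (intro avg_integrable continuous_on_powr') auto
qed (use assms weight_nonneg weight_integral avg_integrable avg_integrable[of "\<lambda>_. 1"] in auto)

lemma avg_continuous:
  assumes "continuous_on UNIV (\<lambda>(x, y). K x y)"
  shows "continuous_on UNIV (\<lambda>x. avg (K x))"
proof -
  have "continuous_on UNIV (K x)" for x
  proof -
    have "continuous_on UNIV ((\<lambda>(x, y). K x y) \<circ> (\<lambda>y. (x, y)))"
      by (intro continuous_on_compose continuous_intros continuous_on_subset[OF assms]) auto
    then show ?thesis by (simp add: o_def)
  qed
  moreover have "continuous_on UNIV (\<lambda>x. integral (cbox a b) (K x))"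
    by (rule integral_continuous_on_param) (rule continuous_on_subset[OF assms], simp)
  ultimately show ?thesis by (simp add: avg_eq_integral divide_inverse continuous_on_mult_right)
qed

lemma weight_mix: "weight (mix S y z) * weight (mix S z y) = weight y * weight z"
proof -
  have "mix S y z \<in> cbox a b \<and> mix S z y \<in> cbox a b \<longleftrightarrow> y \<in> cbox a b \<and> z \<in> cbox a b"
    by (auto simp: mem_box_cart split: if_splits)
  then have "indicat_real (cbox a b) (mix S y z) * indicator (cbox a b) (mix S z y) = indicator (cbox a b) y * indicator (cbox a b) z"
    by (auto simp: indicator_def)
  then show ?thesis by (simp add: weight_def)
qed

text \<open>
  The exchange of coordinates preserves both Lebesgue measure and the product of two copies of the cube.
\<close>

lemma avg_swap:
  assumes K: "continuous_on UNIV (\<lambda>(x, y). K x y)"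
  shows "avg (\<lambda>y. avg (\<lambda>z. K (mix S y z) (mix S z y))) = avg (\<lambda>y. avg (\<lambda>z. K y z))"
proof -
  have int: "integrable (lborel \<Otimes>\<^sub>M lborel) (\<lambda>(y, z). J y z * weight z * weight y) \<and>
      avg (\<lambda>y. avg (\<lambda>z. J y z)) = (\<integral>p. (case p of (y, z) \<Rightarrow> J y z * weight z * weight y) \<partial>(lborel \<Otimes>\<^sub>M lborel))"
    if J: "continuous_on UNIV (\<lambda>(x, y). J x y)" for J
  proof -
    have c: "compact (cbox a b \<times> cbox a b)" by (intro compact_Times compact_cbox)
    have "integrable lborel (\<lambda>p. if p \<in> cbox a b \<times> cbox a b then (case p of (y, z) \<Rightarrow> J y z) else 0)"
      using c J by (intro integrable_compact_continuous)
    then have "integrable lborel (\<lambda>p. (if p \<in> cbox a b \<times> cbox a b then (case p of (y, z) \<Rightarrow> J y z) else 0) * (1 / L ^ CARD('n) * (1 / L ^ CARD('n))))"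
      by (rule integrable_mult_left)
    also have "(\<lambda>p. (if p \<in> cbox a b \<times> cbox a b then (case p of (y, z) \<Rightarrow> J y z) else 0) * (1 / L ^ CARD('n) * (1 / L ^ CARD('n))))
      = (\<lambda>(y, z). J y z * weight z * weight y)"
      by (auto simp: fun_eq_iff weight_def indicator_def)
    finally have i: "integrable (lborel \<Otimes>\<^sub>M lborel) (\<lambda>(y, z). J y z * weight z * weight y)"
      by (simp add: lborel_prod)
    have "avg (\<lambda>y. avg (\<lambda>z. J y z)) = (\<integral>y. (\<integral>z. J y z * weight z * weight y \<partial>lborel) \<partial>lborel)"
      by (simp add: avg_def)
    also have "\<dots> = (\<integral>p. (case p of (y, z) \<Rightarrow> J y z * weight z * weight y) \<partial>(lborel \<Otimes>\<^sub>M lborel))"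
      by (rule lborel_pair.integral_fst[OF i])
    finally show ?thesis using i by simp
  qed
  let ?F = "\<lambda>(y, z). K y z * weight z * weight y"
  let ?G = "\<lambda>(y, z). K (mix S y z) (mix S z y) * weight z * weight y"
  have [measurable]: "(\<lambda>(x, y). K x y) \<in> borel_measurable borel" by (rule borel_measurable_continuous_onI[OF K])
  have Fm: "?F \<in> borel_measurable borel"
    using borel_measurable_integrable[OF conjunct1[OF int[OF K]]] by (simp add: lborel_prod)
  have eq: "?G p = ?F (swap_coords S p)" for p
    using weight_mix[of S "fst p" "snd p"] by (simp add: swap_coords_def split_def mult.assoc mult.commute)
  have K': "continuous_on UNIV (\<lambda>(y, z). K (mix S y z) (mix S z y))"
  proof -
    have "continuous_on UNIV ((\<lambda>(x, y). K x y) \<circ> swap_coords S)"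
      unfolding swap_coords_def by (intro continuous_on_compose continuous_intros continuous_on_subset[OF K]) auto
    then show ?thesis by (simp add: o_def split_def swap_coords_def)
  qed
  have "(\<integral>p. ?G p \<partial>lborel) = (\<integral>p. ?F p \<partial>distr lborel borel (swap_coords S))"
    unfolding eq by (rule integral_distr[symmetric]) (use Fm in auto)
  also have "\<dots> = (\<integral>p. ?F p \<partial>lborel)" by (simp only: lborel_swap_coords)
  finally show ?thesis
    using int[OF K] int[OF K'] by (simp only: lborel_prod)
qed


text \<open>
  Averaging a function of a single coordinate over the cube is averaging over its side, as the measure of
  the cube is a product.
\<close>

lemma avg_of_coordinate:
  fixes h :: "real \<Rightarrow> real"
  assumes h: "continuous_on UNIV h" and pos: "\<And>s. 0 \<le> h s"
  shows "avg (\<lambda>z. h (z $ i)) = integral {a $ i..b $ i} h / L"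
proof -
  have [measurable]: "h \<in> borel_measurable borel" using h by (rule borel_measurable_continuous_onI)
  have ch: "continuous_on UNIV (\<lambda>z. h (z $ i))"
    by (rule continuous_on_compose2[OF h]) (auto intro: continuous_intros)
  have pint: "0 \<le> integral {a $ j..b $ j} h" for j
    using pos by (intro Henstock_Kurzweil_Integration.integral_nonneg integrable_continuous_real continuous_on_subset[OF h]) auto
  define f where "f j s = ennreal ((if j = i then h s else 1) * indicator {a $ j..b $ j} s)" for j s
  have [measurable]: "f j \<in> borel_measurable borel" for j unfolding f_def by measurable
  have each: "integral\<^sup>N lborel (f j) = ennreal (if j = i then integral {a $ j..b $ j} h else L)" for j
  proof (cases "j = i")
    case True
    have s: "set_integrable lborel {a $ i..b $ i} h"
      by (rule borel_integrable_atLeastAtMost') (rule continuous_on_subset[OF h], simp)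
    have "integral\<^sup>N lborel (f i) = ennreal (\<integral>s. h s * indicator {a $ i..b $ i} s \<partial>lborel)"
      unfolding f_def using s pos
      by (simp add: set_integrable_def mult.commute nn_integral_eq_integral)
    also have "(\<integral>s. h s * indicator {a $ i..b $ i} s \<partial>lborel) = integral {a $ i..b $ i} h"
      using set_borel_integral_eq_integral(2)[OF s] by (simp add: set_lebesgue_integral_def mult.commute)
    finally show ?thesis using True by simp
  next
    case False
    then have "f j = indicator {a $ j..b $ j}" by (auto simp: fun_eq_iff f_def indicator_def)
    then show ?thesis using False L side[of j] by simp
  qed
  \<comment> \<open>the same factors, indexed by basis vectors instead of coordinates\<close>
  define g where "g c = f (THE j. c = axis j 1)" for c :: "real^'n"
  have g: "g (axis j 1) = f j" for j
    by (simp add: g_def axis_eq_axis)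
  have ind_prod: "indicator (cbox a b) z = (\<Prod>j\<in>UNIV. indicator {a $ j..b $ j} (z $ j) :: real)" for z
    by (auto simp: indicator_def mem_box_cart prod_zero_iff)
  have "ennreal (h (z $ i) * indicator (cbox a b) z) = (\<Prod>j\<in>UNIV. f j (z $ j))" for z
  proof -
    have "h (z $ i) = (\<Prod>j\<in>UNIV. if j = i then h (z $ j) else 1)" by (simp add: prod.delta)
    then have "h (z $ i) * indicator (cbox a b) z = (\<Prod>j\<in>UNIV. (if j = i then h (z $ j) else 1) * indicator {a $ j..b $ j} (z $ j))"
      by (simp add: prod.distrib ind_prod)
    then show ?thesis using pos by (simp add: f_def prod_ennreal)
  qed
  then have "(\<integral>\<^sup>+z. ennreal (h (z $ i) * indicator (cbox a b) z) \<partial>lborel) = (\<integral>\<^sup>+z. (\<Prod>c\<in>Basis. g c (z \<bullet> c)) \<partial>lborel)"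
    by (simp add: prod_Basis_vec g inner_axis)
  also have "\<dots> = (\<Prod>c\<in>Basis. integral\<^sup>N lborel (g c))"
    by (rule nn_integral_lborel_prod) (auto simp: g_def)
  also have "\<dots> = (\<Prod>j\<in>UNIV. integral\<^sup>N lborel (f j))" by (simp add: prod_Basis_vec g)
  also have "\<dots> = (\<Prod>j\<in>UNIV. ennreal (if j = i then integral {a $ j..b $ j} h else L))"
    by (simp only: each)
  also have "(\<Prod>j\<in>UNIV. ennreal (if j = i then integral {a $ j..b $ j} h else L)) = ennreal (\<Prod>j\<in>UNIV. (if j = i then integral {a $ j..b $ j} h else L))"
    using L pint by (intro prod_ennreal) auto
  also have "(\<Prod>j\<in>UNIV. (if j = i then integral {a $ j..b $ j} h else L)) = integral {a $ i..b $ i} h * L ^ (CARD('n) - 1)"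
    by (subst prod.remove[of _ i]) (auto simp: card_Diff_singleton)
  finally have "(\<integral>z. h (z $ i) * indicator (cbox a b) z \<partial>lborel) = integral {a $ i..b $ i} h * L ^ (CARD('n) - 1)"
    using L pos pint by (subst integral_eq_nn_integral) auto
  then have "avg (\<lambda>z. h (z $ i)) = integral {a $ i..b $ i} h * L ^ (CARD('n) - 1) / L ^ CARD('n)"
    by (simp add: avg_def weight_def)
  also have "L ^ CARD('n) = L ^ (CARD('n) - 1) * L"
    by (metis Suc_diff_1 power_Suc2 zero_less_card_finite)
  finally show ?thesis using L by simp
qed

text \<open>
  The increment along a line parallel to the \<open>i\<close>-th axis is at most the integral of \<open>|\<partial>\<^sub>i P|\<close> over the
  whole side, which is \<open>L\<close> times the average of that function over the cube.
\<close>

lemma increment_le_avg_derivative: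
  assumes P': "continuous_on UNIV P'"
    and D: "\<And>x t. ((\<lambda>t. P (x + t *\<^sub>R axis i 1)) has_field_derivative P' (x + t *\<^sub>R axis i 1)) (at t)"
    and x: "x \<in> cbox a b" and z: "z \<in> cbox a b"
  shows "\<bar>P x\<bar> \<le> \<bar>P (mix {i} x z)\<bar> + L * avg (\<lambda>z. \<bar>P' (mix {i} x z)\<bar>)"
proof -
  define line where "line s = x + (s - x $ i) *\<^sub>R axis i 1" for s
  have line: "mix {i} x y = line (y $ i)" for y by (auto simp: line_def vec_eq_iff axis_def)
  have linex: "line (x $ i) = x" by (simp add: line_def)
  have cl: "continuous_on UNIV line" unfolding line_def by (intro continuous_intros)
  define h where "h s = \<bar>P' (line s)\<bar>" for s
  have c': "continuous_on UNIV (\<lambda>s. P' (line s))"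
    by (rule continuous_on_compose2[OF P' cl]) auto
  then have ch: "continuous_on UNIV h" unfolding h_def by (intro continuous_intros)
  have DP: "((\<lambda>s. P (line s)) has_real_derivative P' (line s)) (at s)" for s
    using D[of x "s - x $ i"] DERIV_shift[of "\<lambda>t. P (x + t *\<^sub>R axis i 1)" _ "s" "- x $ i"] by (simp add: line_def)
  have main: "\<bar>P (line t) - P (line s)\<bar> \<le> integral {a $ i..b $ i} h" if st: "s \<le> t" "s \<in> {a $ i..b $ i}" "t \<in> {a $ i..b $ i}" for s t
  proof -
    have "((\<lambda>s. P' (line s)) has_integral (P (line t) - P (line s))) {s..t}"
      using DP by (intro fundamental_theorem_of_calculus st)
        (auto simp: has_real_derivative_iff_has_vector_derivative[symmetric] intro: has_field_derivative_at_within)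
    then have "P (line t) - P (line s) = integral {s..t} (\<lambda>s. P' (line s))" by (simp add: integral_unique)
    also have "\<bar>\<dots>\<bar> \<le> integral {s..t} h"
    proof -
      have "continuous_on {s..t} (\<lambda>s. P' (line s))" by (rule continuous_on_subset[OF c']) simp
      then show ?thesis
        using integral_norm_bound_integral[of "\<lambda>s. P' (line s)" "{s..t}" "\<lambda>s. \<bar>P' (line s)\<bar>"]
        by (simp add: integrable_continuous_real continuous_on_rabs h_def[abs_def])
    qed
    also have "\<dots> \<le> integral {a $ i..b $ i} h"
      using st ch by (intro integral_subset_le integrable_continuous_real) (auto simp: h_def elim: continuous_on_subset)
    finally show ?thesis .
  qed
  have "x $ i \<in> {a $ i..b $ i}" "z $ i \<in> {a $ i..b $ i}" using x z by (auto simp: mem_box_cart)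
  then have "\<bar>P (line (x $ i)) - P (line (z $ i))\<bar> \<le> integral {a $ i..b $ i} h"
    using main[of "x $ i" "z $ i"] main[of "z $ i" "x $ i"] by (cases "x $ i \<le> z $ i") auto
  moreover have "integral {a $ i..b $ i} h = L * avg (\<lambda>z. h (z $ i))"
    using L by (subst avg_of_coordinate[OF ch]) (auto simp: h_def)
  ultimately show ?thesis by (simp add: line linex h_def)
qed

definition sob_const :: "real \<Rightarrow> real" where "sob_const p = (2 * (1 + L)) powr p"

lemma sob_const_ge: "1 \<le> p \<Longrightarrow> 1 \<le> sob_const p"
  unfolding sob_const_def using L by (intro ge_one_powr_ge_zero) auto

text \<open>
  The one-dimensional Sobolev inequality: averaging the previous estimate over \<open>z\<close> bounds the value at
  \<open>x\<close> by averages of the function and its derivative, and Jensen's inequality brings in the power \<open>p\<close>.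
\<close>

lemma coordinate_sobolev:
  assumes p: "1 \<le> p" and P: "continuous_on UNIV P" and P': "continuous_on UNIV P'"
    and D: "\<And>x t. ((\<lambda>t. P (x + t *\<^sub>R axis i 1)) has_field_derivative P' (x + t *\<^sub>R axis i 1)) (at t)"
    and x: "x \<in> cbox a b"
  shows "\<bar>P x\<bar> powr p \<le> sob_const p * avg (\<lambda>z. \<bar>P (mix {i} x z)\<bar> powr p + \<bar>P' (mix {i} x z)\<bar> powr p)"
proof -
  have cP: "continuous_on UNIV (\<lambda>z. \<bar>P (mix {i} x z)\<bar>)" and cP': "continuous_on UNIV (\<lambda>z. \<bar>P' (mix {i} x z)\<bar>)"
    by (intro continuous_intros continuous_on_compose2[OF P] continuous_on_compose2[OF P'], auto)+
  have "\<bar>P x\<bar> = avg (\<lambda>z. \<bar>P x\<bar>)" by (simp add: avg_const)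
  also have "\<dots> \<le> avg (\<lambda>z. \<bar>P (mix {i} x z)\<bar> + L * avg (\<lambda>z. \<bar>P' (mix {i} x z)\<bar>))"
    using increment_le_avg_derivative[OF P' D x]
    by (intro avg_mono continuous_on_const continuous_on_add[OF cP]) auto
  also have "\<dots> = avg (\<lambda>z. \<bar>P (mix {i} x z)\<bar>) + L * avg (\<lambda>z. \<bar>P' (mix {i} x z)\<bar>)"
    using cP by (subst avg_add) (auto simp: avg_const)
  also have "\<dots> = avg (\<lambda>z. \<bar>P (mix {i} x z)\<bar> + L * \<bar>P' (mix {i} x z)\<bar>)"
    using cP cP' by (subst avg_add) (auto simp: avg_cmult intro!: continuous_intros)
  finally have "\<bar>P x\<bar> powr p \<le> avg (\<lambda>z. \<bar>P (mix {i} x z)\<bar> + L * \<bar>P' (mix {i} x z)\<bar>) powr p"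
    using p by (intro powr_mono2) auto
  also have "\<dots> \<le> avg (\<lambda>z. (\<bar>P (mix {i} x z)\<bar> + L * \<bar>P' (mix {i} x z)\<bar>) powr p)"
    using L by (intro avg_jensen p continuous_on_add continuous_on_mult_left cP cP') auto
  also have "\<dots> \<le> avg (\<lambda>z. sob_const p * (\<bar>P (mix {i} x z)\<bar> powr p + \<bar>P' (mix {i} x z)\<bar> powr p))"
  proof (rule avg_mono)
    show "continuous_on UNIV (\<lambda>z. (\<bar>P (mix {i} x z)\<bar> + L * \<bar>P' (mix {i} x z)\<bar>) powr p)"
      "continuous_on UNIV (\<lambda>z. sob_const p * (\<bar>P (mix {i} x z)\<bar> powr p + \<bar>P' (mix {i} x z)\<bar> powr p))"
      using p L by (auto intro!: continuous_on_powr' continuous_on_add continuous_on_mult_left cP cP')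
    show "(\<bar>P (mix {i} x z)\<bar> + L * \<bar>P' (mix {i} x z)\<bar>) powr p \<le> sob_const p * (\<bar>P (mix {i} x z)\<bar> powr p + \<bar>P' (mix {i} x z)\<bar> powr p)" for z
    proof -
      have "\<bar>P (mix {i} x z)\<bar> + L * \<bar>P' (mix {i} x z)\<bar> \<le> (1 + L) * (\<bar>P (mix {i} x z)\<bar> + \<bar>P' (mix {i} x z)\<bar>)"
        using L by (simp add: algebra_simps)
      then have "(\<bar>P (mix {i} x z)\<bar> + L * \<bar>P' (mix {i} x z)\<bar>) powr p \<le> ((1 + L) * (\<bar>P (mix {i} x z)\<bar> + \<bar>P' (mix {i} x z)\<bar>)) powr p"
        using p L by (intro powr_mono2) auto
      also have "\<dots> = (1 + L) powr p * (\<bar>P (mix {i} x z)\<bar> + \<bar>P' (mix {i} x z)\<bar>) powr p"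
        using L by (simp add: powr_mult)
      also have "\<dots> \<le> (1 + L) powr p * (2 powr p * (\<bar>P (mix {i} x z)\<bar> powr p + \<bar>P' (mix {i} x z)\<bar> powr p))"
        using p by (intro mult_left_mono powr_add_le) auto
      also have "(1 + L) powr p * (2 powr p * (\<bar>P (mix {i} x z)\<bar> powr p + \<bar>P' (mix {i} x z)\<bar> powr p))
         = sob_const p * (\<bar>P (mix {i} x z)\<bar> powr p + \<bar>P' (mix {i} x z)\<bar> powr p)"
        using L unfolding sob_const_def by (subst powr_mult) auto
      finally show ?thesis .
    qed
  qed
  finally show ?thesis by (simp add: avg_cmult)
qed

lemma mix_in_cube: "x \<in> cbox a b \<Longrightarrow> y \<in> cbox a b \<Longrightarrow> mix S x y \<in> cbox a b"
  by (auto simp: mem_box_cart)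

text \<open>
  Averaging over the coordinates in \<open>B\<close> and then over the coordinate \<open>i\<close> is averaging over both: exchange
  the \<open>i\<close>-th coordinates of the two integration variables.
\<close>

lemma avg_mix_insert:
  assumes F: "continuous_on UNIV F" and i: "i \<notin> B"
  shows "avg (\<lambda>y. avg (\<lambda>z. F (mix {i} (mix B x y) z))) = avg (\<lambda>y. F (mix (insert i B) x y))"
proof -
  have c: "continuous_on UNIV (\<lambda>(y, z). F (mix {i} (mix B x y) z))"
    unfolding split_def by (rule continuous_on_compose2[OF F]) (auto intro!: continuous_intros)
  have "mix {i} (mix B x (mix {i} y z)) (mix {i} z y) = mix (insert i B) x y" for y z
    using i by (auto simp: vec_eq_iff)
  then show ?thesis
    using avg_swap[OF c, of "{i}"] by (simp add: avg_const)
qed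

text \<open>
  The one-dimensional inequality applied in each direction of \<open>B\<close>. \<open>P e\<close> is the derivative of \<open>P {}\<close>
  taken once in each direction of \<open>e\<close>. The bound depends only on the coordinates of \<open>x\<close>
  outside \<open>B\<close>.
\<close>

lemma iterated_sobolev:
  fixes P :: "'n set \<Rightarrow> real^'n \<Rightarrow> real"
  assumes p: "1 \<le> p" and P: "\<And>e. e \<subseteq> B \<Longrightarrow> continuous_on UNIV (P e)"
    and D: "\<And>e i x t. e \<subseteq> B \<Longrightarrow> i \<in> B \<Longrightarrow> i \<notin> e \<Longrightarrow>
      ((\<lambda>t. P e (x + t *\<^sub>R axis i 1)) has_field_derivative P (insert i e) (x + t *\<^sub>R axis i 1)) (at t)"
    and x: "x \<in> cbox a b"
  shows "\<bar>P {} x\<bar> powr p \<le> sob_const p ^ card B * (\<Sum>e\<in>Pow B. avg (\<lambda>y. \<bar>P e (mix B x y)\<bar> powr p))"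
  using finite[of B] P D x
proof (induction B arbitrary: x)
  case empty
  then show ?case by (simp add: avg_const)
next
  case (insert i B)
  have cp: "continuous_on UNIV (\<lambda>x. \<bar>P e x\<bar> powr p)" if "e \<subseteq> insert i B" for e
    using insert.prems(1)[OF that] p by (intro continuous_on_powr' continuous_intros) auto
  have cm: "continuous_on UNIV (\<lambda>y. \<bar>P e (mix S x (f y))\<bar> powr p)" if "e \<subseteq> insert i B" "continuous_on UNIV f" for e S x and f :: "real^'n \<Rightarrow> real^'n"
    by (rule continuous_on_compose2[OF cp[OF that(1)]]) (auto intro!: continuous_intros that)
  have ci: "continuous_on UNIV (\<lambda>(y, z). \<bar>P e (mix {i} (mix B x y) z)\<bar> powr p)" if "e \<subseteq> insert i B" for e
    unfolding split_def by (rule continuous_on_compose2[OF cp[OF that]]) (auto intro!: continuous_intros)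
  have ca: "continuous_on UNIV (\<lambda>y. avg (\<lambda>z. \<bar>P e (mix {i} (mix B x y) z)\<bar> powr p))" if "e \<subseteq> insert i B" for e
    by (rule avg_continuous[OF ci[OF that]])
  have step: "avg (\<lambda>y. \<bar>P e (mix B x y)\<bar> powr p) \<le> sob_const p *
      (avg (\<lambda>y. \<bar>P e (mix (insert i B) x y)\<bar> powr p) + avg (\<lambda>y. \<bar>P (insert i e) (mix (insert i B) x y)\<bar> powr p))"
    if e: "e \<in> Pow B" for e
  proof -
    have sub: "e \<subseteq> insert i B" "insert i e \<subseteq> insert i B" using e by auto
    have "avg (\<lambda>y. \<bar>P e (mix B x y)\<bar> powr p) \<le>
      avg (\<lambda>y. sob_const p * (avg (\<lambda>z. \<bar>P e (mix {i} (mix B x y) z)\<bar> powr p) + avg (\<lambda>z. \<bar>P (insert i e) (mix {i} (mix B x y) z)\<bar> powr p)))"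
    proof (rule avg_mono)
      fix y assume y: "y \<in> cbox a b"
      have "\<bar>P e (mix B x y)\<bar> powr p \<le> sob_const p * avg (\<lambda>z. \<bar>P e (mix {i} (mix B x y) z)\<bar> powr p + \<bar>P (insert i e) (mix {i} (mix B x y) z)\<bar> powr p)"
        using insert.prems(1)[OF sub(1)] insert.prems(1)[OF sub(2)] insert.prems(2)[OF sub(1), of i] insert.hyps e
        by (intro coordinate_sobolev p mix_in_cube insert.prems(3) y) auto
      also have "avg (\<lambda>z. \<bar>P e (mix {i} (mix B x y) z)\<bar> powr p + \<bar>P (insert i e) (mix {i} (mix B x y) z)\<bar> powr p)
        = avg (\<lambda>z. \<bar>P e (mix {i} (mix B x y) z)\<bar> powr p) + avg (\<lambda>z. \<bar>P (insert i e) (mix {i} (mix B x y) z)\<bar> powr p)"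
        by (intro avg_add cm sub continuous_on_id)
      finally show "\<bar>P e (mix B x y)\<bar> powr p \<le> sob_const p * (avg (\<lambda>z. \<bar>P e (mix {i} (mix B x y) z)\<bar> powr p) + avg (\<lambda>z. \<bar>P (insert i e) (mix {i} (mix B x y) z)\<bar> powr p))" .
    qed (intro cm sub continuous_on_id continuous_intros ca)+
    also have "\<dots> = sob_const p * (avg (\<lambda>y. avg (\<lambda>z. \<bar>P e (mix {i} (mix B x y) z)\<bar> powr p)) + avg (\<lambda>y. avg (\<lambda>z. \<bar>P (insert i e) (mix {i} (mix B x y) z)\<bar> powr p)))"
      by (subst avg_cmult, subst avg_add[OF ca[OF sub(1)] ca[OF sub(2)]]) (rule refl)
    finally show ?thesis
      using avg_mix_insert[OF cp[OF sub(1)] insert.hyps(2)] avg_mix_insert[OF cp[OF sub(2)] insert.hyps(2)] by simp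
  qed
  have "\<bar>P {} x\<bar> powr p \<le> sob_const p ^ card B * (\<Sum>e\<in>Pow B. avg (\<lambda>y. \<bar>P e (mix B x y)\<bar> powr p))"
  proof (rule insert.IH)
    show "continuous_on UNIV (P e)" if "e \<subseteq> B" for e using insert.prems(1) that by blast
    show "((\<lambda>t. P e (x + t *\<^sub>R axis j 1)) has_real_derivative P (insert j e) (x + t *\<^sub>R axis j 1)) (at t)"
      if "e \<subseteq> B" "j \<in> B" "j \<notin> e" for e j x t using insert.prems(2) that by blast
  qed (rule insert.prems(3))
  also have "\<dots> \<le> sob_const p ^ card B * (\<Sum>e\<in>Pow B. sob_const p *
      (avg (\<lambda>y. \<bar>P e (mix (insert i B) x y)\<bar> powr p) + avg (\<lambda>y. \<bar>P (insert i e) (mix (insert i B) x y)\<bar> powr p)))"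
    using sob_const_ge[OF p] by (intro mult_left_mono sum_mono step) auto
  also have "\<dots> = sob_const p ^ card (insert i B) * (\<Sum>e\<in>Pow (insert i B). avg (\<lambda>y. \<bar>P e (mix (insert i B) x y)\<bar> powr p))"
  proof -
    have "(\<Sum>e\<in>Pow (insert i B). avg (\<lambda>y. \<bar>P e (mix (insert i B) x y)\<bar> powr p))
      = (\<Sum>e\<in>Pow B. avg (\<lambda>y. \<bar>P e (mix (insert i B) x y)\<bar> powr p)) + (\<Sum>e\<in>insert i ` Pow B. avg (\<lambda>y. \<bar>P e (mix (insert i B) x y)\<bar> powr p))"
      unfolding Pow_insert using insert.hyps by (intro sum.union_disjoint) auto
    also have "(\<Sum>e\<in>insert i ` Pow B. avg (\<lambda>y. \<bar>P e (mix (insert i B) x y)\<bar> powr p)) = (\<Sum>e\<in>Pow B. avg (\<lambda>y. \<bar>P (insert i e) (mix (insert i B) x y)\<bar> powr p))"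
    proof -
      have "inj_on (insert i) (Pow B)" using insert.hyps(2) by (auto simp: inj_on_def)
      then show ?thesis by (simp add: sum.reindex)
    qed
    finally show ?thesis using insert.hyps by (simp add: sum.distrib sum_distrib_left[symmetric] mult_ac)
  qed
  finally show ?case .
qed

text \<open>
  The first factor depends only on the coordinates outside \<open>B\<close>, the second only on those in \<open>B\<close>, so
  after an exchange of the coordinates in \<open>B\<close> they depend on independent variables.
\<close>

lemma avg_product_complementary:
  assumes G: "continuous_on UNIV G" and H: "continuous_on UNIV H"
  shows "avg (\<lambda>x. avg (\<lambda>y. G (mix B x y)) * avg (\<lambda>y. H (mix (- B) x y))) = avg G * avg H"
proof -
  define u where "u x = avg (\<lambda>y. G (mix B x y))" for x
  define h where "h x = avg (\<lambda>y. H (mix (- B) x y))" for x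
  have cG: "continuous_on UNIV (\<lambda>(x, y). G (mix B x y))" and cH: "continuous_on UNIV (\<lambda>(x, y). H (mix (- B) x y))"
    unfolding split_def by (rule continuous_on_compose2[OF G] continuous_on_compose2[OF H]; auto intro!: continuous_intros)+
  have cu: "continuous_on UNIV u" and ch: "continuous_on UNIV h"
    unfolding u_def h_def by (rule avg_continuous[OF cG] avg_continuous[OF cH])+
  have u: "u (mix B x y) = u x" for x y
  proof -
    have "mix B (mix B x y) z = mix B x z" for z by (auto simp: vec_eq_iff)
    then show ?thesis by (simp add: u_def)
  qed
  have h: "h (mix B x y) = h y" for x y
  proof -
    have "mix (- B) (mix B x y) z = mix (- B) y z" for z by (auto simp: vec_eq_iff)
    then show ?thesis by (simp add: h_def)
  qed
  have c: "continuous_on UNIV (\<lambda>(x, y::real^'n). u x * h x)"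
    unfolding split_def by (intro continuous_intros continuous_on_compose2[OF cu] continuous_on_compose2[OF ch]) auto
  have "avg (\<lambda>x. u x * h x) = avg (\<lambda>x. avg (\<lambda>y. u x * h x))" by (simp add: avg_const)
  also have "\<dots> = avg (\<lambda>x. avg (\<lambda>y. u x * h y))"
    using avg_swap[OF c, of B] by (simp add: u h)
  also have "\<dots> = avg u * avg h" by (simp add: avg_cmult avg_multc)
  also have "avg u = avg G"
  proof -
    have c: "continuous_on UNIV (\<lambda>(x, y::real^'n). G x)"
      unfolding split_def by (intro continuous_intros continuous_on_compose2[OF G]) auto
    show ?thesis using avg_swap[OF c, of B] by (simp add: u_def[abs_def] avg_const)
  qed
  also have "avg h = avg H"
  proof -
    have c: "continuous_on UNIV (\<lambda>(x, y::real^'n). H x)"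
      unfolding split_def by (intro continuous_intros continuous_on_compose2[OF H]) auto
    show ?thesis using avg_swap[OF c, of "- B"] by (simp add: h_def[abs_def] avg_const)
  qed
  finally show ?thesis by (simp add: u_def h_def)
qed

end

section \<open>Mixed Sobolev inequalities and continuous representatives\<close>

definition index_box :: "nat \<Rightarrow> (nat ^ 'n) set" where
  "index_box \<alpha> = {r. \<forall>i. r $ i \<le> \<alpha>}"

lemma finite_index_box: "finite (index_box \<alpha> :: (nat ^ 'n) set)"
proof -
  have "finite (PiE (UNIV :: 'n set) (\<lambda>_. {..\<alpha>}))" by (intro finite_PiE) auto
  moreover have "index_box \<alpha> \<subseteq> vec_lambda ` PiE (UNIV :: 'n set) (\<lambda>_. {..\<alpha>})"
  proof
    fix r :: "nat ^ 'n" assume "r \<in> index_box \<alpha>"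
    then have "($) r \<in> PiE UNIV (\<lambda>_. {..\<alpha>})" by (auto simp: index_box_def)
    then show "r \<in> vec_lambda ` PiE UNIV (\<lambda>_. {..\<alpha>})" by (force intro: image_eqI[of _ _ "($) r"])
  qed
  ultimately show ?thesis using finite_subset by blast
qed

definition indicator_index :: "'n set \<Rightarrow> nat ^ 'n" where
  "indicator_index e = (\<chi> i. if i \<in> e then 1 else 0)"

lemma indicator_index_empty: "indicator_index {} = 0" by (simp add: indicator_index_def vec_eq_iff)

lemma indicator_index_insert: "i \<notin> e \<Longrightarrow> indicator_index (insert i e) = indicator_index e + axis i 1"
  by (auto simp: indicator_index_def vec_eq_iff axis_def)

lemma indicator_index_inj: "inj (indicator_index :: 'n set \<Rightarrow> nat ^ 'n)"
proof (rule injI)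
  fix x y :: "'n set" assume "indicator_index x = (indicator_index y :: nat ^ 'n)"
  then have *: "indicator_index x $ i = (indicator_index y :: nat ^ 'n) $ i" for i by simp
  have "i \<in> x \<longleftrightarrow> i \<in> y" for i using *[of i] by (simp add: indicator_index_def split: if_splits)
  then show "x = y" by blast
qed

text \<open>
  \<open>P r\<close> behaves like the \<open>r\<close>-th derivative of \<open>P 0\<close>. Only derivatives along coordinate lines are demanded:
  this is all that the Sobolev inequality uses, and it is immediate for mollifications.
\<close>

definition smooth_family :: "nat \<Rightarrow> (nat ^ 'n \<Rightarrow> real ^ 'n \<Rightarrow> real) \<Rightarrow> bool" where
  "smooth_family \<alpha> P \<longleftrightarrow> (\<forall>r\<in>index_box \<alpha>. continuous_on UNIV (P r)) \<and>
    (\<forall>r\<in>index_box \<alpha>. \<forall>i. r $ i < \<alpha> \<longrightarrow> (\<forall>x t.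
      ((\<lambda>t. P r (x + t *\<^sub>R axis i 1)) has_field_derivative P (r + axis i 1) (x + t *\<^sub>R axis i 1)) (at t)))"

definition weak_family :: "nat \<Rightarrow> (nat ^ 'n \<Rightarrow> real ^ 'n \<Rightarrow> real) \<Rightarrow> bool" where
  "weak_family \<alpha> u \<longleftrightarrow> (\<forall>r\<in>index_box \<alpha>. loc_int (u r)) \<and>
    (\<forall>r\<in>index_box \<alpha>. \<forall>i. r $ i < \<alpha> \<longrightarrow> wderiv [i] (u r) (u (r + axis i 1)))"

lemma smooth_family_mollify:
  assumes "mollifier \<eta>" "weak_family \<alpha> u"
  shows "smooth_family \<alpha> (\<lambda>r. mollify \<eta> m (u r))"
  using assms unfolding smooth_family_def weak_family_def
  by (auto intro!: mollify_continuous mollify_DERIV)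

lemma smooth_family_diff:
  assumes "smooth_family \<alpha> P" "smooth_family \<alpha> Q"
  shows "smooth_family \<alpha> (\<lambda>r x. P r x - Q r x)"
  using assms unfolding smooth_family_def by (auto intro!: continuous_intros DERIV_diff)

context side_cube
begin

lemma sobolev_partial:
  assumes p: "1 \<le> p" and P: "smooth_family \<alpha> P" and s: "s \<in> index_box \<alpha>" "\<And>i. i \<in> B \<Longrightarrow> s $ i < \<alpha>"
    and x: "x \<in> cbox a b"
  shows "\<bar>P s x\<bar> powr p \<le> sob_const p ^ card B * avg (\<lambda>y. (\<Sum>e\<in>Pow B. \<bar>P (s + indicator_index e) (mix B x y)\<bar> powr p))"
proof -
  have index_box: "s + indicator_index e \<in> index_box \<alpha>" if "e \<subseteq> B" for e
    using s that by (auto simp: index_box_def indicator_index_def Suc_le_eq subset_iff)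
  have c: "continuous_on UNIV (P (s + indicator_index e))" if "e \<subseteq> B" for e
    using P index_box[OF that] unfolding smooth_family_def by blast
  have lt: "(s + indicator_index e) $ i < \<alpha>" if "e \<subseteq> B" "i \<in> B" "i \<notin> e" for e i
    using s(2)[OF that(2)] that(3) by (simp add: indicator_index_def)
  have "\<bar>P (s + indicator_index {}) x\<bar> powr p \<le> sob_const p ^ card B * (\<Sum>e\<in>Pow B. avg (\<lambda>y. \<bar>P (s + indicator_index e) (mix B x y)\<bar> powr p))"
  proof (rule iterated_sobolev[OF p])
    fix e i x t assume e: "e \<subseteq> B" "i \<in> B" "i \<notin> e"
    have "s + indicator_index (insert i e) = s + indicator_index e + axis i 1"
      using e(3) by (simp add: indicator_index_insert add.assoc)
    then show "((\<lambda>t. P (s + indicator_index e) (x + t *\<^sub>R axis i 1)) has_field_derivative P (s + indicator_index (insert i e)) (x + t *\<^sub>R axis i 1)) (at t)"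
      using P index_box[OF e(1)] lt[OF e] unfolding smooth_family_def by simp
  qed (use c x in auto)
  also have "(\<Sum>e\<in>Pow B. avg (\<lambda>y. \<bar>P (s + indicator_index e) (mix B x y)\<bar> powr p)) = avg (\<lambda>y. (\<Sum>e\<in>Pow B. \<bar>P (s + indicator_index e) (mix B x y)\<bar> powr p))"
  proof (rule avg_sum[symmetric])
    fix e assume "e \<in> Pow B"
    then have c: "continuous_on UNIV (P (s + indicator_index e))" using c by auto
    show "continuous_on UNIV (\<lambda>y. \<bar>P (s + indicator_index e) (mix B x y)\<bar> powr p)"
      using p by (intro continuous_on_powr' continuous_intros continuous_on_compose2[OF c]) auto
  qed
  finally show ?thesis by (simp add: indicator_index_empty)
qed

lemma sum_indicator_index_le:
  fixes s :: "nat ^ 'n"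
  assumes s: "s \<in> index_box \<alpha>" "\<And>i. i \<in> B \<Longrightarrow> s $ i < \<alpha>" and f: "\<And>r. 0 \<le> f r"
  shows "(\<Sum>e\<in>Pow B. f (s + indicator_index e)) \<le> (\<Sum>r\<in>index_box \<alpha>. f r :: real)"
proof -
  have "inj_on (\<lambda>e. s + indicator_index e) (Pow B)" using indicator_index_inj by (auto simp: inj_on_def)
  then have "(\<Sum>e\<in>Pow B. f (s + indicator_index e)) = (\<Sum>r\<in>(\<lambda>e. s + indicator_index e) ` Pow B. f r)"
    by (simp add: sum.reindex)
  also have "\<dots> \<le> (\<Sum>r\<in>index_box \<alpha>. f r)"
    using s by (intro sum_mono2 finite_index_box) (auto simp: index_box_def indicator_index_def Suc_le_eq subset_iff f)
  finally show ?thesis .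
qed

text \<open>
  In a direction with \<open>t\<^sub>i = \<alpha>\<close> one has \<open>s\<^sub>i = 0 < \<alpha>\<close>, so \<open>P s\<close> may be differentiated there once more;
  in all other directions \<open>W t\<close> may. The Sobolev inequality in these complementary sets of directions
  leaves two factors of separate variables.
\<close>

lemma mixed_product_smooth:
  assumes p: "1 \<le> p" and \<alpha>: "1 \<le> \<alpha>" and P: "smooth_family \<alpha> P" and W: "smooth_family \<alpha> W"
    and st: "\<And>i. s $ i + t $ i \<le> \<alpha>"
  shows "avg (\<lambda>x. \<bar>P s x\<bar> powr p * \<bar>W t x\<bar> powr p) \<le>
    sob_const p ^ CARD('n) * (\<Sum>r\<in>index_box \<alpha>. avg (\<lambda>x. \<bar>P r x\<bar> powr p)) * (\<Sum>r\<in>index_box \<alpha>. avg (\<lambda>x. \<bar>W r x\<bar> powr p))"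
proof -
  \<comment> \<open>the directions in which \<open>W t\<close> cannot be differentiated any further\<close>
  define B where "B = {i. t $ i = \<alpha>}"
  have s: "s \<in> index_box \<alpha>" "\<And>i. i \<in> B \<Longrightarrow> s $ i < \<alpha>"
  proof -
    show "s \<in> index_box \<alpha>" using st by (auto simp: index_box_def intro: order_trans[OF le_add1])
    show "s $ i < \<alpha>" if "i \<in> B" for i using st[of i] that \<alpha> by (simp add: B_def)
  qed
  have t: "t \<in> index_box \<alpha>" "\<And>i. i \<in> - B \<Longrightarrow> t $ i < \<alpha>"
  proof -
    show t: "t \<in> index_box \<alpha>" using st by (auto simp: index_box_def intro: order_trans[OF le_add2])
    show "t $ i < \<alpha>" if "i \<in> - B" for i using t that by (auto simp: B_def index_box_def le_neq_implies_less)
  qed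
  have cp: "continuous_on UNIV (\<lambda>x. \<bar>F r x\<bar> powr p)" if "smooth_family \<alpha> F" "r \<in> index_box \<alpha>" for F and r :: "nat^'n"
  proof -
    have "continuous_on UNIV (F r)" using that by (simp add: smooth_family_def)
    then show ?thesis using p by (intro continuous_on_powr' continuous_on_rabs continuous_on_const) auto
  qed
  have sB: "s + indicator_index e \<in> index_box \<alpha>" if "e \<subseteq> B" for e
    using s that by (auto simp: index_box_def indicator_index_def Suc_le_eq subset_iff)
  have tB: "t + indicator_index e \<in> index_box \<alpha>" if "e \<subseteq> - B" for e
    using t that by (auto simp: index_box_def indicator_index_def Suc_le_eq subset_iff)
  define G where "G x = (\<Sum>e\<in>Pow B. \<bar>P (s + indicator_index e) x\<bar> powr p)" for x
  define H where "H x = (\<Sum>e\<in>Pow (- B). \<bar>W (t + indicator_index e) x\<bar> powr p)" for x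
  have cG: "continuous_on UNIV G" and cH: "continuous_on UNIV H"
    unfolding G_def H_def by (intro continuous_on_sum cp[OF P] cp[OF W]; use sB tB in auto)+
  have cG': "continuous_on UNIV (\<lambda>(x, y). G (mix B x y))" and cH': "continuous_on UNIV (\<lambda>(x, y). H (mix (- B) x y))"
    unfolding split_def by (rule continuous_on_compose2[OF cG] continuous_on_compose2[OF cH]; auto intro!: continuous_intros)+
  let ?c = "sob_const p"
  have c: "1 \<le> ?c" by (rule sob_const_ge[OF p])
  have "avg (\<lambda>x. \<bar>P s x\<bar> powr p * \<bar>W t x\<bar> powr p)
     \<le> avg (\<lambda>x. ?c ^ CARD('n) * (avg (\<lambda>y. G (mix B x y)) * avg (\<lambda>y. H (mix (- B) x y))))"
  proof (rule avg_mono)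
    fix x assume x: "x \<in> cbox a b"
    have 1: "\<bar>P s x\<bar> powr p \<le> ?c ^ card B * avg (\<lambda>y. G (mix B x y))"
      unfolding G_def by (rule sobolev_partial[OF p P s x])
    have 2: "\<bar>W t x\<bar> powr p \<le> ?c ^ card (- B) * avg (\<lambda>y. H (mix (- B) x y))"
      unfolding H_def by (rule sobolev_partial[OF p W t x])
    have card: "card B + card (- B) = CARD('n)" using card_Un_disjoint[of B "- B"] by simp
    have "\<bar>P s x\<bar> powr p * \<bar>W t x\<bar> powr p \<le> (?c ^ card B * avg (\<lambda>y. G (mix B x y))) * (?c ^ card (- B) * avg (\<lambda>y. H (mix (- B) x y)))"
      using c by (intro mult_mono 1 2) (auto intro!: mult_nonneg_nonneg avg_nonneg sum_nonneg simp: G_def)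
    also have "\<dots> = ?c ^ CARD('n) * (avg (\<lambda>y. G (mix B x y)) * avg (\<lambda>y. H (mix (- B) x y)))"
      by (simp add: card[symmetric] power_add)
    finally show "\<bar>P s x\<bar> powr p * \<bar>W t x\<bar> powr p \<le> \<dots>" .
  next
    show "continuous_on UNIV (\<lambda>x. \<bar>P s x\<bar> powr p * \<bar>W t x\<bar> powr p)"
      by (intro continuous_on_mult cp[OF P] cp[OF W] s t)
    show "continuous_on UNIV (\<lambda>x. ?c ^ CARD('n) * (avg (\<lambda>y. G (mix B x y)) * avg (\<lambda>y. H (mix (- B) x y))))"
      by (intro continuous_intros avg_continuous[OF cG'] avg_continuous[OF cH'])
  qed
  also have "\<dots> = ?c ^ CARD('n) * (avg G * avg H)"
    by (subst avg_cmult, subst avg_product_complementary[OF cG cH]) (rule refl)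
  also have "\<dots> \<le> ?c ^ CARD('n) * ((\<Sum>r\<in>index_box \<alpha>. avg (\<lambda>x. \<bar>P r x\<bar> powr p)) * (\<Sum>r\<in>index_box \<alpha>. avg (\<lambda>x. \<bar>W r x\<bar> powr p)))"
  proof (intro mult_left_mono mult_mono)
    have "avg G = (\<Sum>e\<in>Pow B. avg (\<lambda>x. \<bar>P (s + indicator_index e) x\<bar> powr p))"
      unfolding G_def by (rule avg_sum) (use cp[OF P] sB in auto)
    also have "\<dots> \<le> (\<Sum>r\<in>index_box \<alpha>. avg (\<lambda>x. \<bar>P r x\<bar> powr p))"
      by (rule sum_indicator_index_le[OF s, where f="\<lambda>r. avg (\<lambda>x. \<bar>P r x\<bar> powr p)"]) (auto intro: avg_nonneg)
    finally show "avg G \<le> (\<Sum>r\<in>index_box \<alpha>. avg (\<lambda>x. \<bar>P r x\<bar> powr p))" .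
    have "avg H = (\<Sum>e\<in>Pow (- B). avg (\<lambda>x. \<bar>W (t + indicator_index e) x\<bar> powr p))"
      unfolding H_def by (rule avg_sum) (use cp[OF W] tB in auto)
    also have "\<dots> \<le> (\<Sum>r\<in>index_box \<alpha>. avg (\<lambda>x. \<bar>W r x\<bar> powr p))"
      by (rule sum_indicator_index_le[OF t, where f="\<lambda>r. avg (\<lambda>x. \<bar>W r x\<bar> powr p)"]) (auto intro: avg_nonneg)
    finally show "avg H \<le> (\<Sum>r\<in>index_box \<alpha>. avg (\<lambda>x. \<bar>W r x\<bar> powr p))" .
  qed (use c in \<open>auto intro!: sum_nonneg avg_nonneg simp: H_def\<close>)
  finally show ?thesis by (simp add: mult.assoc)
qed

text \<open>
  The local convergence of mollifications, written with averages; the integrability is recorded for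
  the passage to an almost everywhere convergent subsequence.
\<close>

lemma mollify_avg_L1:
  assumes eta: "mollifier \<eta>" and v: "loc_int v"
  shows "(\<lambda>m. avg (\<lambda>x. \<bar>mollify \<eta> m v x - v x\<bar>)) \<longlonglongrightarrow> 0"
    and "integrable lborel (\<lambda>x. (mollify \<eta> m v x - v x) * weight x)"
proof -
  have [measurable]: "v \<in> borel_measurable borel" "mollify \<eta> m v \<in> borel_measurable borel" for m
    using loc_int_measurable[OF v] mollify_borel[OF eta loc_int_measurable[OF v]] by auto
  have lm: "loc_int (\<lambda>x. mollify \<eta> m v x - v x)" for m
    using loc_int_add[OF continuous_loc_int[OF mollify_continuous[OF eta v, of m]] loc_int_cmult[OF v, of "-1"]] by simp
  have i: "integrable lborel (\<lambda>x. (mollify \<eta> m v x - v x) * weight x)" for m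
  proof (rule loc_int_mult_bounded_compact[OF lm, where K="cbox a b"])
    show "\<bar>weight x\<bar> \<le> 1 / L ^ CARD('n)" for x using L by (simp add: weight_def indicator_def)
  qed (auto simp: weight_def)
  then show "integrable lborel (\<lambda>x. (mollify \<eta> m v x - v x) * weight x)" .
  have eq: "ennreal (avg (\<lambda>x. \<bar>mollify \<eta> m v x - v x\<bar>)) = ennreal (1 / L ^ CARD('n)) * (\<integral>\<^sup>+x. indicator (cbox a b) x * ennreal \<bar>mollify \<eta> m v x - v x\<bar> \<partial>lborel)" for m
  proof -
    have "integrable lborel (\<lambda>x. \<bar>mollify \<eta> m v x - v x\<bar> * weight x)"
      using integrable_abs[OF i[of m]] by (simp add: abs_mult weight_nonneg)
    then have "ennreal (avg (\<lambda>x. \<bar>mollify \<eta> m v x - v x\<bar>)) = (\<integral>\<^sup>+x. ennreal (\<bar>mollify \<eta> m v x - v x\<bar> * weight x) \<partial>lborel)"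
      unfolding avg_def by (subst nn_integral_eq_integral) (auto simp: weight_nonneg)
    also have "\<dots> = (\<integral>\<^sup>+x. ennreal (1 / L ^ CARD('n)) * (indicator (cbox a b) x * ennreal \<bar>mollify \<eta> m v x - v x\<bar>) \<partial>lborel)"
      using L by (intro nn_integral_cong) (auto simp: weight_def indicator_def ennreal_mult'[symmetric])
    also have "\<dots> = ennreal (1 / L ^ CARD('n)) * (\<integral>\<^sup>+x. indicator (cbox a b) x * ennreal \<bar>mollify \<eta> m v x - v x\<bar> \<partial>lborel)"
      by (rule nn_integral_cmult) measurable
    finally show ?thesis .
  qed
  have "(\<lambda>m. ennreal (1 / L ^ CARD('n)) * (\<integral>\<^sup>+x. indicator (cbox a b) x * ennreal \<bar>mollify \<eta> m v x - v x\<bar> \<partial>lborel)) \<longlonglongrightarrow> ennreal (1 / L ^ CARD('n)) * 0"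
    by (intro ennreal_tendsto_cmult mollify_local_L1[OF eta v]) auto
  then have "(\<lambda>m. ennreal (avg (\<lambda>x. \<bar>mollify \<eta> m v x - v x\<bar>))) \<longlonglongrightarrow> ennreal 0"
    by (simp add: eq)
  then show "(\<lambda>m. avg (\<lambda>x. \<bar>mollify \<eta> m v x - v x\<bar>)) \<longlonglongrightarrow> 0"
    by (subst (asm) tendsto_ennreal_iff) (auto intro!: avg_nonneg always_eventually)
qed

lemma loc_int_weight_integrable:
  assumes "loc_int v" shows "integrable lborel (\<lambda>x. v x * weight x)"
proof (rule loc_int_mult_bounded_compact[OF assms, where K="cbox a b"])
  show "\<bar>weight x\<bar> \<le> 1 / L ^ CARD('n)" for x using L by (simp add: weight_def indicator_def)
qed (auto simp: weight_def)

lemma mollify_avg_tendsto: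
  assumes eta: "mollifier \<eta>" and v: "loc_int v"
  shows "(\<lambda>m. avg (mollify \<eta> m v)) \<longlonglongrightarrow> avg v"
proof -
  have im: "integrable lborel (\<lambda>x. mollify \<eta> m v x * weight x)" for m
    by (intro loc_int_weight_integrable continuous_loc_int mollify_continuous eta v)
  have "\<bar>avg (mollify \<eta> m v) - avg v\<bar> \<le> avg (\<lambda>x. \<bar>mollify \<eta> m v x - v x\<bar>)" for m
  proof -
    have "avg (mollify \<eta> m v) - avg v = (\<integral>x. (mollify \<eta> m v x - v x) * weight x \<partial>lborel)"
      unfolding avg_def using im[of m] loc_int_weight_integrable[OF v] by (simp add: left_diff_distrib)
    also have "\<bar>\<dots>\<bar> \<le> (\<integral>x. \<bar>(mollify \<eta> m v x - v x) * weight x\<bar> \<partial>lborel)"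
      by (rule integral_abs_bound)
    finally show ?thesis by (simp add: avg_def abs_mult weight_nonneg)
  qed
  then have "(\<lambda>m. \<bar>avg (mollify \<eta> m v) - avg v\<bar>) \<longlonglongrightarrow> 0"
    by (intro tendsto_sandwich[OF _ _ tendsto_const mollify_avg_L1(1)[OF eta v]]) simp_all
  then show ?thesis by (rule LIM_zero_cancel[OF tendsto_rabs_zero_cancel])
qed

lemma mollify_AE_subseq:
  assumes eta: "mollifier \<eta>" and v: "loc_int v"
  obtains k where "strict_mono k" "AE x in lborel. x \<in> cbox a b \<longrightarrow> (\<lambda>m. mollify \<eta> (k m) v x) \<longlonglongrightarrow> v x"
proof -
  have "(\<lambda>m. \<integral>x. norm ((mollify \<eta> m v x - v x) * weight x) \<partial>lborel) \<longlonglongrightarrow> 0"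
    using mollify_avg_L1(1)[OF eta v] by (simp add: avg_def abs_mult weight_nonneg)
  from tendsto_L1_AE_subseq[OF mollify_avg_L1(2)[OF eta v] this]
  obtain k where k: "strict_mono k" "AE x in lborel. (\<lambda>m. (mollify \<eta> (k m) v x - v x) * weight x) \<longlonglongrightarrow> 0"
    by blast
  have "AE x in lborel. x \<in> cbox a b \<longrightarrow> (\<lambda>m. mollify \<eta> (k m) v x) \<longlonglongrightarrow> v x"
    using k(2)
  proof (eventually_elim, intro impI)
    fix x assume *: "(\<lambda>m. (mollify \<eta> (k m) v x - v x) * weight x) \<longlonglongrightarrow> 0" and x: "x \<in> cbox a b"
    have "(\<lambda>m. (mollify \<eta> (k m) v x - v x) * weight x * L ^ CARD('n)) \<longlonglongrightarrow> 0 * L ^ CARD('n)"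
      by (intro tendsto_mult * tendsto_const)
    then have "(\<lambda>m. mollify \<eta> (k m) v x - v x) \<longlonglongrightarrow> 0" using L x by (simp add: weight_def)
    then show "(\<lambda>m. mollify \<eta> (k m) v x) \<longlonglongrightarrow> v x" by (rule LIM_zero_cancel)
  qed
  with k(1) show thesis using that by blast
qed

text \<open>
  Apply the estimate to the mollified derivatives. On the right, Jensen's inequality reduces to
  mollifications of \<open>|u\<^sub>r|\<^sup>p\<close>, whose averages converge; on the left, Fatou's lemma applies along
  an almost everywhere convergent subsequence.
\<close>

lemma mixed_product_weak:
  fixes \<eta> :: "real ^ 'n \<Rightarrow> real"
  assumes p: "1 \<le> p" and \<alpha>: "1 \<le> \<alpha>" and eta: "mollifier \<eta>" and u: "weak_family \<alpha> u" and W: "smooth_family \<alpha> W"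
    and up: "\<And>r. r \<in> index_box \<alpha> \<Longrightarrow> loc_int (\<lambda>x. \<bar>u r x\<bar> powr p)"
    and st: "\<And>i. s $ i + t $ i \<le> \<alpha>"
  shows "avg (\<lambda>x. \<bar>u s x\<bar> powr p * \<bar>W t x\<bar> powr p) \<le>
    sob_const p ^ CARD('n) * (\<Sum>r\<in>index_box \<alpha>. avg (\<lambda>x. \<bar>u r x\<bar> powr p)) * (\<Sum>r\<in>index_box \<alpha>. avg (\<lambda>x. \<bar>W r x\<bar> powr p))"
    (is "_ \<le> ?c * _ * ?N")
proof -
  have s: "s \<in> index_box \<alpha>" and t: "t \<in> index_box \<alpha>"
    using st by (auto simp: index_box_def intro: order_trans[OF le_add1] order_trans[OF le_add2])
  have lu: "loc_int (u r)" if "r \<in> index_box \<alpha>" for r using u that by (simp add: weak_family_def)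
  note [measurable] = loc_int_measurable[OF lu[OF s]] mollify_borel[OF eta loc_int_measurable[OF lu[OF s]]]
  have cW: "continuous_on UNIV (W t)" using W t by (simp add: smooth_family_def)
  then have cW': "continuous_on UNIV (\<lambda>x. \<bar>W t x\<bar> powr p)" using p by (intro continuous_on_powr' continuous_on_rabs continuous_on_const) auto
  note [measurable] = borel_measurable_continuous_onI[OF cW]
  have c0: "0 \<le> ?c" using sob_const_ge[OF p] by simp
  have N0: "0 \<le> ?N" by (intro sum_nonneg avg_nonneg) auto
  let ?M = "\<lambda>m r. avg (mollify \<eta> m (\<lambda>x. \<bar>u r x\<bar> powr p))"
  have bound: "avg (\<lambda>x. \<bar>mollify \<eta> m (u s) x\<bar> powr p * \<bar>W t x\<bar> powr p) \<le> ?c * (\<Sum>r\<in>index_box \<alpha>. ?M m r) * ?N" for m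
  proof -
    have "avg (\<lambda>x. \<bar>mollify \<eta> m (u s) x\<bar> powr p * \<bar>W t x\<bar> powr p) \<le> ?c * (\<Sum>r\<in>index_box \<alpha>. avg (\<lambda>x. \<bar>mollify \<eta> m (u r) x\<bar> powr p)) * ?N"
      by (rule mixed_product_smooth[OF p \<alpha> smooth_family_mollify[OF eta u] W st])
    also have "\<dots> \<le> ?c * (\<Sum>r\<in>index_box \<alpha>. ?M m r) * ?N"
    proof (intro mult_right_mono mult_left_mono sum_mono avg_mono c0 N0)
      fix r :: "nat^'n" assume r: "r \<in> index_box \<alpha>"
      show "continuous_on UNIV (\<lambda>x. \<bar>mollify \<eta> m (u r) x\<bar> powr p)"
        using p by (intro continuous_on_powr' continuous_intros mollify_continuous eta lu r) auto
      show "continuous_on UNIV (mollify \<eta> m (\<lambda>x. \<bar>u r x\<bar> powr p))" by (intro mollify_continuous eta up r)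
      show "\<bar>mollify \<eta> m (u r) x\<bar> powr p \<le> mollify \<eta> m (\<lambda>x. \<bar>u r x\<bar> powr p) x" for x
        by (intro mollify_jensen eta lu up r p)
    qed
    finally show ?thesis .
  qed
  have lim: "(\<lambda>m. ?c * (\<Sum>r\<in>index_box \<alpha>. ?M m r) * ?N) \<longlonglongrightarrow> ?c * (\<Sum>r\<in>index_box \<alpha>. avg (\<lambda>x. \<bar>u r x\<bar> powr p)) * ?N"
    by (intro tendsto_intros tendsto_sum mollify_avg_tendsto eta up)
  obtain k where k: "strict_mono k" "AE x in lborel. x \<in> cbox a b \<longrightarrow> (\<lambda>m. mollify \<eta> (k m) (u s) x) \<longlonglongrightarrow> u s x"
    using mollify_AE_subseq[OF eta lu[OF s]] by blast
  let ?f = "\<lambda>m x. ennreal (\<bar>mollify \<eta> (k m) (u s) x\<bar> powr p * \<bar>W t x\<bar> powr p * weight x)"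
  have "(\<integral>\<^sup>+x. ennreal (\<bar>u s x\<bar> powr p * \<bar>W t x\<bar> powr p * weight x) \<partial>lborel) = (\<integral>\<^sup>+x. liminf (\<lambda>m. ?f m x) \<partial>lborel)"
  proof (rule nn_integral_cong_AE)
    show "AE x in lborel. ennreal (\<bar>u s x\<bar> powr p * \<bar>W t x\<bar> powr p * weight x) = liminf (\<lambda>m. ?f m x)"
      using k(2)
    proof eventually_elim
      fix x assume *: "x \<in> cbox a b \<longrightarrow> (\<lambda>m. mollify \<eta> (k m) (u s) x) \<longlonglongrightarrow> u s x"
      have "(\<lambda>m. ?f m x) \<longlonglongrightarrow> ennreal (\<bar>u s x\<bar> powr p * \<bar>W t x\<bar> powr p * weight x)"
      proof (cases "x \<in> cbox a b")
        case True
        with * have "(\<lambda>m. mollify \<eta> (k m) (u s) x) \<longlonglongrightarrow> u s x" by blast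
        then show ?thesis using p by (intro tendsto_ennrealI tendsto_mult tendsto_const tendsto_powr' tendsto_rabs) auto
      qed (simp add: weight_def)
      then show "ennreal (\<bar>u s x\<bar> powr p * \<bar>W t x\<bar> powr p * weight x) = liminf (\<lambda>m. ?f m x)"
        by (simp add: lim_imp_Liminf)
    qed
  qed
  also have "\<dots> \<le> liminf (\<lambda>m. \<integral>\<^sup>+x. ?f m x \<partial>lborel)"
    by (rule nn_integral_liminf) measurable
  also have "\<dots> \<le> liminf (\<lambda>m. ennreal (?c * (\<Sum>r\<in>index_box \<alpha>. ?M (k m) r) * ?N))"
  proof (rule Liminf_mono, rule always_eventually, rule allI)
    fix m
    have "continuous_on UNIV (\<lambda>x. \<bar>mollify \<eta> (k m) (u s) x\<bar> powr p * \<bar>W t x\<bar> powr p)"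
      using p by (intro continuous_on_mult cW' continuous_on_powr' continuous_intros mollify_continuous eta lu s) auto
    then have "(\<integral>\<^sup>+x. ?f m x \<partial>lborel) = ennreal (avg (\<lambda>x. \<bar>mollify \<eta> (k m) (u s) x\<bar> powr p * \<bar>W t x\<bar> powr p))"
      unfolding avg_def by (subst nn_integral_eq_integral) (auto simp: avg_integrable weight_nonneg)
    then show "(\<integral>\<^sup>+x. ?f m x \<partial>lborel) \<le> ennreal (?c * (\<Sum>r\<in>index_box \<alpha>. ?M (k m) r) * ?N)"
      using bound by (simp add: ennreal_leI)
  qed
  also have "\<dots> = ennreal (?c * (\<Sum>r\<in>index_box \<alpha>. avg (\<lambda>x. \<bar>u r x\<bar> powr p)) * ?N)"
    using LIMSEQ_subseq_LIMSEQ[OF tendsto_ennrealI[OF lim] k(1)]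
    by (intro lim_imp_Liminf) (auto simp: o_def)
  finally have "(\<integral>\<^sup>+x. ennreal (\<bar>u s x\<bar> powr p * \<bar>W t x\<bar> powr p * weight x) \<partial>lborel) \<le> ennreal (?c * (\<Sum>r\<in>index_box \<alpha>. avg (\<lambda>x. \<bar>u r x\<bar> powr p)) * ?N)" .
  moreover have "integrable lborel (\<lambda>x. \<bar>u s x\<bar> powr p * \<bar>W t x\<bar> powr p * weight x)"
    by (intro loc_int_weight_integrable loc_int_mult_continuous up s cW')
  ultimately have "ennreal (avg (\<lambda>x. \<bar>u s x\<bar> powr p * \<bar>W t x\<bar> powr p)) \<le> ennreal (?c * (\<Sum>r\<in>index_box \<alpha>. avg (\<lambda>x. \<bar>u r x\<bar> powr p)) * ?N)"
    unfolding avg_def by (subst (asm) nn_integral_eq_integral) (auto simp: weight_nonneg)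
  then show ?thesis
    using c0 N0 by (subst (asm) ennreal_le_iff) (auto intro!: mult_nonneg_nonneg sum_nonneg avg_nonneg)
qed

text \<open>
  The Sobolev inequality in all directions with exponent 1 bounds the supremum of the difference of
  two mollifications of \<open>u 0\<close> by averages of the differences of the mollified derivatives, and these
  converge in \<open>L\<^sub>1\<close> of the cube.
\<close>

lemma mollify_uniformly_Cauchy:
  assumes eta: "mollifier \<eta>" and u: "weak_family 1 u"
  shows "uniformly_Cauchy_on (cbox a b) (\<lambda>m. mollify \<eta> m (u 0))"
proof (rule uniformly_Cauchy_onI)
  fix e :: real assume e: "e > 0"
  have lu: "loc_int (u r)" if "r \<in> index_box 1" for r using u that by (simp add: weak_family_def)
  let ?c = "sob_const 1 ^ CARD('n)"
  let ?d = "\<lambda>m. \<Sum>r\<in>index_box 1. avg (\<lambda>x. \<bar>mollify \<eta> m (u r) x - u r x\<bar>)"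
  have "(\<lambda>m. ?c * ?d m) \<longlonglongrightarrow> ?c * (\<Sum>r\<in>(index_box 1 :: (nat^'n) set). 0)"
    by (intro tendsto_mult tendsto_const tendsto_sum mollify_avg_L1(1) eta lu)
  then have "eventually (\<lambda>m. ?c * ?d m < e / 2) sequentially"
    using e by (intro order_tendstoD) auto
  then obtain N where N: "\<And>m. m \<ge> N \<Longrightarrow> ?c * ?d m < e / 2" by (auto simp: eventually_sequentially)
  have "dist (mollify \<eta> m (u 0) x) (mollify \<eta> k (u 0) x) < e" if x: "x \<in> cbox a b" and mk: "m \<ge> N" "k \<ge> N" for x m k
  proof -
    let ?P = "\<lambda>r x. mollify \<eta> m (u r) x - mollify \<eta> k (u r) x"
    have sf: "smooth_family 1 ?P" by (intro smooth_family_diff smooth_family_mollify eta u)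
    have c: "continuous_on UNIV (?P r)" if "r \<in> index_box 1" for r using sf that by (simp add: smooth_family_def)
    have "\<bar>?P 0 x\<bar> powr 1 \<le> ?c * avg (\<lambda>y. (\<Sum>e\<in>Pow UNIV. \<bar>?P (0 + indicator_index e) (mix UNIV x y)\<bar> powr 1))"
      by (rule sobolev_partial[OF _ sf _ _ x]) (auto simp: index_box_def)
    also have "avg (\<lambda>y. (\<Sum>e\<in>Pow UNIV. \<bar>?P (0 + indicator_index e) (mix UNIV x y)\<bar> powr 1))
      = (\<Sum>e\<in>Pow UNIV. avg (\<lambda>y. \<bar>?P (0 + indicator_index e) y\<bar>))"
    proof -
      have "continuous_on UNIV (\<lambda>y. \<bar>?P (0 + indicator_index e) y\<bar>)" for e
        by (intro continuous_on_rabs c) (simp add: index_box_def indicator_index_def)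
      then show ?thesis by (simp add: avg_sum)
    qed
    also have "\<dots> \<le> (\<Sum>r\<in>index_box 1. avg (\<lambda>y. \<bar>?P r y\<bar>))"
      by (rule sum_indicator_index_le[where f="\<lambda>r. avg (\<lambda>y. \<bar>?P r y\<bar>)"]) (auto simp: index_box_def intro!: avg_nonneg)
    also have "\<dots> \<le> (\<Sum>r\<in>index_box 1. avg (\<lambda>y. \<bar>mollify \<eta> m (u r) y - u r y\<bar>) + avg (\<lambda>y. \<bar>mollify \<eta> k (u r) y - u r y\<bar>))"
    proof (rule sum_mono)
      fix r :: "nat^'n" assume r: "r \<in> index_box 1"
      have i: "integrable lborel (\<lambda>y. \<bar>mollify \<eta> m (u r) y - u r y\<bar> * weight y)" for m
        using integrable_abs[OF mollify_avg_L1(2)[OF eta lu[OF r], of m]] by (simp add: abs_mult weight_nonneg)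
      have "avg (\<lambda>y. \<bar>?P r y\<bar>) \<le> (\<integral>y. \<bar>mollify \<eta> m (u r) y - u r y\<bar> * weight y + \<bar>mollify \<eta> k (u r) y - u r y\<bar> * weight y \<partial>lborel)"
        unfolding avg_def
      proof (rule integral_mono)
        show "integrable lborel (\<lambda>y. \<bar>?P r y\<bar> * weight y)" by (intro avg_integrable continuous_on_rabs c r)
        show "\<bar>?P r y\<bar> * weight y \<le> \<bar>mollify \<eta> m (u r) y - u r y\<bar> * weight y + \<bar>mollify \<eta> k (u r) y - u r y\<bar> * weight y" for y
          unfolding distrib_right[symmetric] by (intro mult_right_mono weight_nonneg) auto
      qed (intro Bochner_Integration.integrable_add i)
      also have "\<dots> = avg (\<lambda>y. \<bar>mollify \<eta> m (u r) y - u r y\<bar>) + avg (\<lambda>y. \<bar>mollify \<eta> k (u r) y - u r y\<bar>)"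
        unfolding avg_def by (rule Bochner_Integration.integral_add[OF i i])
      finally show "avg (\<lambda>y. \<bar>?P r y\<bar>) \<le> \<dots>" .
    qed
    also have "\<dots> = ?d m + ?d k" by (simp add: sum.distrib)
    finally have "\<bar>?P 0 x\<bar> \<le> ?c * ?d m + ?c * ?d k" using sob_const_ge[of 1] by (simp add: distrib_left)
    also have "\<dots> < e" using N[OF mk(1)] N[OF mk(2)] by simp
    finally show ?thesis by (simp add: dist_real_def)
  qed
  then show "\<exists>M. \<forall>x\<in>cbox a b. \<forall>m\<ge>M. \<forall>n\<ge>M. dist (mollify \<eta> m (u 0) x) (mollify \<eta> n (u 0) x) < e" by blast
qed

end

text \<open>
  The mollifications converge uniformly on every cube to a continuous function, and almost everywhere
  along a subsequence to \<open>u 0\<close>.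
\<close>

lemma continuous_representative:
  fixes u :: "nat ^ 'n \<Rightarrow> real ^ 'n \<Rightarrow> real" and \<eta> :: "real ^ 'n \<Rightarrow> real"
  assumes eta: "mollifier \<eta>" and u: "weak_family 1 u"
  shows "\<exists>h. continuous_on UNIV h \<and> (AE x in lborel. h x = u 0 x)"
proof -
  have lu: "loc_int (u 0)" using u by (auto simp: weak_family_def index_box_def)
  define A where "A n = (\<chi> i::'n. - real (Suc n))" for n
  define B where "B n = (\<chi> i::'n. real (Suc n))" for n
  have cube: "side_cube (A n) (B n) (2 * real (Suc n))" for n
    by standard (auto simp: A_def B_def)
  have mem: "\<exists>n. x \<in> box (A n) (B n)" for x
  proof -
    obtain n where n: "norm x < real n" using reals_Archimedean2 by blast
    have "x $ i < real (Suc n)" "- real (Suc n) < x $ i" for i using component_le_norm_cart[of x i] n by auto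
    then have "x \<in> box (A n) (B n)" by (simp add: mem_box_cart A_def B_def del: of_nat_Suc)
    then show ?thesis by blast
  qed
  have "uniformly_convergent_on (cbox (A n) (B n)) (\<lambda>m. mollify \<eta> m (u 0))" for n
    by (intro Cauchy_uniformly_convergent side_cube.mollify_uniformly_Cauchy[OF cube eta u])
  then have unif: "uniform_limit (cbox (A n) (B n)) (\<lambda>m. mollify \<eta> m (u 0)) (\<lambda>x. lim (\<lambda>m. mollify \<eta> m (u 0) x)) sequentially" for n
    by (simp add: uniformly_convergent_uniform_limit_iff)
  define h where "h x = lim (\<lambda>m. mollify \<eta> m (u 0) x)" for x
  have cn: "continuous_on (cbox (A n) (B n)) h" for n
    unfolding h_def
    by (rule uniform_limit_theorem[OF _ unif])
      (auto intro!: always_eventually continuous_on_subset[OF mollify_continuous[OF eta lu]])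
  have "isCont h x" for x
  proof -
    obtain n where n: "x \<in> box (A n) (B n)" using mem by blast
    have "continuous_on (box (A n) (B n)) h" by (rule continuous_on_subset[OF cn]) (rule box_subset_cbox)
    then show ?thesis using n by (simp add: continuous_on_eq_continuous_at open_box)
  qed
  then have c: "continuous_on UNIV h" by (simp add: continuous_at_imp_continuous_on)
  have ptw: "(\<lambda>m. mollify \<eta> m (u 0) x) \<longlonglongrightarrow> h x" for x
    using mem[of x] tendsto_uniform_limitI[OF unif] box_subset_cbox unfolding h_def by blast
  have "AE x in lborel. x \<in> cbox (A n) (B n) \<longrightarrow> h x = u 0 x" for n
  proof -
    obtain k where k: "strict_mono k" "AE x in lborel. x \<in> cbox (A n) (B n) \<longrightarrow> (\<lambda>m. mollify \<eta> (k m) (u 0) x) \<longlonglongrightarrow> u 0 x"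
      using side_cube.mollify_AE_subseq[OF cube eta lu] by blast
    show ?thesis using k(2)
    proof eventually_elim
      fix x assume *: "x \<in> cbox (A n) (B n) \<longrightarrow> (\<lambda>m. mollify \<eta> (k m) (u 0) x) \<longlonglongrightarrow> u 0 x"
      have "(\<lambda>m. mollify \<eta> (k m) (u 0) x) \<longlonglongrightarrow> h x"
        using LIMSEQ_subseq_LIMSEQ[OF ptw k(1)] by (simp add: o_def)
      then show "x \<in> cbox (A n) (B n) \<longrightarrow> h x = u 0 x" using * LIMSEQ_unique by blast
    qed
  qed
  then have "AE x in lborel. \<forall>n. x \<in> cbox (A n) (B n) \<longrightarrow> h x = u 0 x" by (subst AE_all_countable) blast
  then have "AE x in lborel. h x = u 0 x"
    by eventually_elim (use mem box_subset_cbox in blast)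
  with c show ?thesis by blast
qed

section \<open>Weak derivatives with respect to Lebesgue measure\<close>

lemma loc_int_locally_integrable: "loc_int f \<Longrightarrow> locally_integrable U f"
  unfolding loc_int_def locally_integrable_def set_integrable_def
  by (auto simp: integrable_completion borel_compact)

text \<open>
  Measurability on the whole space follows by exhaustion with balls, as local integrability
  only speaks of compact sets.
\<close>

lemma locally_integrable_borel_rep:
  fixes f :: "real^'n \<Rightarrow> real"
  assumes f: "locally_integrable UNIV f"
  shows "f \<in> borel_measurable lebesgue" and "\<exists>f'. loc_int f' \<and> (AE x in lborel. f x = f' x)"
proof -
  have i: "integrable lebesgue (\<lambda>x. indicator K x *\<^sub>R f x)" if "compact K" for K
    using f that by (simp add: locally_integrable_def set_integrable_def)
  show m: "f \<in> borel_measurable lebesgue"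
  proof (rule borel_measurable_LIMSEQ_real)
    show "(\<lambda>x. indicator (cball 0 (real n)) x *\<^sub>R f x) \<in> borel_measurable lebesgue" for n
      using i[OF compact_cball, of 0 "real n"] by (rule borel_measurable_integrable)
    show "(\<lambda>n. indicator (cball 0 (real n)) x *\<^sub>R f x) \<longlonglongrightarrow> f x" for x
    proof -
      obtain N where N: "norm x \<le> real N" using real_arch_simple by blast
      have "eventually (\<lambda>n. indicator (cball 0 (real n)) x *\<^sub>R f x = f x) sequentially"
        using eventually_ge_at_top[of N]
      proof eventually_elim
        case (elim n)
        then show ?case using N by (simp add: indicator_def)
      qed
      then show ?thesis by (rule tendsto_eventually)
    qed
  qed
  obtain f' where f': "f' \<in> borel_measurable lborel" "AE x in lborel. f x = f' x"
    using completion_ex_borel_measurable_real[OF m] by blast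
  have "set_integrable lborel K f'" if K: "compact K" for K
  proof -
    have m1: "(\<lambda>x. indicator K x *\<^sub>R f' x) \<in> borel_measurable lborel" using f' K borel_compact[OF K] by auto
    have "integrable lebesgue (\<lambda>x. indicator K x *\<^sub>R f' x)"
    proof (subst integrable_cong_AE[where g="\<lambda>x. indicator K x *\<^sub>R f x"])
      show "(\<lambda>x. indicator K x *\<^sub>R f' x) \<in> borel_measurable lebesgue" using m1 by (rule measurable_completion)
      show "(\<lambda>x. indicator K x *\<^sub>R f x) \<in> borel_measurable lebesgue" using i[OF K] by (rule borel_measurable_integrable)
      show "AE x in lebesgue. indicator K x *\<^sub>R f' x = indicator K x *\<^sub>R f x"
        using AE_completion[OF f'(2)] by eventually_elim simp
    qed (rule i[OF K])
    then show ?thesis using m1 by (simp add: set_integrable_def integrable_completion)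
  qed
  then have "loc_int f'" using f'(1) by (simp add: loc_int_def)
  with f'(2) show "\<exists>f'. loc_int f' \<and> (AE x in lborel. f x = f' x)" by blast
qed

lemma integral_lebesgue_AE:
  fixes f g :: "'a::euclidean_space \<Rightarrow> real"
  assumes g: "g \<in> borel_measurable borel" and eq: "AE x in lborel. f x = g x"
  shows "(\<integral>x. f x \<partial>lebesgue) = (\<integral>x. g x \<partial>lborel)" "integrable lebesgue f \<longleftrightarrow> integrable lborel g"
proof -
  have g': "g \<in> borel_measurable lebesgue" using g by (simp add: measurable_completion)
  have eq': "AE x in lebesgue. g x = f x" using AE_completion[OF eq] by eventually_elim simp
  have f': "f \<in> borel_measurable lebesgue" by (rule borel_measurable_AE[OF g' eq'])
  have "(\<integral>x. f x \<partial>lebesgue) = (\<integral>x. g x \<partial>lebesgue)"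
    by (rule integral_cong_AE[OF f' g']) (use eq' in eventually_elim, simp)
  then show "(\<integral>x. f x \<partial>lebesgue) = (\<integral>x. g x \<partial>lborel)" using g by (simp add: integral_completion)
  have "integrable lebesgue f \<longleftrightarrow> integrable lebesgue g"
    by (rule integrable_cong_AE[OF f' g']) (use eq' in eventually_elim, simp)
  then show "integrable lebesgue f \<longleftrightarrow> integrable lborel g" using g by (simp add: integrable_completion)
qed

lemma wderiv_imp_has_weak_deriv:
  assumes fu: "wderiv is f u"
  shows "has_weak_deriv \<Omega> (mult_index is) f u"
  unfolding has_weak_deriv_def
proof (intro conjI ballI)
  have lf: "loc_int f" and lu: "loc_int u" using fu by (auto simp: wderiv_def)
  note [measurable] = loc_int_measurable[OF lf] loc_int_measurable[OF lu]
  show "locally_integrable (interior \<Omega>) f" "locally_integrable (interior \<Omega>) u"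
    by (intro loc_int_locally_integrable lf lu)+
  fix \<psi> assume \<psi>: "\<psi> \<in> test_functions (interior \<Omega>)"
  have \<psi>': "\<psi> \<in> test_functions UNIV" using test_functions_mono[OF subset_UNIV \<psi>] .
  note [measurable] = test_function_borel[OF \<psi>] test_function_borel[OF test_functions_iter_partial[OF \<psi>]]
  have "(LINT x:interior \<Omega>|lebesgue. f x * multi_deriv (mult_index is) \<psi> x) = (\<integral>x. f x * iter_partial is \<psi> x \<partial>lborel)"
  proof -
    have "indicator (interior \<Omega>) x *\<^sub>R (f x * multi_deriv (mult_index is) \<psi> x) = f x * iter_partial is \<psi> x" for x
      using test_functionsD(5)[OF \<psi>, of x "is"] by (cases "x \<in> interior \<Omega>") (auto simp: multi_deriv_eq[OF test_functionsD(1)[OF \<psi>]])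
    then show ?thesis unfolding set_lebesgue_integral_def by (simp only:) (rule integral_completion, measurable)
  qed
  moreover have "(LINT x:interior \<Omega>|lebesgue. u x * \<psi> x) = (\<integral>x. u x * \<psi> x \<partial>lborel)"
  proof -
    have "indicator (interior \<Omega>) x *\<^sub>R (u x * \<psi> x) = u x * \<psi> x" for x
      using test_functionsD(4)[OF \<psi>, of x] by (cases "x \<in> interior \<Omega>") auto
    then show ?thesis unfolding set_lebesgue_integral_def by (simp only:) (rule integral_completion, measurable)
  qed
  ultimately show "(LINT x:interior \<Omega>|lebesgue. f x * multi_deriv (mult_index is) \<psi> x) =
    (- 1) ^ (\<Sum>i\<in>UNIV. mult_index is $ i) * (LINT x:interior \<Omega>|lebesgue. u x * \<psi> x)"
    using fu \<psi>' by (simp add: wderiv_def mult_index_length)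
qed

lemma has_weak_deriv_imp_wderiv:
  assumes fu: "has_weak_deriv UNIV (mult_index is) f u"
    and f': "loc_int f'" "AE x in lborel. f x = f' x" and u': "loc_int u'" "AE x in lborel. u x = u' x"
  shows "wderiv is f' u'"
  unfolding wderiv_def
proof (intro conjI ballI f' u')
  note [measurable] = loc_int_measurable[OF f'(1)] loc_int_measurable[OF u'(1)]
  fix \<psi> :: "real^'a \<Rightarrow> real" assume \<psi>: "\<psi> \<in> test_functions UNIV"
  note [measurable] = test_function_borel[OF \<psi>] test_function_borel[OF test_functions_iter_partial[OF \<psi>]]
  have "(LINT x:interior UNIV|lebesgue. f x * multi_deriv (mult_index is) \<psi> x) = (\<integral>x. f' x * iter_partial is \<psi> x \<partial>lborel)"
    unfolding set_lebesgue_integral_def multi_deriv_eq[OF test_functionsD(1)[OF \<psi>]]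
  proof (rule integral_lebesgue_AE)
    show "AE x in lborel. indicator (interior UNIV) x *\<^sub>R (f x * iter_partial is \<psi> x) = f' x * iter_partial is \<psi> x"
      using f'(2) by eventually_elim simp
  qed measurable
  moreover have "(LINT x:interior UNIV|lebesgue. u x * \<psi> x) = (\<integral>x. u' x * \<psi> x \<partial>lborel)"
    unfolding set_lebesgue_integral_def
  proof (rule integral_lebesgue_AE)
    show "AE x in lborel. indicator (interior UNIV) x *\<^sub>R (u x * \<psi> x) = u' x * \<psi> x"
      using u'(2) by eventually_elim simp
  qed measurable
  moreover have "(LINT x:interior UNIV|lebesgue. f x * multi_deriv (mult_index is) \<psi> x) =
    (- 1) ^ (\<Sum>i\<in>UNIV. mult_index is $ i) * (LINT x:interior UNIV|lebesgue. u x * \<psi> x)"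
    using fu \<psi> unfolding has_weak_deriv_def by simp
  ultimately show "(\<integral>x. f' x * iter_partial is \<psi> x \<partial>lborel) = (- 1) ^ length is * (\<integral>x. u' x * \<psi> x \<partial>lborel)"
    by (simp add: mult_index_length)
qed

text \<open>
  On a cube inside \<open>U\<close> the mollifier kernels are test functions on \<open>U\<close> once they are narrow enough, so the
  mollifications of \<open>v\<close> vanish there, while they converge to \<open>v\<close>. Countably many cubes cover \<open>U\<close>.
\<close>

lemma fundamental_lemma:
  fixes v :: "real^'n \<Rightarrow> real"
  assumes eta: "mollifier (\<eta> :: real^'n \<Rightarrow> real)" and U: "open U" and v: "locally_integrable U v"
    and zero: "\<And>\<psi>. \<psi> \<in> test_functions U \<Longrightarrow> (LINT x:U|lebesgue. v x * \<psi> x) = 0"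
  shows "AE x in lborel. x \<in> U \<longrightarrow> v x = 0"
proof -
  obtain R where R: "R > 0" "\<And>x. x \<notin> cball 0 R \<Longrightarrow> \<eta> x = 0" using mollifier_supp[OF eta] by blast
  have cube: "AE x in lborel. x \<in> cbox a b \<longrightarrow> v x = 0" if ab: "cbox a b \<subseteq> U" for a b
  proof -
    obtain d where d: "d > 0" "(\<Union>x\<in>cbox a b. cball x d) \<subseteq> U"
      using compact_subset_open_imp_cball_epsilon_subset[OF compact_cbox U ab] by blast
    \<comment> \<open>a compact neighbourhood of the cube inside \<open>U\<close>, to which \<open>v\<close> may be restricted\<close>
    define K where "K = (\<Union>x\<in>cbox a b. cball x d)"
    have "K = {x + y |x y. x \<in> cbox a b \<and> y \<in> cball 0 d}"
    proof -
      have "cball x d = (\<lambda>y. x + y) ` cball 0 d" for x :: "real^'n" by simp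
      then show ?thesis unfolding K_def by blast
    qed
    then have K: "compact K" using compact_sums[OF compact_cbox compact_cball, of a b 0 d] by simp
    have "locally_integrable UNIV (\<lambda>x. indicator K x * v x)"
    proof -
      have i: "integrable lebesgue (\<lambda>x. indicator K x *\<^sub>R v x)"
        using v K d unfolding locally_integrable_def set_integrable_def K_def by blast
      have "integrable lebesgue (\<lambda>x. indicator J x *\<^sub>R (indicator K x *\<^sub>R v x))" if "compact J" for J
        by (rule integrable_mult_indicator[OF _ i]) (use borel_compact[OF that] in simp)
      then show ?thesis unfolding locally_integrable_def set_integrable_def by simp
    qed
    from locally_integrable_borel_rep(2)[OF this]
    obtain w where w: "loc_int w" "AE x in lborel. indicator K x * v x = w x" by blast
    note [measurable] = loc_int_measurable[OF w(1)]
    obtain N where N: "R / d < real N" using reals_Archimedean2 by blast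
    have zero': "mollify \<eta> m w x = 0" if m: "m \<ge> N" and x: "x \<in> cbox a b" for m x
    proof -
      have "R / real (Suc m) \<le> d" using N m d R by (simp add: field_simps) (smt (verit) mult_left_mono of_nat_mono)
      then have kz: "mollifier_kernel \<eta> m x y = 0" if "y \<notin> cball x d" for y
        using mollifier_kernel_small_supp[OF eta, of R m x y] R(2) that by force
      have sub: "cball x d \<subseteq> K" "K \<subseteq> U" using x d by (auto simp: K_def)
      have "supp (mollifier_kernel \<eta> m x) \<subseteq> cball x d"
        unfolding supp_def by (rule closure_minimal[OF _ closed_cball]) (use kz in blast)
      then have t: "mollifier_kernel \<eta> m x \<in> test_functions U"
        using mollifier_kernel_test[OF eta, of m x] sub unfolding test_functions_def by auto
      have "(LINT y:U|lebesgue. v y * mollifier_kernel \<eta> m x y) = (\<integral>y. w y * mollifier_kernel \<eta> m x y \<partial>lborel)"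
        unfolding set_lebesgue_integral_def
      proof (rule integral_lebesgue_AE)
        show "(\<lambda>y. w y * mollifier_kernel \<eta> m x y) \<in> borel_measurable borel" using test_function_borel[OF t] by measurable
        show "AE y in lborel. indicator U y *\<^sub>R (v y * mollifier_kernel \<eta> m x y) = w y * mollifier_kernel \<eta> m x y"
          using w(2)
        proof eventually_elim
          case (elim y)
          then show ?case using kz[of y] sub by (cases "y \<in> cball x d") (auto simp: indicator_def)
        qed
      qed
      then show ?thesis using zero[OF t] by (simp add: mollify_kernel[OF eta loc_int_measurable[OF w(1)]])
    qed
    have "(\<lambda>m. \<integral>\<^sup>+x. indicator (cbox a b) x * ennreal \<bar>mollify \<eta> m w x - w x\<bar> \<partial>lborel) \<longlonglongrightarrow> 0"
      by (rule mollify_local_L1[OF eta w(1) compact_cbox])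
    moreover have "eventually (\<lambda>m. (\<integral>\<^sup>+x. indicator (cbox a b) x * ennreal \<bar>mollify \<eta> m w x - w x\<bar> \<partial>lborel)
        = (\<integral>\<^sup>+x. indicator (cbox a b) x * ennreal \<bar>w x\<bar> \<partial>lborel)) sequentially"
      using eventually_ge_at_top[of N]
    proof eventually_elim
      case (elim m)
      then show ?case by (intro nn_integral_cong) (auto simp: indicator_def zero')
    qed
    ultimately have "(\<lambda>m::nat. \<integral>\<^sup>+x. indicator (cbox a b) x * ennreal \<bar>w x\<bar> \<partial>lborel) \<longlonglongrightarrow> 0"
      by (rule Lim_transform_eventually)
    then have "(\<integral>\<^sup>+x. indicator (cbox a b) x * ennreal \<bar>w x\<bar> \<partial>lborel) = 0"
      using LIMSEQ_unique tendsto_const by blast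
    then have "AE x in lborel. indicator (cbox a b) x * ennreal \<bar>w x\<bar> = 0"
      by (subst (asm) nn_integral_0_iff_AE) auto
    with w(2) show ?thesis
    proof eventually_elim
      case (elim x)
      have "cbox a b \<subseteq> K" using d by (force simp: K_def)
      then show ?case using elim by (auto simp: indicator_def split: if_splits)
    qed
  qed
  obtain D where D: "countable D" "D \<subseteq> Pow U" "\<And>X. X \<in> D \<Longrightarrow> \<exists>a b. X = cbox a b" "\<Union>D = U"
    using open_countable_Union_open_cbox[OF U] by metis
  have "AE x in lborel. \<forall>X\<in>D. x \<in> X \<longrightarrow> v x = 0"
    unfolding AE_ball_countable[OF D(1)] proof
    fix X assume X: "X \<in> D"
    then obtain a b where "X = cbox a b" using D(3) by blast
    moreover have "X \<subseteq> U" using X D(2) by blast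
    ultimately show "AE x in lborel. x \<in> X \<longrightarrow> v x = 0" using cube by blast
  qed
  then show ?thesis by eventually_elim (use D(4) in blast)
qed

lemma weak_deriv_unique:
  fixes f :: "real^'n \<Rightarrow> real"
  assumes eta: "mollifier (\<eta> :: real^'n \<Rightarrow> real)" and u: "has_weak_deriv \<Omega> r f u" and w: "has_weak_deriv \<Omega> r f w"
  shows "AE x in lborel. x \<in> interior \<Omega> \<longrightarrow> u x = w x"
proof -
  let ?U = "interior \<Omega>"
  have lu: "locally_integrable ?U u" and lw: "locally_integrable ?U w"
    using u w by (auto simp: has_weak_deriv_def)
  have l: "locally_integrable ?U (\<lambda>x. u x - w x)"
    using lu lw unfolding locally_integrable_def by (auto intro: set_integral_diff)
  have int: "set_integrable lebesgue ?U (\<lambda>x. v x * \<psi> x)"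
    if v: "locally_integrable ?U v" and \<psi>: "\<psi> \<in> test_functions ?U" for v \<psi> :: "real^'n \<Rightarrow> real"
  proof -
    obtain B where B: "B > 0" "\<And>x. \<bar>\<psi> x\<bar> \<le> B" using test_function_bounded[OF \<psi>] by blast
    have i: "integrable lebesgue (\<lambda>x. indicator (supp \<psi>) x *\<^sub>R v x)"
      using v test_functionsD(2,3)[OF \<psi>] by (simp add: locally_integrable_def set_integrable_def)
    have "\<psi> \<in> borel_measurable lebesgue" using test_function_borel[OF \<psi>] by (simp add: measurable_completion)
    then have "integrable lebesgue (\<lambda>x. \<psi> x *\<^sub>R (indicator (supp \<psi>) x *\<^sub>R v x))"
      using i B(2) mult_right_mono[OF order_trans[OF B(2) abs_ge_self]]
      by (intro Bochner_Integration.integrable_bound[OF integrable_mult_right[OF i, of B]])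
        (auto simp: abs_mult intro!: mult_right_mono)
    moreover have "\<psi> x *\<^sub>R (indicator (supp \<psi>) x *\<^sub>R v x) = indicator ?U x *\<^sub>R (v x * \<psi> x)" for x
      using test_functionsD(3,4)[OF \<psi>] supp_zero[of x \<psi>] by (auto simp: indicator_def)
    ultimately show ?thesis unfolding set_integrable_def by (simp only:)
  qed
  have "AE x in lborel. x \<in> ?U \<longrightarrow> u x - w x = 0"
  proof (rule fundamental_lemma[OF eta open_interior l])
    fix \<psi> assume \<psi>: "\<psi> \<in> test_functions ?U"
    have "(- 1) ^ (\<Sum>i\<in>UNIV. r $ i) * (LINT x:?U|lebesgue. u x * \<psi> x) = (- 1) ^ (\<Sum>i\<in>UNIV. r $ i) * (LINT x:?U|lebesgue. w x * \<psi> x)"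
    proof -
      have "(LINT x:?U|lebesgue. f x * multi_deriv r \<psi> x) = (- 1) ^ (\<Sum>i\<in>UNIV. r $ i) * (LINT x:?U|lebesgue. v x * \<psi> x)"
        if "has_weak_deriv \<Omega> r f v" for v
        using that \<psi> unfolding has_weak_deriv_def by blast
      from this[OF u] this[OF w] show ?thesis by linarith
    qed
    then have "(LINT x:?U|lebesgue. u x * \<psi> x) = (LINT x:?U|lebesgue. w x * \<psi> x)" by simp
    then show "(LINT x:?U|lebesgue. (u x - w x) * \<psi> x) = 0"
      using set_integral_diff(2)[OF int[OF lu \<psi>] int[OF lw \<psi>]] by (simp add: left_diff_distrib)
  qed
  then show ?thesis by eventually_elim simp
qed

lemma weak_deriv_works: "has_weak_deriv \<Omega> r f u \<Longrightarrow> has_weak_deriv \<Omega> r f (weak_deriv \<Omega> r f)"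
  unfolding weak_deriv_def by (rule someI[where P="has_weak_deriv \<Omega> r f"])

section \<open>Sobolev norms with Gaussian weight\<close>

lemma lp_norm_powr: "p > 0 \<Longrightarrow> lp_norm p M f powr p = (LINT x|M. \<bar>f x\<bar> powr p)"
  unfolding lp_norm_def by (simp add: powr_powr Bochner_Integration.integral_nonneg)

lemma sobolev_norm_powr:
  assumes "p > 0"
  shows "sobolev_norm \<alpha> p \<Omega> \<mu> f powr p = (\<Sum>r\<in>index_box \<alpha>. LINT x|restrict_space \<mu> \<Omega>. \<bar>weak_deriv \<Omega> r f x\<bar> powr p)"
  unfolding sobolev_norm_def using assms
  by (simp add: powr_powr sum_nonneg lp_norm_powr index_box_def[symmetric])

lemma sobolev_norm_nonneg: "0 \<le> sobolev_norm \<alpha> p \<Omega> \<mu> f"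
  unfolding sobolev_norm_def by simp

lemma gauss_density_pos: "gauss_density x > 0"
  by (simp add: gauss_density_def)

lemma gauss_density_continuous: "continuous_on S gauss_density"
  unfolding gauss_density_def by (intro continuous_intros) auto

lemma gauss_density_borel[measurable]: "gauss_density \<in> borel_measurable borel"
  by (rule borel_measurable_continuous_onI[OF gauss_density_continuous])

lemma gauss_integral:
  assumes f: "f \<in> borel_measurable lebesgue" and g: "g \<in> borel_measurable borel" and eq: "AE x in lborel. f x = g x"
  shows "(LINT x|restrict_space gauss_measure UNIV. f x) = (\<integral>x. g x * gauss_density x \<partial>lborel)"
    and "(LINT x|gauss_measure. f x) = (\<integral>x. g x * gauss_density x \<partial>lborel)"
    and "integrable (restrict_space gauss_measure UNIV) f \<longleftrightarrow> integrable lborel (\<lambda>x. g x * gauss_density x)"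
proof -
  have gm: "gauss_density \<in> borel_measurable lebesgue" by (simp add: measurable_completion)
  have sp: "UNIV \<inter> space gauss_measure \<in> sets gauss_measure" by simp
  have r1: "(LINT x|restrict_space gauss_measure UNIV. f x) = (LINT x|gauss_measure. f x)"
    by (subst integral_restrict_space[OF sp]) simp
  have r2: "integrable (restrict_space gauss_measure UNIV) f \<longleftrightarrow> integrable gauss_measure f"
    by (subst integrable_restrict_space[OF sp]) simp
  have eq': "AE x in lborel. gauss_density x * f x = g x * gauss_density x"
    using eq by eventually_elim simp
  have m: "(\<lambda>x. g x * gauss_density x) \<in> borel_measurable borel" using g by measurable
  have d1: "(LINT x|gauss_measure. f x) = (LINT x|lebesgue. gauss_density x * f x)"
    unfolding gauss_measure_def using gauss_density_pos
    by (intro integral_real_density f gm) (auto intro: less_imp_le)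
  have d2: "integrable gauss_measure f \<longleftrightarrow> integrable lebesgue (\<lambda>x. gauss_density x * f x)"
    unfolding gauss_measure_def using gauss_density_pos
    by (intro integrable_real_density f gm) (auto intro: less_imp_le)
  show "(LINT x|gauss_measure. f x) = (\<integral>x. g x * gauss_density x \<partial>lborel)"
    unfolding d1 by (rule integral_lebesgue_AE(1)[OF m eq'])
  then show "(LINT x|restrict_space gauss_measure UNIV. f x) = (\<integral>x. g x * gauss_density x \<partial>lborel)"
    by (simp only: r1)
  show "integrable (restrict_space gauss_measure UNIV) f \<longleftrightarrow> integrable lborel (\<lambda>x. g x * gauss_density x)"
    unfolding r2 d2 by (rule integral_lebesgue_AE(2)[OF m eq'])
qed

text \<open>
  Passage from the function space to a family \<open>u\<close> of Borel functions that represent all derivatives,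
  with the norm expressed by integrals against Lebesgue measure. \<open>u 0\<close> represents \<open>f\<close> itself
  because weak derivatives of order zero are unique as well.
\<close>

lemma gauss_sobolev_data:
  fixes f :: "real^'n \<Rightarrow> real"
  assumes eta: "mollifier (\<eta> :: real^'n \<Rightarrow> real)" and p: "p > 0" and f: "f \<in> sobolev_space \<alpha> p UNIV gauss_measure"
  obtains u where "\<And>r. r \<in> index_box \<alpha> \<Longrightarrow> loc_int (u r)" "AE x in lborel. f x = u 0 x"
    "\<And>is. mult_index is \<in> index_box \<alpha> \<Longrightarrow> wderiv is (u 0) (u (mult_index is))"
    "\<And>r. r \<in> index_box \<alpha> \<Longrightarrow> integrable lborel (\<lambda>x. \<bar>u r x\<bar> powr p * gauss_density x)"
    "sobolev_norm \<alpha> p UNIV gauss_measure f powr p = (\<Sum>r\<in>index_box \<alpha>. \<integral>x. \<bar>u r x\<bar> powr p * gauss_density x \<partial>lborel)"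
    "f \<in> borel_measurable lebesgue"
proof -
  define w where "w r = weak_deriv UNIV r f" for r
  have ex: "\<exists>v. has_weak_deriv UNIV r f v \<and> v \<in> lp_space p (restrict_space gauss_measure UNIV)" if "r \<in> index_box \<alpha>" for r
    using f that by (auto simp: sobolev_space_def index_box_def)
  have w: "has_weak_deriv UNIV r f (w r)" if "r \<in> index_box \<alpha>" for r
    using ex[OF that] weak_deriv_works unfolding w_def by blast
  have lw: "locally_integrable UNIV (w r)" if "r \<in> index_box \<alpha>" for r
    using w[OF that] by (simp add: has_weak_deriv_def)
  have "\<forall>r\<in>index_box \<alpha>. \<exists>u. loc_int u \<and> (AE x in lborel. w r x = u x)"
    using locally_integrable_borel_rep(2)[OF lw] by blast
  then obtain u where u: "\<And>r. r \<in> index_box \<alpha> \<Longrightarrow> loc_int (u r)" "\<And>r. r \<in> index_box \<alpha> \<Longrightarrow> AE x in lborel. w r x = u r x"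
    by metis
  have 0: "(0 :: nat^'n) \<in> index_box \<alpha>" by (simp add: index_box_def)
  have lf: "locally_integrable UNIV f" using w[OF 0] by (simp add: has_weak_deriv_def)
  have "has_weak_deriv UNIV 0 f f"
    unfolding has_weak_deriv_def
  proof (intro conjI ballI)
    fix \<psi> :: "real^'n \<Rightarrow> real" assume "\<psi> \<in> test_functions (interior UNIV)"
    then have "multi_deriv 0 \<psi> = \<psi>" using multi_deriv_eq[of \<psi> "[]"] test_functionsD(1)[of \<psi>] by (simp add: mult_index_Nil)
    then show "(LINT x:interior UNIV|lebesgue. f x * multi_deriv 0 \<psi> x) =
       (- 1) ^ (\<Sum>i\<in>UNIV. (0 :: nat^'n) $ i) * (LINT x:interior UNIV|lebesgue. f x * \<psi> x)" by simp
  qed (use lf in auto)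
  then have "AE x in lborel. x \<in> interior UNIV \<longrightarrow> f x = w 0 x"
    by (rule weak_deriv_unique[OF eta]) (rule w[OF 0])
  then have fu: "AE x in lborel. f x = u 0 x" using u(2)[OF 0] by eventually_elim simp
  have eqp: "AE x in lborel. \<bar>w r x\<bar> powr p = \<bar>u r x\<bar> powr p" if "r \<in> index_box \<alpha>" for r
    using u(2)[OF that] by eventually_elim simp
  have mp: "(\<lambda>x. \<bar>u r x\<bar> powr p) \<in> borel_measurable borel" if "r \<in> index_box \<alpha>" for r
    using loc_int_measurable[OF u(1)[OF that]] by measurable
  show thesis
  proof (rule that[of u])
    show "wderiv is (u 0) (u (mult_index is))" if "mult_index is \<in> index_box \<alpha>" for "is"
      by (rule has_weak_deriv_imp_wderiv[OF w[OF that] u(1)[OF 0] fu u(1)[OF that] u(2)[OF that]])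
    show "integrable lborel (\<lambda>x. \<bar>u r x\<bar> powr p * gauss_density x)" if r: "r \<in> index_box \<alpha>" for r
    proof -
      obtain v where v: "has_weak_deriv UNIV r f v" "v \<in> lp_space p (restrict_space gauss_measure UNIV)"
        using ex[OF r] by blast
      have "AE x in lborel. x \<in> interior UNIV \<longrightarrow> v x = w r x"
        by (rule weak_deriv_unique[OF eta v(1) w[OF r]])
      then have vu: "AE x in lborel. \<bar>v x\<bar> powr p = \<bar>u r x\<bar> powr p" using u(2)[OF r] by eventually_elim simp
      have "locally_integrable UNIV v" using v(1) by (simp add: has_weak_deriv_def)
      then have "v \<in> borel_measurable lebesgue" by (rule locally_integrable_borel_rep(1))
      then have "(\<lambda>x. \<bar>v x\<bar> powr p) \<in> borel_measurable lebesgue" by measurable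
      from gauss_integral(3)[OF this mp[OF r] vu] v(2) show ?thesis by (simp add: lp_space_def)
    qed
    have wm: "(\<lambda>x. \<bar>w r x\<bar> powr p) \<in> borel_measurable lebesgue" if "r \<in> index_box \<alpha>" for r
      using locally_integrable_borel_rep(1)[OF lw[OF that]] by measurable
    show "sobolev_norm \<alpha> p UNIV gauss_measure f powr p = (\<Sum>r\<in>index_box \<alpha>. \<integral>x. \<bar>u r x\<bar> powr p * gauss_density x \<partial>lborel)"
      unfolding sobolev_norm_powr[OF p] w_def[symmetric]
      by (intro sum.cong refl gauss_integral(1)[OF wm mp eqp])
    show "f \<in> borel_measurable lebesgue" by (rule locally_integrable_borel_rep(1)[OF lf])
  qed (use u fu in auto)
qed

text \<open>
  The norm on the closed cube uses weak derivatives on its interior. They agree almost everywhere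
  with the global ones, and the boundary is a null set.
\<close>

lemma cube_sobolev_norm:
  fixes f :: "real^'n \<Rightarrow> real"
  assumes eta: "mollifier (\<eta> :: real^'n \<Rightarrow> real)" and p: "p > 0"
    and w: "\<And>r. r \<in> index_box \<alpha> \<Longrightarrow> \<exists>is. mult_index is = r \<and> wderiv is f (u r)"
  shows "sobolev_norm \<alpha> p (cbox a b) lebesgue f powr p = (\<Sum>r\<in>index_box \<alpha>. \<integral>x. indicator (cbox a b) x * \<bar>u r x\<bar> powr p \<partial>lborel)"
  unfolding sobolev_norm_powr[OF p]
proof (intro sum.cong refl)
  fix r :: "nat^'n" assume r: "r \<in> index_box \<alpha>"
  obtain "is" where is_r: "mult_index is = r" "wderiv is f (u r)" using w[OF r] by blast
  have [measurable]: "u r \<in> borel_measurable borel" using is_r(2) loc_int_measurable by (auto simp: wderiv_def)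
  have hw: "has_weak_deriv (cbox a b) r f (u r)" using wderiv_imp_has_weak_deriv[OF is_r(2)] is_r(1) by simp
  have ae: "AE x in lborel. x \<in> interior (cbox a b) \<longrightarrow> weak_deriv (cbox a b) r f x = u r x"
    by (rule weak_deriv_unique[OF eta weak_deriv_works[OF hw] hw])
  have "cbox a b - box a b \<in> null_sets lebesgue"
    using negligible_frontier_interval[of a b] by (simp add: negligible_iff_null_sets)
  then have "AE x in lebesgue. x \<notin> cbox a b - box a b" by (rule AE_not_in)
  then have bd: "AE x in lborel. x \<notin> cbox a b - box a b" by (simp add: AE_completion_iff)
  have "(LINT x|restrict_space lebesgue (cbox a b). \<bar>weak_deriv (cbox a b) r f x\<bar> powr p)
    = (LINT x|lebesgue. indicator (cbox a b) x *\<^sub>R \<bar>weak_deriv (cbox a b) r f x\<bar> powr p)"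
    by (rule integral_restrict_space) simp
  also have "\<dots> = (\<integral>x. indicator (cbox a b) x * \<bar>u r x\<bar> powr p \<partial>lborel)"
  proof (rule integral_lebesgue_AE(1))
    show "AE x in lborel. indicator (cbox a b) x *\<^sub>R \<bar>weak_deriv (cbox a b) r f x\<bar> powr p = indicator (cbox a b) x * \<bar>u r x\<bar> powr p"
      using ae bd by eventually_elim (auto simp: interior_cbox indicator_def)
  qed measurable
  finally show "(LINT x|restrict_space lebesgue (cbox a b). \<bar>weak_deriv (cbox a b) r f x\<bar> powr p) = (\<integral>x. indicator (cbox a b) x * \<bar>u r x\<bar> powr p \<partial>lborel)" .
qed

lemma polynomial_partial_deriv:
  fixes q :: "real^'n \<Rightarrow> real"
  assumes "real_polynomial_function q"
  shows "(\<forall>x. q differentiable (at x)) \<and> real_polynomial_function (partial_deriv i q)"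
  using assms
proof (induction q rule: real_polynomial_function.induct)
  case (linear h)
  have "partial_deriv i h = (\<lambda>x. h (axis i 1))"
    using partial_deriv_eq[OF bounded_linear_imp_has_derivative[OF linear]] by blast
  then show ?case using linear by (simp add: bounded_linear_imp_differentiable real_polynomial_function.intros(2))
next
  case (const c)
  then show ?case by (simp add: partial_deriv_const real_polynomial_function.intros(2))
next
  case (add f g)
  then have "partial_deriv i (\<lambda>x. f x + g x) = (\<lambda>x. partial_deriv i f x + partial_deriv i g x)"
    by (auto simp: partial_deriv_add)
  then show ?case using add by (auto intro: real_polynomial_function.intros(3))
next
  case (mult f g)
  then have "partial_deriv i (\<lambda>x. f x * g x) = (\<lambda>x. partial_deriv i f x * g x + f x * partial_deriv i g x)"
    by (auto simp: partial_deriv_mult)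
  then show ?case using mult by (auto intro!: real_polynomial_function.intros(3) real_polynomial_function.intros(4))
qed

text \<open>
  Polynomials are absorbed by an arbitrarily small loss in the Gaussian exponent. In the induction a
  product of two polynomials shares the exponent between its factors.
\<close>

lemma polynomial_growth:
  fixes q :: "'a::euclidean_space \<Rightarrow> real"
  assumes "real_polynomial_function q" "\<epsilon> > 0"
  shows "\<exists>C\<ge>0. \<forall>x. \<bar>q x\<bar> \<le> C * exp (\<epsilon> * (norm x)\<^sup>2)"
  using assms
proof (induction q arbitrary: \<epsilon> rule: real_polynomial_function.induct)
  case (linear h)
  obtain K where K: "K > 0" "\<And>x. norm (h x) \<le> norm x * K" using bounded_linear.pos_bounded[OF linear(1)] by blast
  have "\<bar>h x\<bar> \<le> (K * (1 + 1 / \<epsilon>)) * exp (\<epsilon> * (norm x)\<^sup>2)" for x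
  proof -
    have "norm x \<le> 1 + (norm x)\<^sup>2" using sum_squares_bound[of "norm x" 1] by (smt (verit) mult_1_right power_one zero_le_power2)
    also have "\<dots> \<le> (1 + 1 / \<epsilon>) * (1 + \<epsilon> * (norm x)\<^sup>2)" using linear(2) by (simp add: field_simps)
    also have "\<dots> \<le> (1 + 1 / \<epsilon>) * exp (\<epsilon> * (norm x)\<^sup>2)"
      using linear(2) by (intro mult_left_mono exp_ge_add_one_self) auto
    finally have "norm x * K \<le> ((1 + 1 / \<epsilon>) * exp (\<epsilon> * (norm x)\<^sup>2)) * K" using K by (intro mult_right_mono) auto
    then show ?thesis using K(2)[of x] by (simp add: mult_ac)
  qed
  then show ?case using K linear(2) by (intro exI[of _ "K * (1 + 1 / \<epsilon>)"]) auto
next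
  case (const c)
  have "\<bar>c\<bar> * 1 \<le> \<bar>c\<bar> * exp (\<epsilon> * (norm x)\<^sup>2)" for x :: 'a
    using const by (intro mult_left_mono) auto
  then show ?case by (intro exI[of _ "\<bar>c\<bar>"]) auto
next
  case (add f g)
  obtain C D where CD: "C \<ge> 0" "D \<ge> 0" "\<And>x. \<bar>f x\<bar> \<le> C * exp (\<epsilon> * (norm x)\<^sup>2)" "\<And>x. \<bar>g x\<bar> \<le> D * exp (\<epsilon> * (norm x)\<^sup>2)"
    using add.IH[OF add.prems] by blast
  have "\<bar>f x + g x\<bar> \<le> (C + D) * exp (\<epsilon> * (norm x)\<^sup>2)" for x
    using CD(3)[of x] CD(4)[of x] by (simp add: distrib_right)
  then show ?case using CD by (intro exI[of _ "C + D"]) auto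
next
  case (mult f g)
  have "\<epsilon> / 2 > 0" using mult.prems by simp
  then obtain C D where CD: "C \<ge> 0" "D \<ge> 0" "\<And>x. \<bar>f x\<bar> \<le> C * exp (\<epsilon> / 2 * (norm x)\<^sup>2)" "\<And>x. \<bar>g x\<bar> \<le> D * exp (\<epsilon> / 2 * (norm x)\<^sup>2)"
    using mult.IH[of "\<epsilon> / 2"] by blast
  have "\<bar>f x * g x\<bar> \<le> (C * D) * exp (\<epsilon> * (norm x)\<^sup>2)" for x
  proof -
    have "\<bar>f x\<bar> * \<bar>g x\<bar> \<le> (C * exp (\<epsilon> / 2 * (norm x)\<^sup>2)) * (D * exp (\<epsilon> / 2 * (norm x)\<^sup>2))"
      using CD by (intro mult_mono) auto
    also have "\<dots> = (C * D) * exp (\<epsilon> * (norm x)\<^sup>2)"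
      by (simp add: exp_add[symmetric] mult_ac)
    finally show ?thesis by (simp add: abs_mult)
  qed
  then show ?case using CD by (intro exI[of _ "C * D"]) auto
qed

lemma gauss_density_has_derivative:
  "(gauss_density has_derivative (\<lambda>h. - (x \<bullet> h) * gauss_density x)) (at x)"
  unfolding gauss_density_def[abs_def] power2_norm_eq_inner
  by (auto intro!: derivative_eq_intros ext simp: inner_commute)

lemma iter_partial_gauss:
  "\<exists>q. real_polynomial_function q \<and> iter_partial is (gauss_density :: real^'n \<Rightarrow> real) = (\<lambda>x. q x * gauss_density x)"
proof (induction "is")
  case Nil
  show ?case by (intro exI[of _ "\<lambda>_. 1"]) (auto intro: real_polynomial_function.intros(2))
next
  case (Cons i "is")
  then obtain q where q: "real_polynomial_function q" "iter_partial is (gauss_density :: real^'n \<Rightarrow> real) = (\<lambda>x. q x * gauss_density x)" by blast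
  let ?q = "\<lambda>x. partial_deriv i q x + q x * (- 1 * (x $ i))"
  have "real_polynomial_function ?q"
    using polynomial_partial_deriv[OF q(1), of i]
    by (intro real_polynomial_function.intros(3) real_polynomial_function.intros(4)[OF q(1)]
        real_polynomial_function.intros(4)[OF real_polynomial_function.intros(2)
          real_polynomial_function.intros(1)[OF bounded_linear_vec_nth]]) simp
  moreover have "partial_deriv i (\<lambda>x. q x * gauss_density x) x = ?q x * gauss_density x" for x
  proof -
    have "gauss_density differentiable (at x)" using gauss_density_has_derivative by (auto simp: differentiable_def)
    moreover have "partial_deriv i gauss_density x = - (x $ i) * gauss_density x"
      using partial_deriv_eq[OF gauss_density_has_derivative, of i x] by (simp add: inner_axis)
    ultimately show ?thesis
      using polynomial_partial_deriv[OF q(1), of i] by (simp add: partial_deriv_mult algebra_simps)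
  qed
  ultimately show ?case using q(2) by (intro exI[of _ ?q]) auto
qed

lemma smooth_gauss: "smooth (gauss_density :: real^'n \<Rightarrow> real)"
  unfolding smooth_def
proof (intro allI)
  fix "is" :: "'n list" and x :: "real^'n"
  obtain q where q: "real_polynomial_function q" "iter_partial is (gauss_density :: real^'n \<Rightarrow> real) = (\<lambda>x. q x * gauss_density x)"
    using iter_partial_gauss by blast
  have "(gauss_density :: real^'n \<Rightarrow> real) differentiable (at x)" using gauss_density_has_derivative by (auto simp: differentiable_def)
  then show "iter_partial is gauss_density differentiable (at x)"
    using polynomial_partial_deriv[OF q(1)] by (simp add: q(2))
qed

text \<open>
  \<open>y\<close> is the centre of a cube and \<open>\<rho>\<close> bounds its radius. The derivative is a polynomial times
  \<open>g\<^bsup>1-1/p\<^esup> g\<^bsup>1/p\<^esup>\<close>, where \<open>g\<^bsup>1-1/p\<^esup>\<close> is \<open>exp (- \<kappa> |x|\<^sup>2)\<close> up to a constant,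
  with \<open>\<kappa> = (1 - 1/p)/2\<close>. The gap between \<open>\<delta>\<close> and \<open>\<kappa>\<close> pays for the
  polynomial and for replacing \<open>x\<close> by \<open>y\<close>.
\<close>

lemma gauss_derivative_decay:
  assumes p: "1 < p" and \<delta>: "0 < \<delta>" "\<delta> < (1 - 1 / p) / 2"
  shows "\<exists>C\<ge>0. \<forall>x y. norm (x - y) \<le> \<rho> \<longrightarrow>
    \<bar>iter_partial is gauss_density x\<bar> \<le> C * exp (- \<delta> * (norm y)\<^sup>2) * gauss_density (x :: real^'n) powr (1 / p)"
proof -
  define \<kappa> where "\<kappa> = (1 - 1 / p) / 2"
  \<comment> \<open>\<open>\<kappa> - \<mu>\<close> is left to the polynomial, \<open>\<mu> - \<delta>\<close> to the change from \<open>x\<close> to \<open>y\<close>\<close>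
  define \<mu> where "\<mu> = (\<kappa> + \<delta>) / 2"
  have \<mu>: "\<delta> < \<mu>" "\<mu> < \<kappa>" using \<delta>(2) unfolding \<mu>_def \<kappa>_def[symmetric] by auto
  \<comment> \<open>so that \<open>\<delta> (1 + s) = \<mu>\<close>\<close>
  define s where "s = \<mu> / \<delta> - 1"
  have s: "s > 0" using \<mu> \<delta> by (simp add: s_def field_simps)
  obtain q where q: "real_polynomial_function q" "iter_partial is (gauss_density :: real^'n \<Rightarrow> real) = (\<lambda>x. q x * gauss_density x)"
    using iter_partial_gauss by blast
  obtain C where C: "C \<ge> 0" "\<And>x. \<bar>q x\<bar> \<le> C * exp ((\<kappa> - \<mu>) * (norm x)\<^sup>2)"
    using polynomial_growth[OF q(1), of "\<kappa> - \<mu>"] \<mu> by auto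
  define c where "c = (2 * pi) powr (- (real CARD('n) / 2))"
  have c: "c > 0" by (simp add: c_def)
  have g: "gauss_density x = c powr (1 - 1 / p) * exp (- \<kappa> * (norm x)\<^sup>2) * gauss_density x powr (1 / p)" for x :: "real^'n"
  proof -
    have "gauss_density x = gauss_density x powr (1 - 1 / p) * gauss_density x powr (1 / p)"
      using gauss_density_pos[of x] by (simp add: powr_add[symmetric])
    also have "gauss_density x powr (1 - 1 / p) = c powr (1 - 1 / p) * exp (- \<kappa> * (norm x)\<^sup>2)"
      unfolding gauss_density_def c_def[symmetric] using c
      by (subst powr_mult) (auto simp: powr_def \<kappa>_def field_simps)
    finally show ?thesis .
  qed
  define D where "D = C * c powr (1 - 1 / p) * exp (\<delta> * (1 + 1 / s) * \<rho>\<^sup>2)"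
  have "\<bar>iter_partial is gauss_density x\<bar> \<le> D * exp (- \<delta> * (norm y)\<^sup>2) * gauss_density x powr (1 / p)"
    if xy: "norm (x - y) \<le> \<rho>" for x y :: "real^'n"
  proof -
    have "norm y \<le> norm x + \<rho>" using xy norm_triangle_ineq2[of y x] by (simp add: norm_minus_commute)
    moreover have "0 \<le> \<rho>" using xy norm_ge_zero order_trans by blast
    ultimately have "(norm y)\<^sup>2 \<le> (norm x + \<rho>)\<^sup>2" by (intro power_mono) auto
    also have "\<dots> \<le> (1 + s) * (norm x)\<^sup>2 + (1 + 1 / s) * \<rho>\<^sup>2"
    proof -
      have "0 \<le> (s * norm x - \<rho>)\<^sup>2 / s" using s by simp
      also have "\<dots> = s * (norm x)\<^sup>2 + \<rho>\<^sup>2 / s - 2 * norm x * \<rho>"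
        using s by (simp add: power2_eq_square field_simps)
      finally show ?thesis using s by (simp add: power2_eq_square algebra_simps)
    qed
    finally have "\<delta> * (norm y)\<^sup>2 \<le> \<delta> * ((1 + s) * (norm x)\<^sup>2 + (1 + 1 / s) * \<rho>\<^sup>2)"
      using \<delta> by (intro mult_left_mono) auto
    also have "\<dots> = \<mu> * (norm x)\<^sup>2 + \<delta> * (1 + 1 / s) * \<rho>\<^sup>2"
      using \<delta> by (simp add: s_def algebra_simps)
    finally have le: "- \<mu> * (norm x)\<^sup>2 \<le> \<delta> * (1 + 1 / s) * \<rho>\<^sup>2 + (- \<delta> * (norm y)\<^sup>2)" by simp
    have "\<bar>iter_partial is gauss_density x\<bar> = \<bar>q x\<bar> * gauss_density x"
      using gauss_density_pos[of x] by (simp add: q(2) abs_mult)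
    also have "\<dots> \<le> (C * exp ((\<kappa> - \<mu>) * (norm x)\<^sup>2)) * gauss_density x"
      using C(2) gauss_density_pos[of x] by (intro mult_right_mono) auto
    also have "\<dots> = (C * exp ((\<kappa> - \<mu>) * (norm x)\<^sup>2)) * (c powr (1 - 1 / p) * exp (- \<kappa> * (norm x)\<^sup>2) * gauss_density x powr (1 / p))"
      by (subst g) (rule refl)
    also have "\<dots> = C * c powr (1 - 1 / p) * (exp ((\<kappa> - \<mu>) * (norm x)\<^sup>2) * exp (- \<kappa> * (norm x)\<^sup>2)) * gauss_density x powr (1 / p)"
      by (simp only: mult_ac)
    also have "exp ((\<kappa> - \<mu>) * (norm x)\<^sup>2) * exp (- \<kappa> * (norm x)\<^sup>2) = exp (- \<mu> * (norm x)\<^sup>2)"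
      by (simp add: exp_add[symmetric] algebra_simps)
    also have "C * c powr (1 - 1 / p) * exp (- \<mu> * (norm x)\<^sup>2) * gauss_density x powr (1 / p)
      \<le> C * c powr (1 - 1 / p) * exp (\<delta> * (1 + 1 / s) * \<rho>\<^sup>2 + (- \<delta> * (norm y)\<^sup>2)) * gauss_density x powr (1 / p)"
      using le C by (intro mult_right_mono mult_left_mono) auto
    also have "\<dots> = D * exp (- \<delta> * (norm y)\<^sup>2) * gauss_density x powr (1 / p)"
      by (simp only: D_def exp_add mult_ac)
    finally show ?thesis .
  qed
  moreover have "D \<ge> 0" using C by (simp add: D_def)
  ultimately show ?thesis by blast
qed

text \<open>
  At \<open>k = m e\<^sub>i\<close> the shift by \<open>\<theta>/2\<close> towards the origin contributes the factor
  \<open>exp (\<kappa> \<theta> m)\<close> with \<open>\<kappa> = (1 - 1/p)/2\<close>. It is unbounded in \<open>m\<close>, which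
  excludes even equality of the exponents.
\<close>

lemma decay_condition_exponent:
  assumes dc: "decay_condition TYPE('n::finite) p \<theta> \<tau> \<delta>" and p: "1 < p" and \<theta>: "0 < \<theta>"
  shows "\<delta> < (1 - 1 / p) / 2"
proof (rule ccontr)
  assume "\<not> \<delta> < (1 - 1 / p) / 2"
  define \<kappa> where "\<kappa> = (1 - 1 / p) / 2"
  have \<kappa>: "0 < \<kappa>" "\<kappa> \<le> \<delta>" using p \<open>\<not> _\<close> by (auto simp: \<kappa>_def)
  obtain C where C: "\<And>k :: int^'n. exp (- ((norm (lat k - (\<theta> / 2) *\<^sub>R sign_vec (lat k)))\<^sup>2 / 2) * (1 - 1 / p)) \<le> C * exp (- \<delta> * (norm (lat k))\<^sup>2)"
    using dc unfolding decay_condition_def by (meson max.boundedE)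
  obtain i :: 'n where True by blast
  have "\<kappa> * \<theta> * real m \<le> \<kappa> * (real CARD('n) * (\<theta> / 2)\<^sup>2) + \<bar>C\<bar>" for m :: nat
  proof -
    define k :: "int^'n" where "k = (\<chi> j. if j = i then int m else 0)"
    have nk: "(norm (lat k))\<^sup>2 = (real m)\<^sup>2"
      by (simp add: norm_vec_def L2_set_def k_def lat_def if_distrib[of real_of_int] if_distrib[of "\<lambda>x. x\<^sup>2"] sum_nonneg cong: if_cong)
    have "(norm (lat k - (\<theta> / 2) *\<^sub>R sign_vec (lat k)))\<^sup>2 = (\<Sum>j\<in>UNIV. ((if j = i then real m else 0) - \<theta> / 2)\<^sup>2)"
      by (simp add: norm_vec_def L2_set_def k_def lat_def sign_vec_def sum_nonneg) (intro sum.cong refl, auto)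
    also have "\<dots> = (\<Sum>j\<in>UNIV. (if j = i then (real m)\<^sup>2 - \<theta> * real m else 0) + (\<theta> / 2)\<^sup>2)"
      by (intro sum.cong) (auto simp: power2_eq_square algebra_simps)
    also have "\<dots> = (real m)\<^sup>2 - \<theta> * real m + real CARD('n) * (\<theta> / 2)\<^sup>2" by (simp add: sum.distrib)
    finally have n2: "(norm (lat k - (\<theta> / 2) *\<^sub>R sign_vec (lat k)))\<^sup>2 = (real m)\<^sup>2 - \<theta> * real m + real CARD('n) * (\<theta> / 2)\<^sup>2" .
    have "exp (- \<kappa> * ((real m)\<^sup>2 - \<theta> * real m + real CARD('n) * (\<theta> / 2)\<^sup>2)) \<le> C * exp (- \<delta> * (real m)\<^sup>2)"
      using C[of k] by (simp add: n2 nk \<kappa>_def field_simps)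
    also have "\<dots> \<le> \<bar>C\<bar> * exp (- \<kappa> * (real m)\<^sup>2)" using \<kappa> by (intro mult_mono) (auto intro: mult_right_mono)
    finally have "exp (- \<kappa> * ((real m)\<^sup>2 - \<theta> * real m + real CARD('n) * (\<theta> / 2)\<^sup>2)) * exp (\<kappa> * (real m)\<^sup>2) \<le> \<bar>C\<bar> * exp (- \<kappa> * (real m)\<^sup>2) * exp (\<kappa> * (real m)\<^sup>2)"
      by (intro mult_right_mono) auto
    then have "exp (\<kappa> * \<theta> * real m - \<kappa> * (real CARD('n) * (\<theta> / 2)\<^sup>2)) \<le> \<bar>C\<bar>"
      by (simp add: mult.assoc exp_add[symmetric] algebra_simps)
    moreover have "\<kappa> * \<theta> * real m - \<kappa> * (real CARD('n) * (\<theta> / 2)\<^sup>2) \<le> exp (\<kappa> * \<theta> * real m - \<kappa> * (real CARD('n) * (\<theta> / 2)\<^sup>2))"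
      using exp_ge_add_one_self[of "\<kappa> * \<theta> * real m - \<kappa> * (real CARD('n) * (\<theta> / 2)\<^sup>2)"] by linarith
    ultimately show ?thesis by linarith
  qed
  moreover obtain m :: nat where "(\<kappa> * (real CARD('n) * (\<theta> / 2)\<^sup>2) + \<bar>C\<bar>) / (\<kappa> * \<theta>) < real m" using reals_Archimedean2 by blast
  then have "\<kappa> * (real CARD('n) * (\<theta> / 2)\<^sup>2) + \<bar>C\<bar> < \<kappa> * \<theta> * real m" using \<kappa> \<theta> by (simp add: divide_less_eq mult.commute)
  ultimately show False by (meson not_le)
qed

section \<open>Weak derivatives of products\<close>

text \<open>
  The chosen order of differentiation has no effect, by \<open>iter_partial_index_list\<close> and \<open>wderiv_mset\<close>.
\<close>

definition index_list :: "nat ^ 'n \<Rightarrow> 'n list" where "index_list r = (SOME is. mult_index is = r)"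

lemma mult_index_of_index_list[simp]: "mult_index (index_list r) = r"
  unfolding index_list_def using mult_index_surj[of r] by (rule someI_ex)

lemma mult_index_mset: "mult_index is = mult_index js \<Longrightarrow> mset is = mset js"
  by (simp add: mult_index_def multiset_eq_iff count_mset vec_eq_iff)

lemma index_list_0: "index_list 0 = []"
  using mult_index_length[of "index_list 0"] by simp

lemma iter_partial_index_list: "smooth \<phi> \<Longrightarrow> iter_partial is \<phi> = iter_partial (index_list (mult_index is)) \<phi>"
  by (rule iter_partial_mset) (auto intro: mult_index_mset)

text \<open>
  A family that consists of all weak derivatives of \<open>u 0\<close> up to order \<open>\<alpha>\<close> in each coordinate.
\<close>

definition weak_system :: "nat \<Rightarrow> (nat ^ 'n \<Rightarrow> real ^ 'n \<Rightarrow> real) \<Rightarrow> bool" where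
  "weak_system \<alpha> u \<longleftrightarrow> (\<forall>is. mult_index is \<in> index_box \<alpha> \<longrightarrow> wderiv is (u 0) (u (mult_index is)))"

lemma weak_system_wderiv: "weak_system \<alpha> u \<Longrightarrow> r \<in> index_box \<alpha> \<Longrightarrow> wderiv (index_list r) (u 0) (u r)"
  unfolding weak_system_def by (metis mult_index_of_index_list)

lemma weak_system_loc_int: "weak_system \<alpha> u \<Longrightarrow> r \<in> index_box \<alpha> \<Longrightarrow> loc_int (u r)"
  using weak_system_wderiv by (auto simp: wderiv_def)

lemma weak_system_family: assumes u: "weak_system \<alpha> u" shows "weak_family \<alpha> u"
  unfolding weak_family_def
proof (intro conjI ballI allI impI)
  fix r :: "nat^'a" and i assume r: "r \<in> index_box \<alpha>" "r $ i < \<alpha>"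
  have m: "mult_index (i # index_list r) = r + axis i 1" by (simp add: mult_index_Cons)
  have "r + axis i 1 \<in> index_box \<alpha>" using r by (auto simp: index_box_def axis_def Suc_le_eq)
  then have "wderiv (i # index_list r) (u 0) (u (r + axis i 1))" using u m unfolding weak_system_def by metis
  then show "wderiv [i] (u r) (u (r + axis i 1))" by (rule wderiv_step[OF weak_system_wderiv[OF u r(1)]])
qed (rule weak_system_loc_int[OF u])

lemma weak_family_mono: "weak_family \<alpha> u \<Longrightarrow> \<beta> \<le> \<alpha> \<Longrightarrow> weak_family \<beta> u"
proof -
  assume u: "weak_family \<alpha> u" and le: "\<beta> \<le> \<alpha>"
  have "r \<in> index_box \<alpha>" if "r \<in> index_box \<beta>" for r :: "nat^'a" using that le unfolding index_box_def by (auto intro: order_trans)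
  moreover have "r $ i < \<alpha>" if "r $ i < \<beta>" for r :: "nat^'a" and i using that le by simp
  ultimately show "weak_family \<beta> u" using u unfolding weak_family_def by blast
qed

lemma smooth_family_iter_partial:
  assumes \<phi>: "smooth \<phi>" shows "smooth_family \<alpha> (\<lambda>r. iter_partial (index_list r) \<phi>)"
  unfolding smooth_family_def
proof (intro conjI ballI allI impI)
  show "continuous_on UNIV (iter_partial (index_list r) \<phi>)" for r by (intro smooth_continuous smooth_iter_partial \<phi>)
  fix r i x t
  have "iter_partial (index_list (r + axis i 1)) \<phi> = iter_partial (i # index_list r) \<phi>"
    using iter_partial_index_list[OF \<phi>, of "i # index_list r"] by (simp add: mult_index_Cons)
  then show "((\<lambda>t. iter_partial (index_list r) \<phi> (x + t *\<^sub>R axis i 1)) has_field_derivative iter_partial (index_list (r + axis i 1)) \<phi> (x + t *\<^sub>R axis i 1)) (at t)"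
    using smooth_DERIV[OF smooth_iter_partial[OF \<phi>], of "index_list r" x i t] by simp
qed

text \<open>
  The derivatives of \<open>u 0 \<cdot> \<phi>\<close> by the Leibniz rule.
\<close>

definition prod_family :: "(nat ^ 'n \<Rightarrow> real ^ 'n \<Rightarrow> real) \<Rightarrow> (real ^ 'n \<Rightarrow> real) \<Rightarrow> nat ^ 'n \<Rightarrow> real ^ 'n \<Rightarrow> real" where
  "prod_family u \<phi> r x = (\<Sum>(A, B)\<leftarrow>splits (index_list r). u (mult_index B) x * iter_partial A \<phi> x)"

lemma prod_family_0: "prod_family u \<phi> 0 x = u 0 x * \<phi> x"
  by (simp add: prod_family_def index_list_0 mult_index_Nil)

lemma splits_index_box:
  assumes "(A, B) \<in> set (splits (index_list r))" "r \<in> index_box \<alpha>"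
  shows "mult_index A \<in> index_box \<alpha>" "mult_index B \<in> index_box \<alpha>" "mult_index B $ i + mult_index A $ i \<le> \<alpha>"
proof -
  have eq: "mult_index A + mult_index B = r" using splits_mult_index[OF assms(1)] by simp
  have "mult_index A $ i + mult_index B $ i \<le> \<alpha>" for i
    using assms(2) unfolding eq[symmetric] by (simp add: index_box_def)
  then show "mult_index A \<in> index_box \<alpha>" "mult_index B \<in> index_box \<alpha>" "mult_index B $ i + mult_index A $ i \<le> \<alpha>"
    by (auto simp: index_box_def add.commute intro: order_trans[OF le_add1] order_trans[OF le_add2])
qed

lemma prod_family_system:
  assumes u: "weak_system \<alpha> u" and \<phi>: "smooth \<phi>"
  shows "weak_system \<alpha> (prod_family u \<phi>)"
  unfolding weak_system_def
proof (intro allI impI)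
  fix "is" :: "'a list" assume r: "mult_index is \<in> index_box \<alpha>"
  let ?r = "mult_index is"
  have *: "wderiv (index_list ?r) (\<lambda>x. u 0 x * \<phi> x) (\<lambda>x. \<Sum>(A, B)\<leftarrow>splits (index_list ?r). u (mult_index B) x * iter_partial A \<phi> x)"
  proof (rule wderiv_leibniz[OF _ \<phi>])
    show "wderiv B (u 0) (u (mult_index B))" if "(A, B) \<in> set (splits (index_list ?r))" for A B
      using u splits_index_box(2)[OF that r] by (simp add: weak_system_def)
  qed
  have "wderiv (index_list ?r) (prod_family u \<phi> 0) (prod_family u \<phi> ?r)"
  proof -
    have "prod_family u \<phi> 0 = (\<lambda>x. u 0 x * \<phi> x)" by (rule ext) (rule prod_family_0)
    moreover have "prod_family u \<phi> ?r = (\<lambda>x. \<Sum>(A, B)\<leftarrow>splits (index_list ?r). u (mult_index B) x * iter_partial A \<phi> x)"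
      by (rule ext) (rule prod_family_def)
    ultimately show ?thesis using * by (simp only:)
  qed
  then show "wderiv is (prod_family u \<phi> 0) (prod_family u \<phi> ?r)"
    by (rule wderiv_mset) (rule mult_index_mset, rule mult_index_of_index_list)
qed

lemma sum_list_powr_le:
  fixes F :: "'a \<Rightarrow> real"
  assumes "0 \<le> p"
  shows "\<bar>\<Sum>a\<leftarrow>xs. F a\<bar> powr p \<le> (2 powr p) ^ length xs * (\<Sum>a\<leftarrow>xs. \<bar>F a\<bar> powr p)"
proof (induction xs)
  case (Cons a xs)
  let ?c = "2 powr p"
  have c: "1 \<le> ?c" using assms by (simp add: ge_one_powr_ge_zero)
  have "\<bar>\<Sum>a\<leftarrow>a # xs. F a\<bar> powr p \<le> (\<bar>F a\<bar> + \<bar>\<Sum>a\<leftarrow>xs. F a\<bar>) powr p"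
    using assms by (intro powr_mono2) auto
  also have "\<dots> \<le> ?c * (\<bar>F a\<bar> powr p + \<bar>\<Sum>a\<leftarrow>xs. F a\<bar> powr p)"
    using assms by (intro powr_add_le) auto
  also have "\<dots> \<le> ?c * (?c ^ length xs * \<bar>F a\<bar> powr p + ?c ^ length xs * (\<Sum>a\<leftarrow>xs. \<bar>F a\<bar> powr p))"
    using c Cons.IH mult_right_mono[of 1 "?c ^ length xs" "\<bar>F a\<bar> powr p"] by (intro mult_left_mono add_mono) auto
  finally show ?case by (simp add: algebra_simps)
qed simp

lemma sum_list_le_const:
  fixes F :: "'a \<Rightarrow> real"
  shows "(\<And>a. a \<in> set xs \<Longrightarrow> F a \<le> M) \<Longrightarrow> (\<Sum>a\<leftarrow>xs. F a) \<le> real (length xs) * M"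
proof (induction xs)
  case (Cons a xs)
  then have "F a \<le> M" "(\<Sum>a\<leftarrow>xs. F a) \<le> real (length xs) * M" by auto
  then show ?case by (simp add: distrib_right)
qed simp

definition split_const :: "real \<Rightarrow> nat ^ 'n \<Rightarrow> real" where
  "split_const p r = (2 powr p) ^ length (splits (index_list r))"

lemma split_const_nonneg: "0 \<le> split_const p r" by (simp add: split_const_def)

lemma prod_family_powr_le:
  assumes "0 \<le> p"
  shows "\<bar>prod_family u \<phi> r x\<bar> powr p \<le> split_const p r * (\<Sum>a\<leftarrow>splits (index_list r). \<bar>u (mult_index (snd a)) x\<bar> powr p * \<bar>iter_partial (fst a) \<phi> x\<bar> powr p)"
  using sum_list_powr_le[OF assms, of "\<lambda>a. u (mult_index (snd a)) x * iter_partial (fst a) \<phi> x" "splits (index_list r)"]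
  by (simp add: prod_family_def split_const_def split_def abs_mult powr_mult)

lemma loc_int_bound:
  assumes h: "loc_int h" and f: "f \<in> borel_measurable borel" and le: "\<And>x. \<bar>f x\<bar> \<le> h x"
  shows "loc_int f"
  unfolding loc_int_def set_integrable_def
proof (intro conjI allI impI f)
  fix K :: "'a set" assume K: "compact K"
  show "integrable lborel (\<lambda>x. indicator K x *\<^sub>R f x)"
  proof (rule Bochner_Integration.integrable_bound)
    show "integrable lborel (\<lambda>x. indicator K x *\<^sub>R h x)" using h K by (simp add: loc_int_def set_integrable_def)
    show "(\<lambda>x. indicator K x *\<^sub>R f x) \<in> borel_measurable lborel" using f borel_compact[OF K] by simp
    show "AE x in lborel. norm (indicator K x *\<^sub>R f x) \<le> norm (indicator K x *\<^sub>R h x)"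
      using le by (intro AE_I2) (auto simp: indicator_def intro: order_trans[OF le abs_ge_self])
  qed
qed

lemma integrable_loc_int: "integrable lborel v \<Longrightarrow> loc_int v"
  unfolding loc_int_def set_integrable_def
  by (auto intro!: integrable_mult_indicator[where f=v, simplified] simp: borel_compact)

lemma loc_int_powr_prod:
  fixes u :: "nat ^ 'n \<Rightarrow> real ^ 'n \<Rightarrow> real"
  assumes p: "0 < p" and u: "weak_system \<alpha> u" and up: "\<And>r. r \<in> index_box \<alpha> \<Longrightarrow> loc_int (\<lambda>x. \<bar>u r x\<bar> powr p)"
    and \<phi>: "smooth \<phi>" and r: "r \<in> index_box \<alpha>"
  shows "loc_int (\<lambda>x. \<bar>prod_family u \<phi> r x\<bar> powr p)"
proof (rule loc_int_bound)
  have c: "continuous_on UNIV (\<lambda>x. \<bar>iter_partial A \<phi> x\<bar> powr p)" for A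
    using p by (intro continuous_on_powr' continuous_on_rabs continuous_on_const smooth_continuous smooth_iter_partial \<phi>) auto
  show "loc_int (\<lambda>x. split_const p r * (\<Sum>a\<leftarrow>splits (index_list r). \<bar>u (mult_index (snd a)) x\<bar> powr p * \<bar>iter_partial (fst a) \<phi> x\<bar> powr p))"
  proof (intro loc_int_cmult loc_int_sum_list loc_int_mult_continuous c up)
    fix a assume "a \<in> set (splits (index_list r))"
    then show "mult_index (snd a) \<in> index_box \<alpha>" using splits_index_box(2)[of "fst a" "snd a" r \<alpha>] r by simp
  qed
  have "prod_family u \<phi> r \<in> borel_measurable borel"
    using weak_system_loc_int[OF prod_family_system[OF u \<phi>] r] by (rule loc_int_measurable)
  then show "(\<lambda>x. \<bar>prod_family u \<phi> r x\<bar> powr p) \<in> borel_measurable borel" by measurable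
  show "\<bar>\<bar>prod_family u \<phi> r x\<bar> powr p\<bar> \<le> split_const p r * (\<Sum>a\<leftarrow>splits (index_list r). \<bar>u (mult_index (snd a)) x\<bar> powr p * \<bar>iter_partial (fst a) \<phi> x\<bar> powr p)" for x
    using prod_family_powr_le[of p u \<phi> r x] p by simp
qed

text \<open>
  The constant of the multiplication algebra on cubes of side \<open>L\<close>. It is fixed outside the locale
  of cubes, so that it visibly does not depend on the position of the cube.
\<close>

definition algebra_const :: "'n::finite itself \<Rightarrow> real \<Rightarrow> nat \<Rightarrow> real \<Rightarrow> real" where
  "algebra_const _ L \<alpha> p = ((2 * (1 + L)) powr p) ^ CARD('n) *
     (\<Sum>r\<in>(index_box \<alpha> :: (nat^'n) set). split_const p r * length (splits (index_list r)))"

lemma algebra_const_nonneg: "0 \<le> algebra_const TYPE('n::finite) L \<alpha> p"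
  unfolding algebra_const_def by (intro mult_nonneg_nonneg sum_nonneg split_const_nonneg zero_le_power) auto

context side_cube
begin

lemma avg_mono_loc_int:
  assumes "loc_int F" "loc_int G" "\<And>x. x \<in> cbox a b \<Longrightarrow> F x \<le> G x"
  shows "avg F \<le> avg G"
  unfolding avg_def
proof (rule integral_mono)
  show "F x * weight x \<le> G x * weight x" for x
    using assms(3)[of x] L by (auto simp: weight_def indicator_def divide_right_mono)
qed (use assms loc_int_weight_integrable in auto)

lemma avg_sum_list:
  assumes "\<And>c. c \<in> set xs \<Longrightarrow> loc_int (F c)"
  shows "avg (\<lambda>x. \<Sum>c\<leftarrow>xs. F c x) = (\<Sum>c\<leftarrow>xs. avg (F c))"
  unfolding avg_def using integral_sum_list[of xs lborel "\<lambda>c x. F c x * weight x"] assms loc_int_weight_integrable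
  by (simp add: sum_list_mult_const)

definition sob_sum :: "nat \<Rightarrow> real \<Rightarrow> (nat ^ 'n \<Rightarrow> real ^ 'n \<Rightarrow> real) \<Rightarrow> real" where
  "sob_sum \<alpha> p u = (\<Sum>r\<in>index_box \<alpha>. avg (\<lambda>x. \<bar>u r x\<bar> powr p))"

lemma sob_sum_nonneg: "0 \<le> sob_sum \<alpha> p u"
  unfolding sob_sum_def by (intro sum_nonneg avg_nonneg) simp

lemma avg_prod_family_le:
  assumes p: "0 < p" and u: "weak_system \<alpha> u" and up: "\<And>r. r \<in> index_box \<alpha> \<Longrightarrow> loc_int (\<lambda>x. \<bar>u r x\<bar> powr p)"
    and \<phi>: "smooth \<phi>" and r: "r \<in> index_box \<alpha>"
    and M: "\<And>A B. (A, B) \<in> set (splits (index_list r)) \<Longrightarrow> avg (\<lambda>x. \<bar>u (mult_index B) x\<bar> powr p * \<bar>iter_partial A \<phi> x\<bar> powr p) \<le> M"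
  shows "avg (\<lambda>x. \<bar>prod_family u \<phi> r x\<bar> powr p) \<le> split_const p r * length (splits (index_list r)) * M"
proof -
  have c: "continuous_on UNIV (\<lambda>x. \<bar>iter_partial A \<phi> x\<bar> powr p)" for A
    using p by (intro continuous_on_powr' continuous_on_rabs continuous_on_const smooth_continuous smooth_iter_partial \<phi>) auto
  have l: "loc_int (\<lambda>x. \<bar>u (mult_index (snd a)) x\<bar> powr p * \<bar>iter_partial (fst a) \<phi> x\<bar> powr p)" if "a \<in> set (splits (index_list r))" for a
    using that splits_index_box(2)[of "fst a" "snd a" r \<alpha>] r by (intro loc_int_mult_continuous c up) simp
  have "avg (\<lambda>x. \<bar>prod_family u \<phi> r x\<bar> powr p)
    \<le> avg (\<lambda>x. split_const p r * (\<Sum>a\<leftarrow>splits (index_list r). \<bar>u (mult_index (snd a)) x\<bar> powr p * \<bar>iter_partial (fst a) \<phi> x\<bar> powr p))"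
    using prod_family_powr_le[of p u \<phi> r] p
    by (intro avg_mono_loc_int loc_int_powr_prod[OF p u up \<phi> r] loc_int_cmult loc_int_sum_list l) auto
  also have "\<dots> = split_const p r * (\<Sum>a\<leftarrow>splits (index_list r). avg (\<lambda>x. \<bar>u (mult_index (snd a)) x\<bar> powr p * \<bar>iter_partial (fst a) \<phi> x\<bar> powr p))"
    using l by (subst avg_cmult, subst avg_sum_list) auto
  also have "\<dots> \<le> split_const p r * (length (splits (index_list r)) * M)"
    using M by (intro mult_left_mono sum_list_le_const split_const_nonneg) auto
  finally show ?thesis by simp
qed

text \<open>
  Each term of the Leibniz rule is covered by the mixed product estimate, because the two orders of
  differentiation in it add up to an order at most \<open>\<alpha>\<close> in every coordinate.
\<close>

lemma sobolev_algebra: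
  assumes p: "1 \<le> p" and \<alpha>: "1 \<le> \<alpha>" and eta: "mollifier (\<eta> :: real^'n \<Rightarrow> real)" and u: "weak_system \<alpha> u"
    and up: "\<And>r. r \<in> index_box \<alpha> \<Longrightarrow> loc_int (\<lambda>x. \<bar>u r x\<bar> powr p)" and \<phi>: "smooth \<phi>"
  shows "sob_sum \<alpha> p (prod_family u \<phi>) \<le> algebra_const TYPE('n) L \<alpha> p * sob_sum \<alpha> p u * sob_sum \<alpha> p (\<lambda>r. iter_partial (index_list r) \<phi>)"
proof -
  let ?M = "sob_const p ^ CARD('n) * sob_sum \<alpha> p u * sob_sum \<alpha> p (\<lambda>r. iter_partial (index_list r) \<phi>)"
  have "avg (\<lambda>x. \<bar>prod_family u \<phi> r x\<bar> powr p) \<le> split_const p r * length (splits (index_list r)) * ?M" if r: "r \<in> index_box \<alpha>" for r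
  proof (rule avg_prod_family_le[OF _ u up \<phi> r])
    fix A B assume AB: "(A, B) \<in> set (splits (index_list r))"
    have "avg (\<lambda>x. \<bar>u (mult_index B) x\<bar> powr p * \<bar>iter_partial (index_list (mult_index A)) \<phi> x\<bar> powr p) \<le> ?M"
      unfolding sob_sum_def
      by (rule mixed_product_weak[OF p \<alpha> eta weak_system_family[OF u] smooth_family_iter_partial[OF \<phi>] up splits_index_box(3)[OF AB r]])
    then show "avg (\<lambda>x. \<bar>u (mult_index B) x\<bar> powr p * \<bar>iter_partial A \<phi> x\<bar> powr p) \<le> ?M"
      using iter_partial_index_list[OF \<phi>, of A] by simp
  qed (use p in auto)
  note step = this
  have "sob_sum \<alpha> p (prod_family u \<phi>) \<le> (\<Sum>r\<in>(index_box \<alpha> :: (nat^'n) set). split_const p r * length (splits (index_list r)) * ?M)"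
    unfolding sob_sum_def[of \<alpha> p "prod_family u \<phi>"] by (rule sum_mono) (rule step)
  also have "\<dots> = algebra_const TYPE('n) L \<alpha> p * sob_sum \<alpha> p u * sob_sum \<alpha> p (\<lambda>r. iter_partial (index_list r) \<phi>)"
    unfolding algebra_const_def sob_const_def sum_distrib_right[symmetric] by (simp only: mult_ac)
  finally show ?thesis .
qed

lemma avg_le_integral:
  assumes F: "integrable lborel F" "\<And>x. 0 \<le> F x"
  shows "avg F \<le> (1 / L ^ CARD('n)) * (\<integral>x. F x \<partial>lborel)"
proof -
  have "avg F \<le> (\<integral>x. (1 / L ^ CARD('n)) * F x \<partial>lborel)"
    unfolding avg_def
  proof (rule integral_mono)
    show "integrable lborel (\<lambda>x. F x * weight x)" by (intro loc_int_weight_integrable integrable_loc_int F)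
    show "F x * weight x \<le> (1 / L ^ CARD('n)) * F x" for x using F(2)[of x] L by (auto simp: weight_def indicator_def)
  qed (use F in auto)
  then show ?thesis by simp
qed

end

text \<open>
  On the cube the derivatives of the Gaussian density are bounded pointwise by \<open>exp (- \<delta> |y|\<^sup>2) g\<^bsup>1/p\<^esup>\<close>, and the \<open>p\<close>-th power of
  \<open>g\<^bsup>1/p\<^esup>\<close> is the weight of the Gaussian norm. The quantifiers make the constant
  independent of the cube and of \<open>u\<close>.
\<close>

lemma gauss_product_bound:
  assumes p: "1 < p" and \<delta>: "0 < \<delta>" "\<delta> < (1 - 1 / p) / 2" and L: "L > 0"
  shows "\<exists>C\<ge>0. \<forall>a b (y :: real^'n) u. side_cube a b L \<longrightarrow> (\<forall>x\<in>cbox a b. norm (x - y) \<le> \<rho>) \<longrightarrow> weak_system \<alpha> u \<longrightarrow>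
     (\<forall>r\<in>index_box \<alpha>. loc_int (\<lambda>x. \<bar>u r x\<bar> powr p) \<and> integrable lborel (\<lambda>x. \<bar>u r x\<bar> powr p * gauss_density x)) \<longrightarrow>
     side_cube.sob_sum a b L \<alpha> p (prod_family u gauss_density) \<le> C * exp (- \<delta> * (norm y)\<^sup>2) powr p * (\<Sum>r\<in>index_box \<alpha>. \<integral>x. \<bar>u r x\<bar> powr p * gauss_density x \<partial>lborel)"
proof -
  have "\<forall>is. \<exists>C\<ge>0. \<forall>x y. norm (x - y) \<le> \<rho> \<longrightarrow> \<bar>iter_partial is gauss_density x\<bar> \<le> C * exp (- \<delta> * (norm y)\<^sup>2) * gauss_density (x :: real^'n) powr (1 / p)"
    using gauss_derivative_decay[OF p \<delta>, of \<rho>] by blast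
  then obtain c where c: "\<And>is. c is \<ge> 0"
    "\<And>is x y. norm (x - y) \<le> \<rho> \<Longrightarrow> \<bar>iter_partial is gauss_density x\<bar> \<le> c is * exp (- \<delta> * (norm y)\<^sup>2) * gauss_density (x :: real^'n) powr (1 / p)"
    by metis
  \<comment> \<open>a common bound for the finitely many derivatives of the density that occur\<close>
  define K where "K = Max (insert 0 (\<Union>r\<in>(index_box \<alpha> :: (nat^'n) set). (\<lambda>a. c (fst a)) ` set (splits (index_list r))))"
  have K0: "0 \<le> K" unfolding K_def by (auto intro!: Max_ge simp: finite_index_box)
  have K: "c A \<le> K" if "r \<in> index_box \<alpha>" "(A, B) \<in> set (splits (index_list r))" for A B r
  proof -
    have "c A \<in> (\<lambda>a. c (fst a)) ` set (splits (index_list r))" using that(2) by force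
    then show ?thesis using that(1) unfolding K_def by (intro Max_ge) (auto simp: finite_index_box)
  qed
  define S where "S = (\<Sum>r\<in>(index_box \<alpha> :: (nat^'n) set). split_const p r * length (splits (index_list r)))"
  have S0: "0 \<le> S" unfolding S_def by (intro sum_nonneg mult_nonneg_nonneg split_const_nonneg) auto
  define C where "C = S * (K powr p / L ^ CARD('n))"
  show ?thesis
  proof (intro exI[of _ C] conjI allI impI)
    show "C \<ge> 0" using S0 L by (simp add: C_def)
    fix a b y :: "real^'n" and u :: "nat^'n \<Rightarrow> real^'n \<Rightarrow> real"
    assume cube: "side_cube a b L" and near: "\<forall>x\<in>cbox a b. norm (x - y) \<le> \<rho>" and u: "weak_system \<alpha> u"
      and int: "\<forall>r\<in>index_box \<alpha>. loc_int (\<lambda>x. \<bar>u r x\<bar> powr p) \<and> integrable lborel (\<lambda>x. \<bar>u r x\<bar> powr p * gauss_density x)"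
    interpret side_cube a b L by (rule cube)
    let ?e = "exp (- \<delta> * (norm y)\<^sup>2)"
    let ?N = "\<Sum>r\<in>index_box \<alpha>. \<integral>x. \<bar>u r x\<bar> powr p * gauss_density x \<partial>lborel"
    let ?M = "(K * ?e) powr p * ((1 / L ^ CARD('n)) * ?N)"
    have "avg (\<lambda>x. \<bar>prod_family u gauss_density r x\<bar> powr p) \<le> split_const p r * length (splits (index_list r)) * ?M" if r: "r \<in> index_box \<alpha>" for r
    proof (rule avg_prod_family_le[OF _ u _ smooth_gauss r])
      fix A B assume AB: "(A, B) \<in> set (splits (index_list r))"
      note B = splits_index_box(2)[OF AB r]
      have iB: "integrable lborel (\<lambda>x. \<bar>u (mult_index B) x\<bar> powr p * gauss_density x)" using int B by blast
      have pos: "0 \<le> \<bar>u s x\<bar> powr p * gauss_density x" for s x using gauss_density_pos[of x] by simp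
      have cD: "continuous_on UNIV (\<lambda>x. \<bar>iter_partial A gauss_density x\<bar> powr p)"
        using p by (intro continuous_on_powr' continuous_on_rabs continuous_on_const smooth_continuous smooth_iter_partial smooth_gauss) auto
      have "avg (\<lambda>x. \<bar>u (mult_index B) x\<bar> powr p * \<bar>iter_partial A gauss_density x\<bar> powr p)
        \<le> avg (\<lambda>x. (K * ?e) powr p * (\<bar>u (mult_index B) x\<bar> powr p * gauss_density x))"
      proof (rule avg_mono_loc_int)
        show "loc_int (\<lambda>x. \<bar>u (mult_index B) x\<bar> powr p * \<bar>iter_partial A gauss_density x\<bar> powr p)"
          using int B by (intro loc_int_mult_continuous cD) blast
        show "loc_int (\<lambda>x. (K * ?e) powr p * (\<bar>u (mult_index B) x\<bar> powr p * gauss_density x))"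
          by (intro loc_int_cmult integrable_loc_int iB)
        fix x assume x: "x \<in> cbox a b"
        have "\<bar>iter_partial A gauss_density x\<bar> \<le> c A * ?e * gauss_density x powr (1 / p)"
          using near x by (intro c) auto
        also have "\<dots> \<le> K * ?e * gauss_density x powr (1 / p)"
          using K[OF r AB] by (intro mult_right_mono) auto
        finally have "\<bar>iter_partial A gauss_density x\<bar> powr p \<le> (K * ?e * gauss_density x powr (1 / p)) powr p"
          using p by (intro powr_mono2) auto
        also have "\<dots> = (K * ?e) powr p * gauss_density x"
          using K0 p gauss_density_pos[of x] by (simp add: powr_mult powr_powr)
        finally show "\<bar>u (mult_index B) x\<bar> powr p * \<bar>iter_partial A gauss_density x\<bar> powr p \<le> (K * ?e) powr p * (\<bar>u (mult_index B) x\<bar> powr p * gauss_density x)"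
          using mult_left_mono[of _ _ "\<bar>u (mult_index B) x\<bar> powr p"] by (simp add: mult.left_commute)
      qed
      also have "\<dots> = (K * ?e) powr p * avg (\<lambda>x. \<bar>u (mult_index B) x\<bar> powr p * gauss_density x)" by (rule avg_cmult)
      also have "\<dots> \<le> ?M"
      proof (intro mult_left_mono)
        have "avg (\<lambda>x. \<bar>u (mult_index B) x\<bar> powr p * gauss_density x) \<le> (1 / L ^ CARD('n)) * (\<integral>x. \<bar>u (mult_index B) x\<bar> powr p * gauss_density x \<partial>lborel)"
          by (rule avg_le_integral[OF iB pos])
        also have "\<dots> \<le> (1 / L ^ CARD('n)) * ?N"
          using L B by (intro mult_left_mono member_le_sum[where f="\<lambda>r. \<integral>x. \<bar>u r x\<bar> powr p * gauss_density x \<partial>lborel"] finite_index_box)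
            (auto intro!: Bochner_Integration.integral_nonneg pos)
        finally show "avg (\<lambda>x. \<bar>u (mult_index B) x\<bar> powr p * gauss_density x) \<le> (1 / L ^ CARD('n)) * ?N" .
      qed simp
      finally show "avg (\<lambda>x. \<bar>u (mult_index B) x\<bar> powr p * \<bar>iter_partial A gauss_density x\<bar> powr p) \<le> ?M" .
    qed (use p int in auto)
    note step = this
    have "sob_sum \<alpha> p (prod_family u gauss_density) \<le> (\<Sum>r\<in>(index_box \<alpha> :: (nat^'n) set). split_const p r * length (splits (index_list r)) * ?M)"
      unfolding sob_sum_def by (rule sum_mono) (rule step)
    also have "\<dots> = S * ?M" unfolding S_def sum_distrib_right[symmetric] by (rule refl)
    also have "\<dots> = C * ?e powr p * ?N" using K0 by (simp add: C_def powr_mult mult_ac)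
    finally show "sob_sum \<alpha> p (prod_family u gauss_density) \<le> C * ?e powr p * ?N" .
  qed
qed

section \<open>The integer lattice and partitions of unity\<close>

lemma shifted_cube_eq: "shifted_cube \<theta> k = cbox (\<chi> i. lat k $ i - \<theta> / 2) (\<chi> i. lat k $ i + \<theta> / 2)"
proof (intro set_eqI iffI)
  fix x assume "x \<in> shifted_cube \<theta> k"
  then show "x \<in> cbox (\<chi> i. lat k $ i - \<theta> / 2) (\<chi> i. lat k $ i + \<theta> / 2)"
    by (auto simp: shifted_cube_def cube_def mem_box_cart)
next
  fix x assume *: "x \<in> cbox (\<chi> i. lat k $ i - \<theta> / 2) (\<chi> i. lat k $ i + \<theta> / 2)"
  have "- \<theta> / 2 \<le> (x - lat k) $ i \<and> (x - lat k) $ i \<le> \<theta> / 2" for i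
    using * by (auto simp: mem_box_cart algebra_simps dest!: spec[of _ i])
  then have "x - lat k \<in> cube \<theta>" by (simp add: cube_def mem_box_cart)
  moreover have "x = lat k + (x - lat k)" by simp
  ultimately show "x \<in> shifted_cube \<theta> k" unfolding shifted_cube_def by blast
qed

lemma side_cube_shifted: "0 < \<theta> \<Longrightarrow> side_cube (\<chi> i. lat k $ i - \<theta> / 2) (\<chi> i. lat k $ i + \<theta> / 2) \<theta>"
  by standard auto

lemma shifted_cube_near:
  assumes "x \<in> cbox (\<chi> i. lat k $ i - \<theta> / 2) (\<chi> i. lat k $ i + \<theta> / 2)"
  shows "norm (x - lat (k :: int^'n)) \<le> real CARD('n) * (\<theta> / 2)"
proof -
  have "\<bar>(x - lat k) $ i\<bar> \<le> \<theta> / 2" for i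
    unfolding abs_le_iff using assms by (auto simp: mem_box_cart dest!: spec[of _ i])
  then have "(\<Sum>i\<in>UNIV. \<bar>(x - lat k) $ i\<bar>) \<le> real CARD('n) * (\<theta> / 2)"
    using sum_bounded_above[of UNIV "\<lambda>i. \<bar>(x - lat k) $ i\<bar>" "\<theta> / 2"] by simp
  then show ?thesis using norm_le_l1_cart[of "x - lat k"] by linarith
qed

lemma scaled_mem_shifted_cube:
  assumes "0 < \<theta>"
  shows "\<theta> *\<^sub>R x + lat k \<in> cbox (\<chi> i. lat k $ i - \<theta> / 2) (\<chi> i. lat k $ i + \<theta> / 2) \<longleftrightarrow> x \<in> cube 1"
proof -
  have "lat k $ i - \<theta> / 2 \<le> \<theta> * x $ i + lat k $ i \<and> \<theta> * x $ i + lat k $ i \<le> lat k $ i + \<theta> / 2 \<longleftrightarrow> - 1 / 2 \<le> x $ i \<and> x $ i \<le> 1 / 2" for i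
  proof -
    have "lat k $ i - \<theta> / 2 \<le> \<theta> * x $ i + lat k $ i \<longleftrightarrow> \<theta> * (- 1 / 2) \<le> \<theta> * x $ i" by auto
    moreover have "\<theta> * x $ i + lat k $ i \<le> lat k $ i + \<theta> / 2 \<longleftrightarrow> \<theta> * x $ i \<le> \<theta> * (1 / 2)" by auto
    ultimately show ?thesis using assms by (simp only: mult_le_cancel_left_pos)
  qed
  then show ?thesis by (simp add: cube_def mem_box_cart)
qed

lemma finite_lattice_ball: "finite {k :: int^'n. norm (lat k) < N}"
proof -
  let ?M = "\<lceil>N\<rceil>"
  have "finite (PiE (UNIV :: 'n set) (\<lambda>_. {- ?M..?M}))" by (intro finite_PiE) auto
  moreover have "{k :: int^'n. norm (lat k) < N} \<subseteq> vec_lambda ` PiE (UNIV :: 'n set) (\<lambda>_. {- ?M..?M})"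
  proof
    fix k :: "int^'n" assume k: "k \<in> {k. norm (lat k) < N}"
    have "k $ i \<in> {- ?M..?M}" for i
    proof -
      have "\<bar>real_of_int (k $ i)\<bar> < N" using component_le_norm_cart[of "lat k" i] k by (simp add: lat_def)
      then have "\<bar>real_of_int (k $ i)\<bar> \<le> real_of_int ?M" by linarith
      then show ?thesis by auto
    qed
    then have "($) k \<in> PiE UNIV (\<lambda>_. {- ?M..?M})" by auto
    then show "k \<in> vec_lambda ` PiE UNIV (\<lambda>_. {- ?M..?M})" by (force intro: image_eqI[of _ _ "($) k"])
  qed
  ultimately show ?thesis using finite_subset by blast
qed

text \<open>
  Comparison with two geometric series, from \<open>|j| \<le> j\<^sup>2\<close> for integers.
\<close>

lemma integer_gauss_sum:
  fixes q :: real
  assumes q: "0 < q" "q < 1"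
  shows "(\<Sum>j\<in>{- int M..int M}. q ^ nat (j\<^sup>2)) \<le> 2 / (1 - q)" (is "?S \<le> _")
proof -
  have le: "q ^ nat (j\<^sup>2) \<le> q ^ nat \<bar>j\<bar>" for j :: int
  proof (rule power_decreasing)
    have "\<bar>j\<bar> \<le> j\<^sup>2" by (cases "j = 0") (auto simp: power2_eq_square abs_mult_self_eq[symmetric, of j] simp del: abs_mult_self_eq intro: mult_le_cancel_left1[THEN iffD2])
    then show "nat \<bar>j\<bar> \<le> nat (j\<^sup>2)" by (rule nat_mono)
  qed (use q in auto)
  have geo: "(\<Sum>i\<le>M. q ^ i) \<le> 1 / (1 - q)"
    using q sum_gp0[of q M] by (simp add: divide_right_mono)
  have "{- int M..int M} \<subseteq> int ` {..M} \<union> (\<lambda>i. - int i) ` {..M}"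
  proof
    fix j assume "j \<in> {- int M..int M}"
    then show "j \<in> int ` {..M} \<union> (\<lambda>i. - int i) ` {..M}"
      by (cases "0 \<le> j") (auto intro: image_eqI[of _ _ "nat j"] image_eqI[of _ _ "nat (- j)"])
  qed
  then have "?S \<le> (\<Sum>j\<in>int ` {..M} \<union> (\<lambda>i. - int i) ` {..M}. q ^ nat (j\<^sup>2))"
    using q by (intro sum_mono2) auto
  also have "\<dots> \<le> (\<Sum>j\<in>int ` {..M}. q ^ nat (j\<^sup>2)) + (\<Sum>j\<in>(\<lambda>i. - int i) ` {..M}. q ^ nat (j\<^sup>2))"
    using q sum.union_inter[of "int ` {..M}" "(\<lambda>i. - int i) ` {..M}" "\<lambda>j. q ^ nat (j\<^sup>2)"]
      sum_nonneg[of "int ` {..M} \<inter> (\<lambda>i. - int i) ` {..M}" "\<lambda>j. q ^ nat (j\<^sup>2)"] by auto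
  also have "(\<Sum>j\<in>int ` {..M}. q ^ nat (j\<^sup>2)) \<le> (\<Sum>i\<le>M. q ^ i)"
    using le[of "int _"] by (subst sum.reindex) (auto intro!: sum_mono simp: inj_on_def)
  also have "(\<Sum>j\<in>(\<lambda>i. - int i) ` {..M}. q ^ nat (j\<^sup>2)) \<le> (\<Sum>i\<le>M. q ^ i)"
    using le[of "- int _"] by (subst sum.reindex) (auto intro!: sum_mono simp: inj_on_def)
  finally have "?S \<le> 2 * (\<Sum>i\<le>M. q ^ i)" by simp
  also have "\<dots> \<le> 2 * (1 / (1 - q))" using geo by simp
  finally show ?thesis by simp
qed

lemma norm_lat_sq: "(norm (lat (k :: int^'n)))\<^sup>2 = (\<Sum>i\<in>UNIV. (real_of_int (k $ i))\<^sup>2)"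
  by (simp add: norm_vec_def L2_set_def lat_def sum_nonneg)

text \<open>
  The Gaussian factorizes over the coordinates, so a box of lattice points gives a product of
  one-dimensional sums.
\<close>

lemma lattice_gauss_sum:
  fixes T :: "(int^'n) set"
  assumes T: "finite T" and c: "0 < c"
  shows "(\<Sum>k\<in>T. exp (- c * (norm (lat k))\<^sup>2)) \<le> (2 / (1 - exp (- c))) ^ CARD('n)"
proof -
  define q where "q = exp (- c)"
  have q: "0 < q" "q < 1" using c by (auto simp: q_def)
  have factor: "exp (- c * (norm (lat k))\<^sup>2) = (\<Prod>i\<in>UNIV. q ^ nat ((k $ i)\<^sup>2))" for k :: "int^'n"
  proof -
    have "- c * (norm (lat k))\<^sup>2 = (\<Sum>i\<in>UNIV. of_nat (nat ((k $ i)\<^sup>2)) * (- c))"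
      by (simp add: norm_lat_sq sum_distrib_left mult.commute sum_negf)
    then have "exp (- c * (norm (lat k))\<^sup>2) = (\<Prod>i\<in>UNIV. exp (of_nat (nat ((k $ i)\<^sup>2)) * (- c)))"
      by (simp only: exp_sum finite)
    then show ?thesis by (simp only: exp_of_nat_mult q_def)
  qed
  obtain M where M: "\<And>k i. k \<in> T \<Longrightarrow> \<bar>k $ i\<bar> \<le> int M"
  proof -
    let ?A = "(\<lambda>(k, i). nat \<bar>k $ i\<bar>) ` (T \<times> (UNIV :: 'n set))"
    have "finite ?A" using T by simp
    then have "nat \<bar>k $ i\<bar> \<le> Max (insert 0 ?A)" if "k \<in> T" for k i using that by (intro Max_ge) auto
    then show thesis using that[of "Max (insert 0 ?A)"] by (simp add: nat_le_iff)
  qed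
  have "(\<Sum>k\<in>T. exp (- c * (norm (lat k))\<^sup>2)) = (\<Sum>g\<in>(\<lambda>k. ($) k) ` T. \<Prod>i\<in>UNIV. q ^ nat ((g i)\<^sup>2))"
  proof -
    have "inj_on (\<lambda>k. ($) k) T" by (auto simp: inj_on_def vec_eq_iff)
    then show ?thesis by (subst sum.reindex) (simp_all only: factor o_def)
  qed
  also have "\<dots> \<le> (\<Sum>g\<in>PiE UNIV (\<lambda>_. {- int M..int M}). \<Prod>i\<in>(UNIV :: 'n set). q ^ nat ((g i)\<^sup>2))"
  proof (rule sum_mono2)
    show "finite (PiE (UNIV :: 'n set) (\<lambda>_. {- int M..int M}))" by (intro finite_PiE) auto
    have "- int M \<le> k $ i \<and> k $ i \<le> int M" if "k \<in> T" for k i using M[OF that, of i] by linarith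
    then show "(\<lambda>k. ($) k) ` T \<subseteq> PiE UNIV (\<lambda>_. {- int M..int M})" by auto
    show "0 \<le> (\<Prod>i\<in>UNIV. q ^ nat ((g i)\<^sup>2))" for g :: "'n \<Rightarrow> int" using q by (intro prod_nonneg) auto
  qed
  also have "\<dots> = (\<Prod>i\<in>(UNIV :: 'n set). \<Sum>j\<in>{- int M..int M}. q ^ nat (j\<^sup>2))"
    by (subst prod_sum_PiE) auto
  also have "\<dots> = (\<Sum>j\<in>{- int M..int M}. q ^ nat (j\<^sup>2)) ^ CARD('n)" by simp
  also have "\<dots> \<le> (2 / (1 - q)) ^ CARD('n)"
    using q by (intro power_mono integer_gauss_sum sum_nonneg) auto
  finally show ?thesis by (simp add: q_def)
qed

text \<open>
  The factor \<open>\<rho>\<close> in the number of nodes, the reciprocal of the bound for the lattice sum.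
\<close>

definition node_density :: "'n::finite itself \<Rightarrow> real \<Rightarrow> real \<Rightarrow> real" where
  "node_density _ a \<delta> = inverse (2 ^ CARD('n)) * (1 - exp (- \<delta> / (2 * a))) ^ CARD('n)"

lemma node_density_pos: "0 < a \<Longrightarrow> 0 < \<delta> \<Longrightarrow> 0 < node_density TYPE('n::finite) a \<delta>"
  and node_density_le: "0 < a \<Longrightarrow> 0 < \<delta> \<Longrightarrow> node_density TYPE('n::finite) a \<delta> \<le> 1"
proof -
  assume *: "0 < a" "0 < \<delta>"
  then have e: "0 < 1 - exp (- \<delta> / (2 * a))" "1 - exp (- \<delta> / (2 * a)) \<le> 1" by auto
  then show "0 < node_density TYPE('n::finite) a \<delta>" by (simp add: node_density_def)
  have "inverse (2 ^ CARD('n)) * (1 - exp (- \<delta> / (2 * a))) ^ CARD('n) \<le> (1::real) * 1"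
    using e by (intro mult_mono power_le_one) (auto simp: field_simps)
  then show "node_density TYPE('n::finite) a \<delta> \<le> 1" by (simp add: node_density_def)
qed

lemma n_at_eq: "norm (lat (k :: int^'n)) < xi a \<delta> n \<Longrightarrow>
   n_at a \<delta> n k = node_density TYPE('n) a \<delta> * n * exp (- (\<delta> / (2 * a)) * (norm (lat k))\<^sup>2)"
  by (simp add: n_at_def node_density_def)

lemma number_of_nodes:
  assumes a: "0 < a" and \<delta>: "0 < \<delta>" and n: "1 \<le> n"
  shows "real (\<Sum>k :: int ^ 'n | norm (lat k) < xi a \<delta> n. nat \<lfloor>n_at a \<delta> n k\<rfloor>) \<le> n"
proof -
  let ?S = "{k :: int^'n. norm (lat k) < xi a \<delta> n}"
  let ?c = "\<delta> / (2 * a)" and ?d = "node_density TYPE('n) a \<delta>"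
  have fin: "finite ?S" by (rule finite_lattice_ball)
  have d: "0 < ?d" by (rule node_density_pos[OF a \<delta>])
  have "real (\<Sum>k\<in>?S. nat \<lfloor>n_at a \<delta> n k\<rfloor>) = (\<Sum>k\<in>?S. real (nat \<lfloor>n_at a \<delta> n k\<rfloor>))" by simp
  also have "\<dots> \<le> (\<Sum>k\<in>?S. ?d * n * exp (- ?c * (norm (lat k))\<^sup>2))"
  proof (rule sum_mono)
    fix k :: "int^'n" assume k: "k \<in> ?S"
    have "0 \<le> ?d * n * exp (- ?c * (norm (lat k))\<^sup>2)" using d n by simp
    then show "real (nat \<lfloor>n_at a \<delta> n k\<rfloor>) \<le> ?d * n * exp (- ?c * (norm (lat k))\<^sup>2)"
      using k by (subst n_at_eq) (auto intro: of_nat_floor)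
  qed
  also have "\<dots> = ?d * n * (\<Sum>k\<in>?S. exp (- ?c * (norm (lat k))\<^sup>2))" by (simp add: sum_distrib_left)
  also have "\<dots> \<le> ?d * n * (2 / (1 - exp (- ?c))) ^ CARD('n)"
    using d n a \<delta> by (intro mult_left_mono lattice_gauss_sum fin) auto
  also have "\<dots> = n"
  proof -
    define E where "E = 1 - exp (- ?c)"
    have "0 < E" using a \<delta> by (auto simp: E_def)
    then have "inverse (2 ^ CARD('n)) * E ^ CARD('n) * n * (2 / E) ^ CARD('n) = n"
      by (simp add: power_divide)
    then show ?thesis by (simp add: node_density_def E_def)
  qed
  finally show ?thesis .
qed

text \<open>
  A member of the partition that is positive somewhere, divided by its integral.
\<close>

lemma partition_mollifier:
  fixes \<phi> :: "int ^ 'n \<Rightarrow> real ^ 'n \<Rightarrow> real"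
  assumes part: "smooth_partition \<alpha> p \<theta> \<phi>"
  shows "\<exists>\<eta> :: real^'n \<Rightarrow> real. mollifier \<eta>"
proof -
  have t: "\<phi> k \<in> test_functions UNIV" and nn: "0 \<le> \<phi> k x" for k x
    using part by (auto simp: smooth_partition_def)
  have s: "((\<lambda>k. \<phi> k 0) has_sum 1) UNIV" using part by (simp add: smooth_partition_def)
  have "\<exists>k. \<phi> k 0 \<noteq> 0"
  proof (rule ccontr)
    assume "\<not> ?thesis"
    then have "(\<lambda>k. \<phi> k 0) = (\<lambda>_. 0)" by auto
    then have "((\<lambda>k. \<phi> k 0) has_sum 0) UNIV" by (simp add: has_sum_0)
    then show False using s has_sum_unique zero_neq_one by blast
  qed
  then obtain k where k: "\<phi> k 0 \<noteq> 0" by blast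
  have int: "integrable lborel (\<phi> k)"
    using loc_int_mult_test[OF continuous_loc_int[OF continuous_on_const, of 1] t[of k]] by simp
  have cont: "continuous_on UNIV (\<phi> k)" using smooth_continuous test_functionsD(1)[OF t] by blast
  have "(\<integral>x. \<phi> k x \<partial>lborel) \<noteq> 0"
  proof
    assume "(\<integral>x. \<phi> k x \<partial>lborel) = 0"
    then have "AE x in lborel. \<phi> k x = 0" using integral_nonneg_eq_0_iff_AE[OF int] nn by auto
    then have "AE x in lebesgue. x \<in> {x. \<phi> k x = 0}" by (simp add: AE_completion_iff)
    moreover have "closed {x. \<phi> k x = 0}" by (rule closed_Collect_eq[OF cont continuous_on_const])
    ultimately have "0 \<in> {x. \<phi> k x = 0}" by (intro mem_closed_if_AE_lebesgue)
    then show False using k by simp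
  qed
  moreover have "0 \<le> (\<integral>x. \<phi> k x \<partial>lborel)" using nn by (intro Bochner_Integration.integral_nonneg)
  ultimately have I: "0 < (\<integral>x. \<phi> k x \<partial>lborel)" by simp
  have "mollifier (\<lambda>x. inverse (\<integral>x. \<phi> k x \<partial>lborel) * \<phi> k x)"
    unfolding mollifier_def using I nn test_functions_mult[OF t[of k] smooth_const] by auto
  then show ?thesis by blast
qed

text \<open>
  Near a given point only the finitely many cubes that contain it matter, so the sums over balls of
  lattice points become equal to 1.
\<close>

lemma partition_finite_sums:
  fixes \<phi> :: "int ^ 'n \<Rightarrow> real ^ 'n \<Rightarrow> real"
  assumes part: "smooth_partition \<alpha> p \<theta> \<phi>"
  shows "finite T \<Longrightarrow> (\<Sum>k\<in>T. \<phi> k x) \<le> 1"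
    and "(\<lambda>N. \<Sum>k | norm (lat k) < real N. \<phi> k x) \<longlonglongrightarrow> 1"
proof -
  have nn: "0 \<le> \<phi> k x" for k x using part by (auto simp: smooth_partition_def)
  have s: "((\<lambda>k. \<phi> k x) has_sum 1) UNIV" using part by (simp add: smooth_partition_def)
  show "(\<Sum>k\<in>T. \<phi> k x) \<le> 1" if "finite T"
    by (rule has_sum_mono_neutral[OF has_sum_finite[OF that] s]) (use nn in auto)
  obtain N where N: "norm x + real CARD('n) * (\<theta> / 2) < real N" using reals_Archimedean2 by blast
  have out: "\<phi> k x = 0" if "\<not> norm (lat k) < real M" "M \<ge> N" for k M
  proof (rule ccontr)
    assume "\<phi> k x \<noteq> 0"
    then have "x \<in> supp (\<phi> k)" using supp_zero by blast
    moreover have "supp (\<phi> k) \<subseteq> interior (shifted_cube \<theta> k)" using part by (simp add: smooth_partition_def)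
    ultimately have "x \<in> shifted_cube \<theta> k" using interior_subset by blast
    then have "norm (x - lat k) \<le> real CARD('n) * (\<theta> / 2)" unfolding shifted_cube_eq by (rule shifted_cube_near)
    moreover have "norm (lat k) \<le> norm x + norm (x - lat k)" by (metis norm_minus_commute norm_triangle_sub)
    ultimately show False using N that by simp
  qed
  have "eventually (\<lambda>M. (\<Sum>k | norm (lat k) < real M. \<phi> k x) = 1) sequentially"
    using eventually_ge_at_top[of N]
  proof eventually_elim
    case (elim M)
    \<comment> \<open>outside this ball of lattice points all summands vanish\<close>
    have "((\<lambda>k. \<phi> k x) has_sum 1) {k. norm (lat k) < real M}"
      using s by (subst has_sum_cong_neutral[of UNIV]) (use out elim in auto)
    then show ?case using has_sum_unique has_sum_finite[OF finite_lattice_ball] by blast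
  qed
  then show "(\<lambda>N. \<Sum>k | norm (lat k) < real N. \<phi> k x) \<longlonglongrightarrow> 1" by (rule tendsto_eventually)
qed

section \<open>Localization to a cube\<close>

context side_cube
begin

lemma avg_eq_lborel_integral: "avg F = (\<integral>x. indicator (cbox a b) x * F x \<partial>lborel) / L ^ CARD('n)"
  by (simp add: avg_def weight_def mult.commute)

text \<open>
  For smooth functions the abstract sum of averages is the Sobolev norm of the cube; this is
  how the uniform bound on the partition enters.
\<close>

lemma sob_sum_eq_sobolev_norm:
  assumes eta: "mollifier (\<eta> :: real^'n \<Rightarrow> real)" and p: "0 < p" and \<phi>: "smooth \<phi>"
  shows "sob_sum \<alpha> p (\<lambda>r. iter_partial (index_list r) \<phi>) = sobolev_norm \<alpha> p (cbox a b) lebesgue \<phi> powr p / L ^ CARD('n)"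
proof -
  have "sobolev_norm \<alpha> p (cbox a b) lebesgue \<phi> powr p = (\<Sum>r\<in>index_box \<alpha>. \<integral>x. indicator (cbox a b) x * \<bar>iter_partial (index_list r) \<phi> x\<bar> powr p \<partial>lborel)"
    by (rule cube_sobolev_norm[OF eta p]) (use wderiv_smooth[OF \<phi>] mult_index_of_index_list in blast)
  then show ?thesis by (simp add: sob_sum_def avg_eq_lborel_integral sum_divide_distrib)
qed

lemma avg_jensen_loc_int:
  assumes p: "1 \<le> p" and F: "loc_int F" "loc_int (\<lambda>x. \<bar>F x\<bar> powr p)"
  shows "\<bar>avg F\<bar> powr p \<le> avg (\<lambda>x. \<bar>F x\<bar> powr p)"
proof -
  have i: "integrable lborel (\<lambda>x. \<bar>F x\<bar> * weight x)"
    using integrable_abs[OF loc_int_weight_integrable[OF F(1)]] by (simp add: abs_mult weight_nonneg)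
  have "\<bar>avg F\<bar> \<le> avg (\<lambda>x. \<bar>F x\<bar>)"
    unfolding avg_def using integral_abs_bound[of lborel "\<lambda>x. F x * weight x"] by (simp add: abs_mult weight_nonneg)
  then have "\<bar>avg F\<bar> powr p \<le> avg (\<lambda>x. \<bar>F x\<bar>) powr p" using p by (intro powr_mono2) auto
  also have "\<dots> \<le> avg (\<lambda>x. \<bar>F x\<bar> powr p)"
    unfolding avg_def
    by (rule jensen_powr[OF p])
      (use i loc_int_weight_integrable[OF F(2)] weight_nonneg weight_integral avg_integrable[of "\<lambda>_. 1"] in auto)
  finally show ?thesis .
qed

end

lemma partition_norm_bound:
  fixes \<phi> :: "int ^ 'n \<Rightarrow> real ^ 'n \<Rightarrow> real"
  assumes part: "smooth_partition \<alpha> p \<theta> \<phi>" and p: "0 < p" and \<theta>: "0 < \<theta>"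
  shows "\<exists>C\<ge>0. \<forall>k. side_cube.sob_sum (\<chi> i. lat k $ i - \<theta> / 2) (\<chi> i. lat k $ i + \<theta> / 2) \<theta> \<alpha> p (\<lambda>r. iter_partial (index_list r) (\<phi> k)) \<le> C"
proof -
  obtain \<eta> :: "real^'n \<Rightarrow> real" where eta: "mollifier \<eta>" using partition_mollifier[OF part] by blast
  obtain C where C: "\<And>k. sobolev_norm \<alpha> p (shifted_cube \<theta> k) lebesgue (\<phi> k) \<le> C"
    using part by (auto simp: smooth_partition_def)
  show ?thesis
  proof (intro exI[of _ "\<bar>C\<bar> powr p / \<theta> ^ CARD('n)"] conjI allI)
    show "0 \<le> \<bar>C\<bar> powr p / \<theta> ^ CARD('n)" using \<theta> by simp
    fix k :: "int^'n"
    have sm: "smooth (\<phi> k)" using part test_functionsD(1) by (auto simp: smooth_partition_def)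
    have "sobolev_norm \<alpha> p (shifted_cube \<theta> k) lebesgue (\<phi> k) powr p \<le> \<bar>C\<bar> powr p"
      using C[of k] p sobolev_norm_nonneg by (intro powr_mono2) auto
    then show "side_cube.sob_sum (\<chi> i. lat k $ i - \<theta> / 2) (\<chi> i. lat k $ i + \<theta> / 2) \<theta> \<alpha> p (\<lambda>r. iter_partial (index_list r) (\<phi> k)) \<le> \<bar>C\<bar> powr p / \<theta> ^ CARD('n)"
      unfolding side_cube.sob_sum_eq_sobolev_norm[OF side_cube_shifted[OF \<theta>] eta p sm] shifted_cube_eq[symmetric]
      using \<theta> by (intro divide_right_mono) auto
  qed
qed

text \<open>
  The Gaussian density is bounded below on compact sets.
\<close>

lemma weak_system_local_powr:
  assumes "integrable lborel (\<lambda>x. \<bar>u x\<bar> powr p * gauss_density (x :: real^'n))"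
  shows "loc_int (\<lambda>x. \<bar>u x\<bar> powr p)"
proof -
  have "continuous_on UNIV (\<lambda>x :: real^'n. inverse (gauss_density x))"
  proof (intro continuous_on_inverse gauss_density_continuous ballI)
    show "gauss_density x \<noteq> 0" for x :: "real^'n" using gauss_density_pos[of x] by simp
  qed
  from loc_int_mult_continuous[OF integrable_loc_int[OF assms] this]
  have "loc_int (\<lambda>x. \<bar>u x\<bar> powr p * gauss_density x * inverse (gauss_density x))" .
  moreover have "\<bar>u x\<bar> powr p * gauss_density x * inverse (gauss_density x) = \<bar>u x\<bar> powr p" for x
    using gauss_density_pos[of x] by (simp add: mult.assoc)
  ultimately show ?thesis by simp
qed

lemma integrable_loc_int_compact:
  assumes "loc_int h" "compact K" "\<And>x. x \<notin> K \<Longrightarrow> h x = 0"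
  shows "integrable lborel h"
proof -
  have "indicator K x *\<^sub>R h x = h x" for x using assms(3) by (cases "x \<in> K") auto
  moreover have "integrable lborel (\<lambda>x. indicator K x *\<^sub>R h x)" using assms(1,2) by (simp add: loc_int_def set_integrable_def)
  ultimately show ?thesis by (simp only:)
qed

lemma borel_lp_space:
  assumes "f \<in> borel_measurable borel" "integrable lborel (\<lambda>x. \<bar>f x\<bar> powr p)"
  shows "f \<in> lp_space p (restrict_space lebesgue UNIV)"
  unfolding lebesgue_on_UNIV_eq lp_space_def using assms by (simp add: measurable_completion integrable_completion)

text \<open>
  The algebra property bounds \<open>(f g) \<phi>\<^sub>k\<close> by the norm of \<open>f g\<close> on the cube, which decays like
  \<open>exp (- \<delta> |k|\<^sup>2)\<close>, times the norm of \<open>\<phi>\<^sub>k\<close>, which is bounded uniformly in \<open>k\<close>. Scaling the cube to the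
  unit cube costs powers of \<open>\<theta>\<close> only. The bound of the integral serves the cubes without nodes.
\<close>

lemma localized_norm:
  fixes \<phi> :: "int ^ 'n \<Rightarrow> real ^ 'n \<Rightarrow> real"
  assumes part: "smooth_partition \<alpha> p \<theta> \<phi>" and p: "1 < p" and \<alpha>: "1 \<le> \<alpha>" and \<theta>: "1 < \<theta>"
    and \<delta>: "0 < \<delta>" "\<delta> < (1 - 1 / p) / 2"
  shows "\<exists>C\<ge>0. \<forall>k u. weak_system \<alpha> u \<longrightarrow> (\<forall>r\<in>index_box \<alpha>. integrable lborel (\<lambda>x. \<bar>u r x\<bar> powr p * gauss_density x)) \<longrightarrow>
     (\<lambda>x. prod_family (prod_family u gauss_density) (\<phi> k) 0 (\<theta> *\<^sub>R x + lat k)) \<in> sobolev_space_cube0 \<alpha> p \<and>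
     sobolev_norm \<alpha> p (cube 1) lebesgue (\<lambda>x. prod_family (prod_family u gauss_density) (\<phi> k) 0 (\<theta> *\<^sub>R x + lat k))
       \<le> C * exp (- \<delta> * (norm (lat k))\<^sup>2) * (\<Sum>r\<in>index_box \<alpha>. \<integral>x. \<bar>u r x\<bar> powr p * gauss_density x \<partial>lborel) powr (1 / p) \<and>
     \<bar>\<integral>x. prod_family (prod_family u gauss_density) (\<phi> k) 0 x \<partial>lborel\<bar>
       \<le> C * exp (- \<delta> * (norm (lat k))\<^sup>2) * (\<Sum>r\<in>index_box \<alpha>. \<integral>x. \<bar>u r x\<bar> powr p * gauss_density x \<partial>lborel) powr (1 / p)"
proof -
  obtain \<eta> :: "real^'n \<Rightarrow> real" where eta: "mollifier \<eta>" using partition_mollifier[OF part] by blast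
  have p0: "0 < p" and p1: "1 \<le> p" using p by auto
  have \<theta>0: "0 < \<theta>" "\<theta> \<noteq> 0" using \<theta> by auto
  obtain C1 where C1: "C1 \<ge> 0" "\<And>k. side_cube.sob_sum (\<chi> i. lat k $ i - \<theta> / 2) (\<chi> i. lat k $ i + \<theta> / 2) \<theta> \<alpha> p (\<lambda>r. iter_partial (index_list r) (\<phi> k)) \<le> C1"
    using partition_norm_bound[OF part p0 \<theta>0(1)] by blast
  obtain C2 where C2: "C2 \<ge> 0" "\<And>a b (y :: real^'n) u. side_cube a b \<theta> \<Longrightarrow> (\<forall>x\<in>cbox a b. norm (x - y) \<le> real CARD('n) * (\<theta> / 2)) \<Longrightarrow> weak_system \<alpha> u \<Longrightarrow>
     (\<forall>r\<in>index_box \<alpha>. loc_int (\<lambda>x. \<bar>u r x\<bar> powr p) \<and> integrable lborel (\<lambda>x. \<bar>u r x\<bar> powr p * gauss_density x)) \<Longrightarrow>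
     side_cube.sob_sum a b \<theta> \<alpha> p (prod_family u gauss_density) \<le> C2 * exp (- \<delta> * (norm y)\<^sup>2) powr p * (\<Sum>r\<in>index_box \<alpha>. \<integral>x. \<bar>u r x\<bar> powr p * gauss_density x \<partial>lborel)"
    using gauss_product_bound[OF p \<delta> \<theta>0(1), of "real CARD('n) * (\<theta> / 2)" \<alpha>] by blast
  define C3 where "C3 = algebra_const TYPE('n) \<theta> \<alpha> p"
  have C3: "0 \<le> C3" unfolding C3_def by (rule algebra_const_nonneg)
  define K where "K = C3 * C2 * C1"
  have K0: "0 \<le> K" using C1 C2 C3 by (simp add: K_def)
  \<comment> \<open>scaling by \<open>\<theta>\<close> multiplies the derivative of order \<open>r\<close> by \<open>\<theta>\<close> to the power \<open>|r|\<^sub>1 \<le> d \<alpha>\<close>\<close>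
  define T where "T = (\<theta> ^ (CARD('n) * \<alpha>)) powr p"
  have T0: "0 \<le> T" by (simp add: T_def)
  define C where "C = (T * K) powr (1 / p) + \<theta> ^ CARD('n) * K powr (1 / p)"
  show ?thesis
  proof (rule exI[of _ C], rule conjI, goal_cases)
    case 1
    show ?case using \<theta>0 by (simp add: C_def)
  next
    case 2
    show ?case
    proof (intro allI impI)
    fix k :: "int^'n" and u :: "nat^'n \<Rightarrow> real^'n \<Rightarrow> real"
    assume u: "weak_system \<alpha> u" and int: "\<forall>r\<in>index_box \<alpha>. integrable lborel (\<lambda>x. \<bar>u r x\<bar> powr p * gauss_density x)"
    define e where "e = exp (- \<delta> * (norm (lat k))\<^sup>2)"
    define N where "N = (\<Sum>r\<in>index_box \<alpha>. \<integral>x. \<bar>u r x\<bar> powr p * gauss_density x \<partial>lborel)"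
    have e0: "0 < e" by (simp add: e_def)
    have N0: "0 \<le> N" unfolding N_def using gauss_density_pos
      by (intro sum_nonneg Bochner_Integration.integral_nonneg mult_nonneg_nonneg) (auto intro: less_imp_le)
    define a where "a = (\<chi> i. lat k $ i - \<theta> / 2)"
    define b where "b = (\<chi> i. lat k $ i + \<theta> / 2)"
    have cube: "side_cube a b \<theta>" unfolding a_def b_def by (rule side_cube_shifted[OF \<theta>0(1)])
    interpret side_cube a b \<theta> by (rule cube)
    define v where "v = prod_family u gauss_density"
    define F where "F = prod_family v (\<phi> k)"
    have \<phi>: "\<phi> k \<in> test_functions UNIV" "supp (\<phi> k) \<subseteq> interior (shifted_cube \<theta> k)"
      using part by (auto simp: smooth_partition_def)
    have sm: "smooth (\<phi> k)" using test_functionsD(1)[OF \<phi>(1)] .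
    have up: "loc_int (\<lambda>x. \<bar>u r x\<bar> powr p)" if "r \<in> index_box \<alpha>" for r
      using int that by (intro weak_system_local_powr) blast
    have v: "weak_system \<alpha> v" unfolding v_def by (rule prod_family_system[OF u smooth_gauss])
    have vp: "loc_int (\<lambda>x. \<bar>v r x\<bar> powr p)" if "r \<in> index_box \<alpha>" for r
      unfolding v_def by (rule loc_int_powr_prod[OF p0 u up smooth_gauss that])
    have F: "weak_system \<alpha> F" unfolding F_def by (rule prod_family_system[OF v sm])
    have Fp: "loc_int (\<lambda>x. \<bar>F r x\<bar> powr p)" if "r \<in> index_box \<alpha>" for r
      unfolding F_def by (rule loc_int_powr_prod[OF p0 v vp sm that])
    have sumF: "sob_sum \<alpha> p F \<le> K * (e powr p * N)"
    proof -
      have "sob_sum \<alpha> p F \<le> C3 * sob_sum \<alpha> p v * sob_sum \<alpha> p (\<lambda>r. iter_partial (index_list r) (\<phi> k))"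
        unfolding F_def C3_def by (rule sobolev_algebra[OF p1 \<alpha> eta v vp sm])
      also have "\<dots> \<le> C3 * (C2 * e powr p * N) * C1"
      proof (intro mult_mono mult_left_mono)
        show "sob_sum \<alpha> p v \<le> C2 * e powr p * N"
          unfolding v_def e_def N_def
          using shifted_cube_near[of _ k \<theta>] up int by (intro C2(2) cube u) (auto simp: a_def b_def)
        show "sob_sum \<alpha> p (\<lambda>r. iter_partial (index_list r) (\<phi> k)) \<le> C1"
          using C1(2)[of k] by (simp add: a_def b_def)
      qed (use C1(1) C2(1) C3 N0 sob_sum_nonneg in auto)
      finally show ?thesis by (simp add: K_def mult_ac)
    qed
    have off: "F r x = 0" if "x \<notin> supp (\<phi> k)" for r x
      using iter_partial_zero_off_supp[OF that] by (simp add: F_def prod_family_def split_def)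
    have supp_cube: "supp (\<phi> k) \<subseteq> cbox a b"
      using \<phi>(2) interior_subset unfolding shifted_cube_eq a_def b_def by blast
    have Fint: "integrable lborel (\<lambda>x. \<bar>F r x\<bar> powr p)" if "r \<in> index_box \<alpha>" for r
      by (rule integrable_loc_int_compact[OF Fp[OF that] test_functionsD(2)[OF \<phi>(1)]]) (simp add: off)
    define G where "G r x = \<theta> ^ length (index_list r) * F r (\<theta> *\<^sub>R x + lat k)" for r x
    have G0: "G 0 = (\<lambda>x. F 0 (\<theta> *\<^sub>R x + lat k))" by (simp add: G_def[abs_def] index_list_0)
    have wG: "wderiv (index_list r) (G 0) (G r)" if "r \<in> index_box \<alpha>" for r
      unfolding G0 unfolding G_def[abs_def] by (rule wderiv_affine[OF weak_system_wderiv[OF F that] \<theta>0(2)])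
    have Gb: "G r \<in> borel_measurable borel" if "r \<in> index_box \<alpha>" for r
      using wG[OF that] by (auto simp: wderiv_def loc_int_def)
    have Gpow: "\<bar>G r x\<bar> powr p = (\<theta> ^ length (index_list r)) powr p * \<bar>F r (\<theta> *\<^sub>R x + lat k)\<bar> powr p" for r x
      using \<theta>0 by (simp add: G_def abs_mult powr_mult)
    have Gint: "integrable lborel (\<lambda>x. \<bar>G r x\<bar> powr p)" if "r \<in> index_box \<alpha>" for r
      unfolding Gpow by (intro integrable_mult_right integrable_lborel_affine[OF Fint[OF that] \<theta>0(2)])
    have z: "(0 :: nat^'n) \<in> index_box \<alpha>" by (simp add: index_box_def)
    have member: "G 0 \<in> sobolev_space_cube0 \<alpha> p"
      unfolding sobolev_space_cube0_def sobolev_space_def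
    proof (intro CollectI conjI allI impI)
      show "G 0 \<in> lp_space p (restrict_space lebesgue UNIV)" by (intro borel_lp_space Gb Gint z)
      fix r :: "nat^'n" assume "\<forall>i. r $ i \<le> \<alpha>"
      then have r: "r \<in> index_box \<alpha>" by (simp add: index_box_def)
      show "\<exists>w. has_weak_deriv UNIV r (G 0) w \<and> w \<in> lp_space p (restrict_space lebesgue UNIV)"
        using wderiv_imp_has_weak_deriv[OF wG[OF r], of UNIV] borel_lp_space[OF Gb[OF r] Gint[OF r]] by auto
    next
      have "G 0 x = 0" if "x \<notin> cube 1" for x
        unfolding G0 using that scaled_mem_shifted_cube[OF \<theta>0(1), of x k] supp_cube
        by (intro off) (auto simp: a_def b_def)
      then show "AE x in lebesgue. x \<notin> cube 1 \<longrightarrow> G 0 x = 0" by simp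
    qed
    have cubeint: "(\<integral>x. indicator (cube 1) x * \<bar>G r x\<bar> powr p \<partial>lborel) \<le> T * avg (\<lambda>x. \<bar>F r x\<bar> powr p)" if r: "r \<in> index_box \<alpha>" for r
    proof -
      have [measurable]: "F r \<in> borel_measurable borel" using weak_system_loc_int[OF F r] by (rule loc_int_measurable)
      have "(\<integral>y. indicator (cbox a b) y * \<bar>F r y\<bar> powr p \<partial>lborel) = \<bar>\<theta>\<bar> ^ DIM(real^'n) * (\<integral>x. indicator (cbox a b) (\<theta> *\<^sub>R x + lat k) * \<bar>F r (\<theta> *\<^sub>R x + lat k)\<bar> powr p \<partial>lborel)"
        by (rule integral_lborel_affine[OF \<theta>0(2)]) measurable
      moreover have "indicator (cbox a b) (\<theta> *\<^sub>R x + lat k) = (indicator (cube 1) x :: real)" for x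
        using scaled_mem_shifted_cube[OF \<theta>0(1), of x k] by (simp add: indicator_def a_def b_def)
      ultimately have av: "avg (\<lambda>x. \<bar>F r x\<bar> powr p) = (\<integral>x. indicator (cube 1) x * \<bar>F r (\<theta> *\<^sub>R x + lat k)\<bar> powr p \<partial>lborel)"
        using \<theta>0 by (simp add: avg_eq_lborel_integral)
      have "(\<integral>x. indicator (cube 1) x * \<bar>G r x\<bar> powr p \<partial>lborel) = (\<theta> ^ length (index_list r)) powr p * avg (\<lambda>x. \<bar>F r x\<bar> powr p)"
        unfolding av Gpow by (subst Bochner_Integration.integral_mult_right_zero[symmetric]) (simp add: mult.left_commute)
      also have "\<dots> \<le> T * avg (\<lambda>x. \<bar>F r x\<bar> powr p)"
      proof (intro mult_right_mono avg_nonneg)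
        have "length (index_list r) = (\<Sum>i\<in>UNIV. r $ i)" using mult_index_length[of "index_list r"] by simp
        also have "\<dots> \<le> CARD('n) * \<alpha>" using sum_bounded_above[of UNIV "\<lambda>i. r $ i" \<alpha>] r by (simp add: index_box_def)
        finally have "\<theta> ^ length (index_list r) \<le> \<theta> ^ (CARD('n) * \<alpha>)" using \<theta> by (intro power_increasing) auto
        then show "(\<theta> ^ length (index_list r)) powr p \<le> T" unfolding T_def using \<theta>0 p0 by (intro powr_mono2) auto
      qed simp
      finally show ?thesis .
    qed
    have norm_pow: "sobolev_norm \<alpha> p (cube 1) lebesgue (G 0) powr p \<le> T * K * (e powr p * N)"
    proof -
      have "sobolev_norm \<alpha> p (cube 1) lebesgue (G 0) powr p = (\<Sum>r\<in>index_box \<alpha>. \<integral>x. indicator (cube 1) x * \<bar>G r x\<bar> powr p \<partial>lborel)"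
        unfolding cube_def by (rule cube_sobolev_norm[OF eta p0]) (use wG mult_index_of_index_list in blast)
      also have "\<dots> \<le> T * sob_sum \<alpha> p F"
        unfolding sob_sum_def sum_distrib_left by (intro sum_mono cubeint)
      also have "\<dots> \<le> T * (K * (e powr p * N))" by (intro mult_left_mono sumF T0)
      finally show ?thesis by (simp add: mult.assoc)
    qed
    have root: "y \<le> c powr (1 / p) * e * N powr (1 / p)" if y: "0 \<le> y" "y powr p \<le> c * (e powr p * N)" "0 \<le> c" for y c
    proof -
      have "y = (y powr p) powr (1 / p)" using y(1) p0 by (simp add: powr_powr)
      also have "\<dots> \<le> (c * (e powr p * N)) powr (1 / p)" using y p0 by (intro powr_mono2) auto
      also have "\<dots> = c powr (1 / p) * e * N powr (1 / p)"
        using y(3) e0 N0 p0 by (simp add: powr_mult powr_powr)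
      finally show ?thesis .
    qed
    have eN: "0 \<le> e * N powr (1 / p)" using e0 by simp
    have norm_le: "sobolev_norm \<alpha> p (cube 1) lebesgue (G 0) \<le> C * e * N powr (1 / p)"
    proof -
      have "sobolev_norm \<alpha> p (cube 1) lebesgue (G 0) \<le> (T * K) powr (1 / p) * (e * N powr (1 / p))"
        using root[OF sobolev_norm_nonneg norm_pow] T0 K0 by (simp add: mult.assoc)
      also have "\<dots> \<le> C * (e * N powr (1 / p))"
        using \<theta>0 by (intro mult_right_mono eN) (simp add: C_def)
      finally show ?thesis by (simp add: mult.assoc)
    qed
    have int_le: "\<bar>\<integral>x. F 0 x \<partial>lborel\<bar> \<le> C * e * N powr (1 / p)"
    proof -
      have ind: "indicator (cbox a b) x * F 0 x = F 0 x" for x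
        using off[of x 0] supp_cube by (cases "x \<in> cbox a b") auto
      then have eq: "(\<integral>x. F 0 x \<partial>lborel) = \<theta> ^ CARD('n) * avg (F 0)" unfolding avg_eq_lborel_integral ind using \<theta>0 by simp
      have "\<bar>avg (F 0)\<bar> powr p \<le> avg (\<lambda>x. \<bar>F 0 x\<bar> powr p)"
        by (rule avg_jensen_loc_int[OF p1 weak_system_loc_int[OF F z] Fp[OF z]])
      also have "\<dots> \<le> sob_sum \<alpha> p F"
        unfolding sob_sum_def by (rule member_le_sum[OF z, where f="\<lambda>r. avg (\<lambda>x. \<bar>F r x\<bar> powr p)"]) (auto intro: avg_nonneg finite_index_box)
      also note sumF
      finally have "\<bar>avg (F 0)\<bar> \<le> K powr (1 / p) * (e * N powr (1 / p))"
        using root[of "\<bar>avg (F 0)\<bar>" K] K0 by (simp add: mult.assoc)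
      then have "\<theta> ^ CARD('n) * \<bar>avg (F 0)\<bar> \<le> \<theta> ^ CARD('n) * (K powr (1 / p) * (e * N powr (1 / p)))"
        using \<theta>0 by (intro mult_left_mono) auto
      also have "\<dots> = (\<theta> ^ CARD('n) * K powr (1 / p)) * (e * N powr (1 / p))" by simp
      also have "\<dots> \<le> C * (e * N powr (1 / p))"
        by (intro mult_right_mono eN) (simp add: C_def)
      finally show ?thesis using \<theta>0 by (simp add: eq abs_mult mult.assoc)
    qed
    show "(\<lambda>x. prod_family (prod_family u gauss_density) (\<phi> k) 0 (\<theta> *\<^sub>R x + lat k)) \<in> sobolev_space_cube0 \<alpha> p \<and>
       sobolev_norm \<alpha> p (cube 1) lebesgue (\<lambda>x. prod_family (prod_family u gauss_density) (\<phi> k) 0 (\<theta> *\<^sub>R x + lat k))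
         \<le> C * exp (- \<delta> * (norm (lat k))\<^sup>2) * (\<Sum>r\<in>index_box \<alpha>. \<integral>x. \<bar>u r x\<bar> powr p * gauss_density x \<partial>lborel) powr (1 / p) \<and>
       \<bar>\<integral>x. prod_family (prod_family u gauss_density) (\<phi> k) 0 x \<partial>lborel\<bar>
         \<le> C * exp (- \<delta> * (norm (lat k))\<^sup>2) * (\<Sum>r\<in>index_box \<alpha>. \<integral>x. \<bar>u r x\<bar> powr p * gauss_density x \<partial>lborel) powr (1 / p)"
      using member norm_le int_le unfolding G0 F_def v_def e_def N_def by blast
    qed
  qed
qed

section \<open>The error of the assembled quadrature\<close>

text \<open>
  Two continuous functions that agree almost everywhere agree on a closed set of full measure.
\<close>

lemma cont_rep_eq:
  assumes h: "continuous_on UNIV h" and eq: "AE x in lborel. h x = f x"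
  shows "cont_rep f = h"
proof -
  have "continuous_on UNIV h \<and> (AE x in lebesgue. h x = f x)" using assms AE_completion by blast
  then have c: "continuous_on UNIV (cont_rep f) \<and> (AE x in lebesgue. cont_rep f x = f x)"
    unfolding cont_rep_def by (rule someI[where P="\<lambda>h. continuous_on UNIV h \<and> (AE x in lebesgue. h x = f x)"])
  have "AE x in lebesgue. x \<in> {x. cont_rep f x = h x}"
    using conjunct2[OF c] AE_completion[OF eq] by eventually_elim simp
  moreover have "closed {x. cont_rep f x = h x}" by (rule closed_Collect_eq[OF conjunct1[OF c] h])
  ultimately have "x \<in> {x. cont_rep f x = h x}" for x by (intro mem_closed_if_AE_lebesgue)
  then show ?thesis by (simp add: fun_eq_iff)
qed

lemma AE_lborel_affine_eq:
  fixes f g :: "'a::euclidean_space \<Rightarrow> real"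
  assumes [measurable]: "f \<in> borel_measurable borel" "g \<in> borel_measurable borel" and eq: "AE x in lborel. f x = g x" and c: "c \<noteq> 0"
  shows "AE x in lborel. f (c *\<^sub>R x + t) = g (c *\<^sub>R x + t)"
proof -
  have "(\<integral>\<^sup>+x. ennreal \<bar>f x - g x\<bar> \<partial>lborel) = 0"
    by (subst nn_integral_0_iff_AE) (measurable, use eq in eventually_elim, simp)
  then have *: "ennreal (\<bar>c\<bar> ^ DIM('a)) * (\<integral>\<^sup>+x. ennreal \<bar>f (c *\<^sub>R x + t) - g (c *\<^sub>R x + t)\<bar> \<partial>lborel) = 0"
    using nn_integral_lborel_affine[of "\<lambda>x. ennreal \<bar>f x - g x\<bar>" c t] c by simp
  have "(\<integral>\<^sup>+x. ennreal \<bar>f (c *\<^sub>R x + t) - g (c *\<^sub>R x + t)\<bar> \<partial>lborel) = 0"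
  proof -
    have "0 < \<bar>c\<bar> ^ DIM('a)" using c by simp
    then have "ennreal (\<bar>c\<bar> ^ DIM('a)) \<noteq> 0" by (metis ennreal_eq_0_iff not_le)
    then show ?thesis using * by simp
  qed
  then have "AE x in lborel. ennreal \<bar>f (c *\<^sub>R x + t) - g (c *\<^sub>R x + t)\<bar> = 0"
    by (subst (asm) nn_integral_0_iff_AE) auto
  then show ?thesis by eventually_elim (simp add: ennreal_eq_0_iff)
qed

lemma integrable_gauss_density: "integrable lborel (gauss_density :: real^'n \<Rightarrow> real)"
proof -
  define c where "c = (2 * pi) powr (- (real CARD('n) / 2))"
  have f1: "(\<integral>\<^sup>+s. ennreal (exp (- (s::real)\<^sup>2 / 2)) \<partial>lborel) < \<infinity>"
  proof -
    have "integrable lborel (\<lambda>s. sqrt (2 * pi) * std_normal_density s)" by (intro integrable_mult_right integrable_normal_density) simp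
    then have "integrable lborel (\<lambda>s::real. exp (- s\<^sup>2 / 2))" by (simp add: std_normal_density_def)
    then show ?thesis by (simp add: integrable_iff_bounded)
  qed
  have eq: "exp (- (norm x)\<^sup>2 / 2) = (\<Prod>b\<in>Basis. exp (- (x \<bullet> b)\<^sup>2 / 2))" for x :: "real^'n"
  proof -
    have "- (norm x)\<^sup>2 / 2 = (\<Sum>b\<in>Basis. - (x \<bullet> b)\<^sup>2 / 2)"
      unfolding power2_norm_eq_inner by (subst euclidean_inner) (simp add: power2_eq_square sum_divide_distrib sum_negf)
    then show ?thesis by (simp only: exp_sum finite_Basis)
  qed
  have "(\<integral>\<^sup>+x. ennreal (exp (- (norm (x :: real^'n))\<^sup>2 / 2)) \<partial>lborel) = (\<integral>\<^sup>+x. (\<Prod>b\<in>Basis. ennreal (exp (- ((x :: real^'n) \<bullet> b)\<^sup>2 / 2))) \<partial>lborel)"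
    by (simp only: eq prod_ennreal exp_ge_zero)
  also have "\<dots> = (\<Prod>b\<in>(Basis :: (real^'n) set). \<integral>\<^sup>+s. ennreal (exp (- (s::real)\<^sup>2 / 2)) \<partial>lborel)"
    by (rule nn_integral_lborel_prod) auto
  also have "\<dots> < \<infinity>" using f1 by (auto simp: less_top[symmetric] power_eq_top_ennreal)
  finally have "integrable lborel (\<lambda>x :: real^'n. exp (- (norm x)\<^sup>2 / 2))" by (simp add: integrable_iff_bounded)
  then show ?thesis unfolding gauss_density_def[abs_def] by (rule integrable_mult_right)
qed

lemma integrable_gauss_of_powr:
  assumes p: "1 \<le> p" and m: "u \<in> borel_measurable borel" and i: "integrable lborel (\<lambda>x. \<bar>u x\<bar> powr p * gauss_density (x :: real^'n))"
  shows "integrable lborel (\<lambda>x. u x * gauss_density x)"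
proof (rule Bochner_Integration.integrable_bound[OF Bochner_Integration.integrable_add[OF integrable_gauss_density i]])
  show "(\<lambda>x. u x * gauss_density x) \<in> borel_measurable lborel" using m by measurable
  have "\<bar>u x\<bar> \<le> 1 + \<bar>u x\<bar> powr p" for x
  proof (cases "\<bar>u x\<bar> \<le> 1")
    case False
    then have "\<bar>u x\<bar> powr 1 \<le> \<bar>u x\<bar> powr p" using p by (intro powr_mono) auto
    then show ?thesis by simp
  qed (simp add: add_increasing2)
  then have le: "\<bar>u x\<bar> * gauss_density x \<le> (1 + \<bar>u x\<bar> powr p) * gauss_density x" for x
    using gauss_density_pos[of x] by (intro mult_right_mono) auto
  then show "AE x in lborel. norm (u x * gauss_density x) \<le> norm (gauss_density x + \<bar>u x\<bar> powr p * gauss_density x)"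
  proof (intro AE_I2)
    fix x :: "real^'n"
    have g: "0 \<le> gauss_density x" using gauss_density_pos[of x] by simp
    then have "norm (gauss_density x + \<bar>u x\<bar> powr p * gauss_density x) = (1 + \<bar>u x\<bar> powr p) * gauss_density x"
      by (simp add: distrib_right)
    then show "norm (u x * gauss_density x) \<le> norm (gauss_density x + \<bar>u x\<bar> powr p * gauss_density x)"
      using le[of x] g by (simp add: abs_mult)
  qed
qed

lemma ell_ge_1: "1 \<le> ell t" and ell_mono: "0 < s \<Longrightarrow> s \<le> t \<Longrightarrow> ell s \<le> ell t"
  unfolding ell_def by (simp, intro max.mono order_refl) simp

text \<open>
  The power \<open>- a\<close> of the number of nodes grows like \<open>exp (\<delta> |k|\<^sup>2 / 2)\<close>, which spends half of the
  decay \<open>exp (- \<delta> |k|\<^sup>2)\<close>.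
\<close>

lemma node_rate:
  fixes k :: "int^'n"
  assumes a: "0 < a" and b: "0 \<le> b" and \<delta>: "0 < \<delta>" and n: "1 \<le> n" and k: "norm (lat k) < xi a \<delta> n" and nk: "1 \<le> n_at a \<delta> n k"
  shows "n_at a \<delta> n k powr (- a) * ell (n_at a \<delta> n k) powr b * exp (- \<delta> * (norm (lat k))\<^sup>2)
     \<le> node_density TYPE('n) a \<delta> powr (- a) * (n powr (- a) * ell n powr b) * exp (- (\<delta> / 2) * (norm (lat k))\<^sup>2)"
proof -
  let ?d = "node_density TYPE('n) a \<delta>" and ?s = "(norm (lat k))\<^sup>2"
  have d: "0 < ?d" "?d \<le> 1" using node_density_pos[OF a \<delta>] node_density_le[OF a \<delta>] by auto
  have eq: "n_at a \<delta> n k = ?d * n * exp (- (\<delta> / (2 * a)) * ?s)" by (rule n_at_eq[OF k])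
  have "?d * n * exp (- (\<delta> / (2 * a)) * ?s) \<le> 1 * n * 1"
    using d n a \<delta> by (intro mult_mono) auto
  then have le: "n_at a \<delta> n k \<le> n" by (simp add: eq)
  have "n_at a \<delta> n k powr (- a) = ?d powr (- a) * n powr (- a) * exp (\<delta> / 2 * ?s)"
    using d n a by (simp add: eq powr_mult) (simp add: powr_def)
  moreover have "exp (\<delta> / 2 * ?s) * exp (- \<delta> * ?s) = exp (- (\<delta> / 2) * ?s)"
    by (simp add: exp_add[symmetric])
  ultimately have "n_at a \<delta> n k powr (- a) * exp (- \<delta> * ?s) = ?d powr (- a) * n powr (- a) * exp (- (\<delta> / 2) * ?s)"
    by (simp only: mult.assoc)
  moreover have "ell (n_at a \<delta> n k) powr b \<le> ell n powr b"
    using ell_mono[OF _ le] nk b ell_ge_1[of "n_at a \<delta> n k"] by (intro powr_mono2) auto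
  ultimately have "ell (n_at a \<delta> n k) powr b * (n_at a \<delta> n k powr (- a) * exp (- \<delta> * ?s)) \<le> ell n powr b * (?d powr (- a) * n powr (- a) * exp (- (\<delta> / 2) * ?s))"
    by (simp only:) (rule mult_right_mono, auto)
  then show ?thesis by (simp only: mult_ac)
qed

text \<open>
  There are two reasons for a cube to get no node. If \<open>|k| \<ge> \<xi>\<^sub>n\<close>, then \<open>exp (- \<delta> |k|\<^sup>2 / 2) \<le> n\<^sup>-\<^sup>a\<close>
  by the choice of \<open>\<xi>\<^sub>n\<close>; otherwise \<open>\<rho> n exp (- \<delta> |k|\<^sup>2 / (2a)) < 1\<close>, whose \<open>a\<close>-th power
  bounds \<open>exp (- \<delta> |k|\<^sup>2 / 2)\<close> by \<open>\<rho>\<^sup>-\<^sup>a n\<^sup>-\<^sup>a\<close>. The other half of the decay is kept.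
\<close>

lemma tail_rate:
  fixes k :: "int^'n"
  assumes a: "0 < a" and b: "0 \<le> b" and \<delta>: "0 < \<delta>" and n: "1 \<le> n" and nk: "n_at a \<delta> n k < 1"
  shows "exp (- \<delta> * (norm (lat k))\<^sup>2)
     \<le> node_density TYPE('n) a \<delta> powr (- a) * (n powr (- a) * ell n powr b) * exp (- (\<delta> / 2) * (norm (lat k))\<^sup>2)"
proof -
  let ?d = "node_density TYPE('n) a \<delta>" and ?s = "(norm (lat k))\<^sup>2"
  have d: "0 < ?d" "?d \<le> 1" using node_density_pos[OF a \<delta>] node_density_le[OF a \<delta>] by auto
  have key: "exp (- (\<delta> / 2) * ?s) \<le> ?d powr (- a) * n powr (- a)"
  proof (cases "norm (lat k) < xi a \<delta> n")
    case True
    let ?E = "exp (- (\<delta> / (2 * a)) * ?s)"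
    have "?d * n * ?E < 1" using nk n_at_eq[OF True] by simp
    then have "(?d * n * ?E) powr a \<le> 1 powr a" using d n a by (intro powr_mono2) auto
    moreover have "?E powr a = exp (- (\<delta> / 2) * ?s)" using a by (simp add: powr_def)
    ultimately have "?d powr a * n powr a * exp (- (\<delta> / 2) * ?s) \<le> 1" using d n by (simp add: powr_mult)
    then show ?thesis using d n by (simp add: powr_minus field_simps)
  next
    case False
    have "xi a \<delta> n ^ 2 \<le> (norm (lat k)) ^ 2" using False a \<delta> n by (intro power_mono) (auto simp: xi_def)
    then have "2 * a * inverse \<delta> * ln n \<le> ?s" using a \<delta> n by (simp add: xi_def)
    then have "a * ln n \<le> \<delta> / 2 * ?s" using \<delta> by (simp add: field_simps)
    then have "exp (- (\<delta> / 2) * ?s) \<le> exp (- a * ln n)" by simp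
    also have "\<dots> = 1 * n powr (- a)" using n by (simp add: powr_def)
    also have "\<dots> \<le> ?d powr (- a) * n powr (- a)"
      using d a by (intro mult_right_mono) (auto simp: powr_minus one_le_inverse_iff powr_le_one_le powr_le1)
    finally show ?thesis .
  qed
  have "1 \<le> ell n powr b" using ell_ge_1[of n] b by (simp add: ge_one_powr_ge_zero)
  then have "exp (- (\<delta> / 2) * ?s) * 1 \<le> (?d powr (- a) * n powr (- a)) * ell n powr b"
    by (intro mult_mono key) auto
  then have le: "exp (- (\<delta> / 2) * ?s) * exp (- (\<delta> / 2) * ?s) \<le> (?d powr (- a) * n powr (- a)) * ell n powr b * exp (- (\<delta> / 2) * ?s)"
    by (intro mult_right_mono) auto
  have eq: "exp (- (\<delta> / 2) * ?s) * exp (- (\<delta> / 2) * ?s) = exp (- \<delta> * ?s)" by (simp add: exp_add[symmetric])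
  show ?thesis using le unfolding eq by (simp only: mult.assoc)
qed

theorem theorem2p2:
  fixes \<alpha> :: nat and p a b \<theta> \<tau> \<delta> :: real
    and X :: "nat \<Rightarrow> nat \<Rightarrow> real ^ 'n" and \<Lambda> :: "nat \<Rightarrow> nat \<Rightarrow> real"
    and \<phi> :: "int ^ 'n \<Rightarrow> real ^ 'n \<Rightarrow> real"
  assumes "\<alpha> \<ge> 1" and "1 < p" and "a > 0" and "b \<ge> 0" and "\<theta> > 1"
    and nodes: "\<And>N i. 1 \<le> i \<Longrightarrow> i \<le> N \<Longrightarrow> X N i \<in> box (\<chi> j. - 1 / 2) (\<chi> j. 1 / 2)"
    and quad: "\<exists>C. \<forall>m::real. m \<ge> 1 \<longrightarrow> (\<forall>f \<in> sobolev_space_cube0 \<alpha> p.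
        \<bar>(LINT x:cube 1|lebesgue. f x) - quadrature X \<Lambda> m (cont_rep f)\<bar>
          \<le> C * m powr (- a) * ell m powr b * sobolev_norm \<alpha> p (cube 1) lebesgue f)"
    and partition: "smooth_partition \<alpha> p \<theta> \<phi>"
    and "1 < \<tau>" and "\<tau> < p" and "\<delta> > 0"
    and decay: "decay_condition TYPE('n) p \<theta> \<tau> \<delta>"
  shows "(\<exists>C'>0. \<forall>n::real. n \<ge> 1 \<longrightarrow> (\<forall>f \<in> sobolev_space \<alpha> p UNIV gauss_measure.
        \<bar>(LINT x|gauss_measure. f x) - assembled_quadrature a \<delta> \<theta> \<phi> X \<Lambda> n (cont_rep f)\<bar>
          \<le> C' * n powr (- a) * ell n powr b * sobolev_norm \<alpha> p UNIV gauss_measure f))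
    \<and> (\<forall>n::real. n \<ge> 1 \<longrightarrow>
          real (\<Sum>k :: int ^ 'n | norm (lat k) < xi a \<delta> n. nat \<lfloor>n_at a \<delta> n k\<rfloor>) \<le> n)"
proof (intro conjI allI impI)
  show "real (\<Sum>k :: int ^ 'n | norm (lat k) < xi a \<delta> n. nat \<lfloor>n_at a \<delta> n k\<rfloor>) \<le> n" if "1 \<le> n" for n
    by (rule number_of_nodes[OF \<open>a > 0\<close> \<open>\<delta> > 0\<close> that])
next
  note \<alpha> = \<open>\<alpha> \<ge> 1\<close> and p = \<open>1 < p\<close> and a = \<open>a > 0\<close> and b = \<open>b \<ge> 0\<close> and \<theta> = \<open>\<theta> > 1\<close> and \<delta> = \<open>\<delta> > 0\<close>
  have \<theta>0: "0 < \<theta>" "\<theta> \<noteq> 0" and p0: "0 < p" using \<theta> p by auto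
  obtain \<eta> :: "real^'n \<Rightarrow> real" where eta: "mollifier \<eta>" using partition_mollifier[OF partition] by blast
  have \<delta>': "\<delta> < (1 - 1 / p) / 2" by (rule decay_condition_exponent[OF decay p \<theta>0(1)])
  obtain Cq where Cq: "\<And>m f. 1 \<le> m \<Longrightarrow> f \<in> sobolev_space_cube0 \<alpha> p \<Longrightarrow>
      \<bar>(LINT x:cube 1|lebesgue. f x) - quadrature X \<Lambda> m (cont_rep f)\<bar> \<le> Cq * m powr (- a) * ell m powr b * sobolev_norm \<alpha> p (cube 1) lebesgue f"
    using quad by blast
  obtain C where C: "0 \<le> C" and loc: "\<And>k u. weak_system \<alpha> u \<Longrightarrow> (\<forall>r\<in>index_box \<alpha>. integrable lborel (\<lambda>x. \<bar>u r x\<bar> powr p * gauss_density x)) \<Longrightarrow>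
     (\<lambda>x. prod_family (prod_family u gauss_density) (\<phi> k) 0 (\<theta> *\<^sub>R x + lat k)) \<in> sobolev_space_cube0 \<alpha> p \<and>
     sobolev_norm \<alpha> p (cube 1) lebesgue (\<lambda>x. prod_family (prod_family u gauss_density) (\<phi> k) 0 (\<theta> *\<^sub>R x + lat k))
       \<le> C * exp (- \<delta> * (norm (lat k))\<^sup>2) * (\<Sum>r\<in>index_box \<alpha>. \<integral>x. \<bar>u r x\<bar> powr p * gauss_density x \<partial>lborel) powr (1 / p) \<and>
     \<bar>\<integral>x. prod_family (prod_family u gauss_density) (\<phi> k) 0 x \<partial>lborel\<bar>
       \<le> C * exp (- \<delta> * (norm (lat k))\<^sup>2) * (\<Sum>r\<in>index_box \<alpha>. \<integral>x. \<bar>u r x\<bar> powr p * gauss_density x \<partial>lborel) powr (1 / p)"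
    using localized_norm[OF partition p \<alpha> \<theta> \<delta> \<delta>'] by blast
  \<comment> \<open>the first summand comes from the quadrature, the summand 1 covers the cubes without nodes, and the last factor is \<open>\<rho>\<^sup>-\<^sup>a\<close>\<close>
  define D where "D = (\<theta> ^ CARD('n) * \<bar>Cq\<bar> + 1) * C * node_density TYPE('n) a \<delta> powr (- a)"
  have D0: "0 \<le> D" using C \<theta>0 by (simp add: D_def)
  \<comment> \<open>the bound for the sum of \<open>exp (- \<delta> |k|\<^sup>2 / 2)\<close> over the lattice\<close>
  define Z where "Z = (2 / (1 - exp (- (\<delta> / 2)))) ^ CARD('n)"
  have Z0: "0 \<le> Z" using \<delta> by (simp add: Z_def)
  have main: "\<bar>(LINT x|gauss_measure. f x) - assembled_quadrature a \<delta> \<theta> \<phi> X \<Lambda> n (cont_rep f)\<bar>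
          \<le> (D * Z + 1) * n powr (- a) * ell n powr b * sobolev_norm \<alpha> p UNIV gauss_measure f"
    if n: "1 \<le> n" and f: "f \<in> sobolev_space \<alpha> p UNIV gauss_measure" for n and f :: "real^'n \<Rightarrow> real"
  proof -
    obtain u where u: "\<And>r. r \<in> index_box \<alpha> \<Longrightarrow> loc_int (u r)" "AE x in lborel. f x = u 0 x"
      "\<And>is. mult_index is \<in> index_box \<alpha> \<Longrightarrow> wderiv is (u 0) (u (mult_index is))"
      "\<And>r. r \<in> index_box \<alpha> \<Longrightarrow> integrable lborel (\<lambda>x. \<bar>u r x\<bar> powr p * gauss_density x)"
      "sobolev_norm \<alpha> p UNIV gauss_measure f powr p = (\<Sum>r\<in>index_box \<alpha>. \<integral>x. \<bar>u r x\<bar> powr p * gauss_density x \<partial>lborel)"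
      "f \<in> borel_measurable lebesgue"
      using gauss_sobolev_data[OF eta p0 f] by blast
    have sys: "weak_system \<alpha> u" using u(3) by (simp add: weak_system_def)
    have z: "(0 :: nat^'n) \<in> index_box \<alpha>" by (simp add: index_box_def)
    note [measurable] = loc_int_measurable[OF u(1)[OF z]]
    define nf where "nf = sobolev_norm \<alpha> p UNIV gauss_measure f"
    have nf0: "0 \<le> nf" unfolding nf_def by (rule sobolev_norm_nonneg)
    have nf: "(\<Sum>r\<in>index_box \<alpha>. \<integral>x. \<bar>u r x\<bar> powr p * gauss_density x \<partial>lborel) powr (1 / p) = nf"
      unfolding u(5)[symmetric] using p0 nf0 by (simp add: powr_powr nf_def)
    obtain h where h: "continuous_on UNIV h" "AE x in lborel. h x = u 0 x"
      using continuous_representative[OF eta weak_family_mono[OF weak_system_family[OF sys] \<alpha>]] by blast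
    note [measurable] = borel_measurable_continuous_onI[OF h(1)]
    have hf: "cont_rep f = h"
      by (rule cont_rep_eq[OF h(1)]) (use h(2) u(2) in eventually_elim, simp)
    have \<phi>t: "\<phi> k \<in> test_functions UNIV" and \<phi>0: "0 \<le> \<phi> k x" for k x
      using partition by (auto simp: smooth_partition_def)
    have \<phi>c: "continuous_on UNIV (\<phi> k)" for k using smooth_continuous test_functionsD(1)[OF \<phi>t] by blast
    note [measurable] = borel_measurable_continuous_onI[OF \<phi>c]
    define F where "F k x = u 0 x * gauss_density x * \<phi> k x" for k x
    have F_eq: "prod_family (prod_family u gauss_density) (\<phi> k) 0 = F k" for k
      by (rule ext) (simp add: prod_family_0 F_def)
    have [measurable]: "F k \<in> borel_measurable borel" for k unfolding F_def by measurable
    define e where "e k = exp (- \<delta> * (norm (lat k))\<^sup>2)" for k :: "int^'n"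
    have member: "(\<lambda>x. F k (\<theta> *\<^sub>R x + lat k)) \<in> sobolev_space_cube0 \<alpha> p"
      and normG: "sobolev_norm \<alpha> p (cube 1) lebesgue (\<lambda>x. F k (\<theta> *\<^sub>R x + lat k)) \<le> C * e k * nf"
      and intF: "\<bar>\<integral>x. F k x \<partial>lborel\<bar> \<le> C * e k * nf" for k
      using loc[OF sys, of k] u(4) unfolding F_eq nf e_def by auto
    define q where "q k = (let N = nat \<lfloor>n_at a \<delta> n k\<rfloor> in \<Sum>j = 1..N. let x = \<theta> *\<^sub>R X N j + lat k in
          (\<theta> ^ CARD('n) * \<Lambda> N j * gauss_density x * \<phi> k x) * h x)" for k
    have quad_k: "\<bar>(\<integral>x. F k x \<partial>lborel) - q k\<bar> \<le> \<theta> ^ CARD('n) * \<bar>Cq\<bar> * n_at a \<delta> n k powr (- a) * ell (n_at a \<delta> n k) powr b * (C * e k * nf)"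
      if nk: "1 \<le> n_at a \<delta> n k" for k
    proof -
      let ?G = "\<lambda>x. F k (\<theta> *\<^sub>R x + lat k)" and ?m = "n_at a \<delta> n k"
      have c: "continuous_on UNIV (\<lambda>x. h x * gauss_density x * \<phi> k x)"
        by (intro continuous_on_mult h(1) gauss_density_continuous \<phi>c)
      have "AE x in lborel. h (\<theta> *\<^sub>R x + lat k) = u 0 (\<theta> *\<^sub>R x + lat k)"
        by (rule AE_lborel_affine_eq[OF _ _ h(2) \<theta>0(2)]) measurable
      \<comment> \<open>the nodes of the assembled rule evaluate the representative \<open>h\<close> of \<open>f\<close>\<close>
      then have rep: "cont_rep ?G = (\<lambda>x. (\<lambda>x. h x * gauss_density x * \<phi> k x) (\<theta> *\<^sub>R x + lat k))"
      proof (intro cont_rep_eq)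
        show "continuous_on UNIV (\<lambda>x. (\<lambda>x. h x * gauss_density x * \<phi> k x) (\<theta> *\<^sub>R x + lat k))"
          by (rule continuous_on_compose2[OF c]) (auto intro!: continuous_intros)
        assume "AE x in lborel. h (\<theta> *\<^sub>R x + lat k) = u 0 (\<theta> *\<^sub>R x + lat k)"
        then show "AE x in lborel. (\<lambda>x. h x * gauss_density x * \<phi> k x) (\<theta> *\<^sub>R x + lat k) = ?G x"
          by eventually_elim (simp add: F_def)
      qed
      have "AE x in lebesgue. x \<notin> cube 1 \<longrightarrow> ?G x = 0" using member[of k] by (simp add: sobolev_space_cube0_def)
      then have "AE x in lborel. indicator (cube 1) x *\<^sub>R ?G x = ?G x"
        unfolding AE_completion_iff by eventually_elim (auto simp: indicator_def)
      then have "(LINT x:cube 1|lebesgue. ?G x) = (\<integral>x. ?G x \<partial>lborel)"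
        unfolding set_lebesgue_integral_def by (intro integral_lebesgue_AE(1)) measurable
      moreover have "(\<integral>x. F k x \<partial>lborel) = \<bar>\<theta>\<bar> ^ DIM(real^'n) * (\<integral>x. ?G x \<partial>lborel)"
        by (rule integral_lborel_affine[OF \<theta>0(2)]) measurable
      ultimately have i: "(\<integral>x. F k x \<partial>lborel) = \<theta> ^ CARD('n) * (LINT x:cube 1|lebesgue. ?G x)" using \<theta>0 by simp
      have s: "q k = \<theta> ^ CARD('n) * quadrature X \<Lambda> ?m (cont_rep ?G)"
        by (simp add: q_def quadrature_def rep Let_def sum_distrib_left mult_ac)
      have "\<bar>(\<integral>x. F k x \<partial>lborel) - q k\<bar> = \<theta> ^ CARD('n) * \<bar>(LINT x:cube 1|lebesgue. ?G x) - quadrature X \<Lambda> ?m (cont_rep ?G)\<bar>"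
        using \<theta>0 by (simp add: i s right_diff_distrib[symmetric] abs_mult)
      also have "\<dots> \<le> \<theta> ^ CARD('n) * (Cq * ?m powr (- a) * ell ?m powr b * sobolev_norm \<alpha> p (cube 1) lebesgue ?G)"
        using \<theta>0 by (intro mult_left_mono Cq[OF nk member]) auto
      also have "\<dots> \<le> \<theta> ^ CARD('n) * (\<bar>Cq\<bar> * ?m powr (- a) * ell ?m powr b * (C * e k * nf))"
        using \<theta>0 C by (intro mult_left_mono mult_mono normG sobolev_norm_nonneg) (auto simp: intro!: mult_nonneg_nonneg)
      finally show ?thesis by (simp add: mult_ac)
    qed
    define S where "S = {k :: int^'n. norm (lat k) < xi a \<delta> n}"
    \<comment> \<open>extended by 0 so that both sums run over the same lattice points\<close>
    define Q where "Q k = (if k \<in> S then q k else 0)" for k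
    define R where "R = n powr (- a) * ell n powr b"
    have R0: "0 \<le> R" by (simp add: R_def)
    have err: "\<bar>(\<integral>x. F k x \<partial>lborel) - Q k\<bar> \<le> D * R * nf * exp (- (\<delta> / 2) * (norm (lat k))\<^sup>2)" for k
    proof (cases "k \<in> S \<and> 1 \<le> n_at a \<delta> n k")
      case True
      then have kS: "norm (lat k) < xi a \<delta> n" by (simp add: S_def)
      have "\<bar>(\<integral>x. F k x \<partial>lborel) - Q k\<bar> \<le> \<theta> ^ CARD('n) * \<bar>Cq\<bar> * n_at a \<delta> n k powr (- a) * ell (n_at a \<delta> n k) powr b * (C * e k * nf)"
        using quad_k True by (simp add: Q_def)
      also have "\<dots> = (\<theta> ^ CARD('n) * \<bar>Cq\<bar> * C * nf) * (n_at a \<delta> n k powr (- a) * ell (n_at a \<delta> n k) powr b * e k)"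
        by (simp only: mult_ac)
      also have "\<dots> \<le> ((\<theta> ^ CARD('n) * \<bar>Cq\<bar> + 1) * C * nf) * (node_density TYPE('n) a \<delta> powr (- a) * R * exp (- (\<delta> / 2) * (norm (lat k))\<^sup>2))"
      proof (rule mult_mono)
        show "n_at a \<delta> n k powr (- a) * ell (n_at a \<delta> n k) powr b * e k \<le> node_density TYPE('n) a \<delta> powr (- a) * R * exp (- (\<delta> / 2) * (norm (lat k))\<^sup>2)"
          unfolding e_def R_def using True by (intro node_rate a b \<delta> n kS) simp
        show "\<theta> ^ CARD('n) * \<bar>Cq\<bar> * C * nf \<le> (\<theta> ^ CARD('n) * \<bar>Cq\<bar> + 1) * C * nf"
          using C nf0 by (intro mult_right_mono) auto
      qed (use C nf0 \<theta>0 in \<open>auto simp: e_def\<close>)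
      also have "\<dots> = D * R * nf * exp (- (\<delta> / 2) * (norm (lat k))\<^sup>2)" by (simp only: D_def mult_ac)
      finally show ?thesis .
    next
      case False
      \<comment> \<open>outside the ball \<open>S\<close> the number of nodes is 0 by definition\<close>
      have lt: "n_at a \<delta> n k < 1" using False by (cases "k \<in> S") (auto simp: S_def n_at_def)
      then have "\<lfloor>n_at a \<delta> n k\<rfloor> < 1" by (simp add: floor_less_iff)
      then have "nat \<lfloor>n_at a \<delta> n k\<rfloor> = 0" by linarith
      then have "q k = 0" by (simp add: q_def)
      then have "\<bar>(\<integral>x. F k x \<partial>lborel) - Q k\<bar> \<le> C * e k * nf" using intF[of k] by (simp add: Q_def)
      also have "\<dots> = C * nf * e k" by simp
      also have "\<dots> \<le> ((\<theta> ^ CARD('n) * \<bar>Cq\<bar> + 1) * C * nf) * (node_density TYPE('n) a \<delta> powr (- a) * R * exp (- (\<delta> / 2) * (norm (lat k))\<^sup>2))"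
      proof (rule mult_mono)
        show "e k \<le> node_density TYPE('n) a \<delta> powr (- a) * R * exp (- (\<delta> / 2) * (norm (lat k))\<^sup>2)"
          unfolding e_def R_def by (intro tail_rate a b \<delta> n lt)
        have "1 * C * nf \<le> (\<theta> ^ CARD('n) * \<bar>Cq\<bar> + 1) * C * nf"
          using C nf0 \<theta>0 by (intro mult_right_mono) auto
        then show "C * nf \<le> (\<theta> ^ CARD('n) * \<bar>Cq\<bar> + 1) * C * nf" by simp
      qed (use C nf0 \<theta>0 in \<open>auto simp: e_def\<close>)
      also have "\<dots> = D * R * nf * exp (- (\<delta> / 2) * (norm (lat k))\<^sup>2)" by (simp only: D_def mult_ac)
      finally show ?thesis .
    qed
    define A where "A = assembled_quadrature a \<delta> \<theta> \<phi> X \<Lambda> n (cont_rep f)"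
    have A: "A = (\<Sum>k\<in>S. q k)" by (simp add: A_def assembled_quadrature_def hf q_def S_def)
    have ug: "integrable lborel (\<lambda>x. u 0 x * gauss_density x)"
      using p by (intro integrable_gauss_of_powr[OF _ _ u(4)[OF z]]) auto
    have Fint: "integrable lborel (F k)" for k
      unfolding F_def by (rule loc_int_mult_test[OF integrable_loc_int[OF ug] \<phi>t])
    let ?T = "\<lambda>N. {k :: int^'n. norm (lat k) < real N}"
    \<comment> \<open>the partial sums of the partition are bounded by 1, so dominated convergence applies\<close>
    have lim: "(\<lambda>N. \<Sum>k\<in>?T N. \<integral>x. F k x \<partial>lborel) \<longlonglongrightarrow> (\<integral>x. u 0 x * gauss_density x \<partial>lborel)"
    proof -
      have "(\<lambda>N. \<integral>x. u 0 x * gauss_density x * (\<Sum>k\<in>?T N. \<phi> k x) \<partial>lborel) \<longlonglongrightarrow> (\<integral>x. u 0 x * gauss_density x \<partial>lborel)"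
      proof (rule integral_dominated_convergence[where w="\<lambda>x. \<bar>u 0 x * gauss_density x\<bar>"])
        show "AE x in lborel. (\<lambda>N. u 0 x * gauss_density x * (\<Sum>k\<in>?T N. \<phi> k x)) \<longlonglongrightarrow> u 0 x * gauss_density x"
          using tendsto_mult[OF tendsto_const partition_finite_sums(2)[OF partition]] by (intro AE_I2) simp
        show "AE x in lborel. norm (u 0 x * gauss_density x * (\<Sum>k\<in>?T N. \<phi> k x)) \<le> \<bar>u 0 x * gauss_density x\<bar>" for N
        proof (intro AE_I2)
          fix x
          have "\<bar>\<Sum>k\<in>?T N. \<phi> k x\<bar> \<le> 1"
            using partition_finite_sums(1)[OF partition finite_lattice_ball, of x "real N"] \<phi>0 by (simp add: sum_nonneg)
          then show "norm (u 0 x * gauss_density x * (\<Sum>k\<in>?T N. \<phi> k x)) \<le> \<bar>u 0 x * gauss_density x\<bar>"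
            using mult_left_le[of "\<bar>\<Sum>k\<in>?T N. \<phi> k x\<bar>" "\<bar>u 0 x * gauss_density x\<bar>"] by (simp add: abs_mult)
        qed
      qed (use ug in \<open>auto intro!: integrable_abs\<close>)
      moreover have "(\<integral>x. u 0 x * gauss_density x * (\<Sum>k\<in>?T N. \<phi> k x) \<partial>lborel) = (\<Sum>k\<in>?T N. \<integral>x. F k x \<partial>lborel)" for N
        using Fint by (subst Bochner_Integration.integral_sum[symmetric]) (auto simp: F_def sum_distrib_left)
      ultimately show ?thesis by simp
    qed
    have ev: "eventually (\<lambda>N. \<bar>(\<Sum>k\<in>?T N. \<integral>x. F k x \<partial>lborel) - A\<bar> \<le> D * R * nf * Z) sequentially"
    proof -
      obtain N0 where N0: "xi a \<delta> n \<le> real N0" using real_arch_simple by blast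
      show ?thesis using eventually_ge_at_top[of N0]
      proof eventually_elim
        case (elim N)
        have sub: "S \<subseteq> ?T N" using N0 elim by (auto simp: S_def)
        have fin: "finite (?T N)" by (rule finite_lattice_ball)
        have "A = (\<Sum>k\<in>?T N. Q k)" unfolding A
          by (rule sum.mono_neutral_cong_left[OF fin sub]) (auto simp: Q_def)
        then have "\<bar>(\<Sum>k\<in>?T N. \<integral>x. F k x \<partial>lborel) - A\<bar> = \<bar>\<Sum>k\<in>?T N. (\<integral>x. F k x \<partial>lborel) - Q k\<bar>" by (simp add: sum_subtractf)
        also have "\<dots> \<le> (\<Sum>k\<in>?T N. \<bar>(\<integral>x. F k x \<partial>lborel) - Q k\<bar>)" by (rule sum_abs)
        also have "\<dots> \<le> (\<Sum>k\<in>?T N. D * R * nf * exp (- (\<delta> / 2) * (norm (lat k))\<^sup>2))" by (intro sum_mono err)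
        also have "\<dots> = D * R * nf * (\<Sum>k\<in>?T N. exp (- (\<delta> / 2) * (norm (lat k))\<^sup>2))" by (simp only: sum_distrib_left)
        also have "\<dots> \<le> D * R * nf * Z"
          unfolding Z_def using D0 R0 nf0 \<delta> by (intro mult_left_mono lattice_gauss_sum fin) auto
        finally show ?case .
      qed
    qed
    have "(\<lambda>N. \<bar>(\<Sum>k\<in>?T N. \<integral>x. F k x \<partial>lborel) - A\<bar>) \<longlonglongrightarrow> \<bar>(\<integral>x. u 0 x * gauss_density x \<partial>lborel) - A\<bar>"
      by (intro tendsto_intros lim)
    then have "\<bar>(\<integral>x. u 0 x * gauss_density x \<partial>lborel) - A\<bar> \<le> D * R * nf * Z"
      using ev by (rule tendsto_upperbound) simp
    also have "\<dots> = (D * Z) * (R * nf)" by (simp only: mult_ac)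
    also have "\<dots> \<le> (D * Z + 1) * (R * nf)" using R0 nf0 by (intro mult_right_mono) auto
    finally have "\<bar>(\<integral>x. u 0 x * gauss_density x \<partial>lborel) - A\<bar> \<le> (D * Z + 1) * (R * nf)" .
    moreover have "(LINT x|gauss_measure. f x) = (\<integral>x. u 0 x * gauss_density x \<partial>lborel)"
      by (rule gauss_integral(2)[OF u(6) _ u(2)]) measurable
    ultimately show ?thesis by (simp add: A_def R_def nf_def mult.assoc)
  qed
  \<comment> \<open>the summand 1 only makes the constant positive\<close>
  show "\<exists>C'>0. \<forall>n::real. n \<ge> 1 \<longrightarrow> (\<forall>f \<in> sobolev_space \<alpha> p UNIV gauss_measure.
        \<bar>(LINT x|gauss_measure. f x) - assembled_quadrature a \<delta> \<theta> \<phi> X \<Lambda> n (cont_rep f)\<bar>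
          \<le> C' * n powr (- a) * ell n powr b * sobolev_norm \<alpha> p UNIV gauss_measure f)"
    using main D0 Z0 by (intro exI[of _ "D * Z + 1"]) (auto intro: add_nonneg_pos)
qed

end
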